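(* Let $\mathcal C$ be a global (i.e. defined in the empty context) category in the internal language of the topos $\mathbf{cSet}$ of cartesian cubical sets, and assume that $\mathcal C$ is (algebraically) cofibrant and has fibrant components. Then $\mathcal C$ admits a strict Rezk completion: there exist a global category $\overline{\mathcal C}$ in $\mathbf{cSet}$ that has fibrant components and is complete, and a global functor $i:\mathcal C\to\overline{\mathcal C}$, such that the external functor $1_\square^\ast(i):1_\square^\ast(\mathcal C)\to1_\square^\ast(\overline{\mathcal C})$ is a weak equivalence of categories.
   Context: Cubical setting. $\square$ is the cartesian cube category: objects are finite sets, a morphism $J\to I$ is a function $I\to J\sqcup\{0,1\}$, with the evident composition; its terminal object is $1_\square=\emptyset$. $\mathbf{cSet}$ is the topos of presheaves on $\square$; "internally" refers to its internal extensional type theory, $\mathrm{Set}$ denotes a universe of types ("sets") of that language, $\Omega$ its propositions, and "global" means defined in the empty context. $\mathbb I$ is the interval (represented by a one-element set) with endpoints $0,1:\mathbb I$. $\mathrm{Cof}\subseteq\Omega$ is the set of cofibrations: the propositions inductively generated from equalities $(i=j)$, $i,j:\mathbb I$, by binary conjunction and disjunction (it contains $\top,\bot$ and is closed under $\forall i:\mathbb I$); $[\alpha]$ is the proposition associated to $\alpha:\mathrm{Cof}$. A path $x\sim y$ in $X$ is $p:\mathbb I\to X$ with $p(0)=x$, $p(1)=y$; $\mathrm{isContr}(X)=(x:X)\times((y:X)\to(x\sim y))$. A weak composition structure on a line $A:\mathbb I\to\mathrm{Set}$ (an element of $\mathrm{HasWCom}(A)$) gives, for all $r,s:\mathbb I$,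 $\alpha:\mathrm{Cof}$, $t:[\alpha]\to(s:\mathbb I)\to A(s)$, $b:A(r)$ with $[\alpha]\to t(r)=b$, an element $\mathrm{wcom}^{r\to s}(t,b):A(s)$ equal to $t(s)$ under $[\alpha]$, and a path $\mathrm{wcom}^{r\to r}(t,b)\sim b$ that is constant at $b$ under $[\alpha]$. A global family $B:A\to\mathrm{Set}$ over a global set $A$ is fibrant if there is a global element of $(a:A^{\mathbb I})\to\mathrm{HasWCom}(\lambda i.\,B(a(i)))$. $1_\square^\ast$ sends a global internal object to its external set of global elements (evaluation at $1_\square$); it preserves finite limits, hence sends global internal categories and functors to ordinary ones. Categories. A category $\mathcal C$ consists of a set $\mathrm{Ob}_{\mathcal C}$, sets $\mathrm{Hom}_{\mathcal C}(x,y)$, and, for parallel $f,g$, a proposition $\mathrm{EqHom}_{\mathcal C}(f,g)$ equivalent to $f=g$, with identities and composition satisfying the usual laws. $\mathrm{Iso}_{\mathcal C}(x,y)$ is the set of isomorphisms from $x$ to $y$. A functor is a split trivial fibration if its actions on objects, on morphisms $\mathrm{Hom}_{\mathcal C}(x,y)\to\mathrm{Hom}_{\mathcal D}(Fx,Fy)$, and on $\mathrm{EqHom}$ are split surjections. A functor is an algebraic cofibration if it is equipped with left liftings against all split trivial fibrations; $\mathcal C$ is algebraically cofibrant if $\emptyset\to\mathcal C$ is an algebraic cofibration. A functor between ordinary categories is a weak equivalence if it is essentially surjective and fully faithful. An internal category $\mathcal C$ has fibrant components if $\mathrm{Ob}_{\mathcal C}$, $\mathrm{Hom}_{\mathcal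 C}(-)$ and $\mathrm{EqHom}_{\mathcal C}(-)$ (as families over their indexing sets) are fibrant. A category $\mathcal C$ with fibrant components is complete if: for every $x\in\mathcal C$ the set $(y\in\mathcal C)\times\mathrm{Iso}_{\mathcal C}(x,y)$ is contractible; for every $f\in\mathcal C(x,y)$ the set $(g\in\mathcal C(x,y))\times\mathrm{EqHom}_{\mathcal C}(f,g)$ is contractible; and for every $p:\mathrm{EqHom}_{\mathcal C}(f,g)$ the set $\mathrm{EqHom}_{\mathcal C}(f,g)$ is contractible. *)

theory Defs
  imports Main "HOL-Library.FuncSet"
begin

section \<open>The cartesian cube category and its presheaves\<close>

text \<open>
  The objects of the cube category are finite sets; up to equivalence it suffices to take the finite
  subsets of \<^typ>\<open>nat\<close>. The set \<open>J \<squnion> {0,1}\<close> is \<open>ipts J\<close>. Since the interval is represented by a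
  one-element set, its set of elements at stage \<open>J\<close> is \<open>ipts J\<close> as well.
\<close>

type_synonym cube = "nat set"

datatype pt = Zero | One | Var nat

definition ipts :: "cube \<Rightarrow> pt set" where
  "ipts J = {Zero, One} \<union> Var ` J"

datatype arr = Arr (src: cube) (tgt: cube) (amap: "nat \<Rightarrow> pt")

text \<open>A morphism \<open>K \<rightarrow> J\<close> is a function in the opposite direction, \<open>J \<rightarrow> K \<squnion> {0,1}\<close>.\<close>

definition is_arr :: "arr \<Rightarrow> bool" where
  "is_arr f \<longleftrightarrow> finite (src f) \<and> finite (tgt f) \<and> amap f \<in> tgt f \<rightarrow>\<^sub>E ipts (src f)"

primrec pt_act :: "arr \<Rightarrow> pt \<Rightarrow> pt" where
  "pt_act f Zero = Zero"
| "pt_act f One = One"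
| "pt_act f (Var j) = amap f j"

definition cube_id :: "cube \<Rightarrow> arr" where
  "cube_id J = Arr J J (\<lambda>j\<in>J. Var j)"

text \<open>\<open>cube_comp f g\<close> is the composite of \<open>g : L \<rightarrow> K\<close> followed by \<open>f : K \<rightarrow> J\<close>.\<close>

definition cube_comp :: "arr \<Rightarrow> arr \<Rightarrow> arr" where
  "cube_comp f g = Arr (src g) (tgt f) (\<lambda>j\<in>tgt f. pt_act g (amap f j))"

record 'a psh =
  El :: "cube \<Rightarrow> 'a set"
  act :: "arr \<Rightarrow> 'a \<Rightarrow> 'a"

definition presheaf :: "'a psh \<Rightarrow> bool" where
  "presheaf X \<longleftrightarrow>
     (\<forall>f. is_arr f \<longrightarrow> (\<forall>x\<in>El X (tgt f). act X f x \<in> El X (src f))) \<and>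
     (\<forall>J. finite J \<longrightarrow> (\<forall>x\<in>El X J. act X (cube_id J) x = x)) \<and>
     (\<forall>f g. is_arr f \<and> is_arr g \<and> tgt g = src f \<longrightarrow>
        (\<forall>x\<in>El X (tgt f). act X (cube_comp f g) x = act X g (act X f x)))"

definition terminal_psh :: "unit psh" where
  "terminal_psh = \<lparr>El = \<lambda>J. {()}, act = \<lambda>f x. x\<rparr>"

definition yoneda :: "cube \<Rightarrow> arr psh" where
  "yoneda J = \<lparr>El = \<lambda>K. {f. is_arr f \<and> src f = K \<and> tgt f = J}, act = \<lambda>g f. cube_comp f g\<rparr>"

definition interval :: "pt psh" where
  "interval = \<lparr>El = ipts, act = pt_act\<rparr>"

section \<open>Types in context\<close>

text \<open>
  A context is a presheaf, and a type in context \<open>\<Gamma>\<close> (a family of sets indexed by \<open>\<Gamma>\<close>) is a presheaf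
  on the category of elements of \<open>\<Gamma>\<close>. A term in context \<open>\<Gamma>\<close> is a natural section; so a global element
  of a dependent product over \<open>\<Gamma>\<close> is a section over \<open>\<Gamma>\<close>. Definedness in the empty context
  is the case \<open>\<Gamma> = terminal_psh\<close>.
\<close>

record ('g, 'a) fam =
  Fib :: "cube \<Rightarrow> 'g \<Rightarrow> 'a set"
  tr :: "arr \<Rightarrow> 'g \<Rightarrow> 'a \<Rightarrow> 'a"

definition family :: "'g psh \<Rightarrow> ('g, 'a) fam \<Rightarrow> bool" where
  "family \<Gamma> A \<longleftrightarrow>
     (\<forall>f. is_arr f \<longrightarrow> (\<forall>\<gamma>\<in>El \<Gamma> (tgt f). \<forall>a\<in>Fib A (tgt f) \<gamma>.
        tr A f \<gamma> a \<in> Fib A (src f) (act \<Gamma> f \<gamma>))) \<and>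
     (\<forall>J. finite J \<longrightarrow> (\<forall>\<gamma>\<in>El \<Gamma> J. \<forall>a\<in>Fib A J \<gamma>. tr A (cube_id J) \<gamma> a = a)) \<and>
     (\<forall>f g. is_arr f \<and> is_arr g \<and> tgt g = src f \<longrightarrow>
        (\<forall>\<gamma>\<in>El \<Gamma> (tgt f). \<forall>a\<in>Fib A (tgt f) \<gamma>.
           tr A (cube_comp f g) \<gamma> a = tr A g (act \<Gamma> f \<gamma>) (tr A f \<gamma> a)))"

definition sect :: "'g psh \<Rightarrow> ('g, 'a) fam \<Rightarrow> (cube \<Rightarrow> 'g \<Rightarrow> 'a) \<Rightarrow> bool" where
  "sect \<Gamma> A \<sigma> \<longleftrightarrow>
     (\<forall>J. finite J \<longrightarrow> (\<forall>\<gamma>\<in>El \<Gamma> J. \<sigma> J \<gamma> \<in> Fib A J \<gamma>)) \<and>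
     (\<forall>f. is_arr f \<longrightarrow> (\<forall>\<gamma>\<in>El \<Gamma> (tgt f). tr A f \<gamma> (\<sigma> (tgt f) \<gamma>) = \<sigma> (src f) (act \<Gamma> f \<gamma>)))"

definition ext :: "'g psh \<Rightarrow> ('g, 'a) fam \<Rightarrow> ('g \<times> 'a) psh" where
  "ext \<Gamma> A = \<lparr>El = \<lambda>J. Sigma (El \<Gamma> J) (Fib A J), act = \<lambda>f (\<gamma>, a). (act \<Gamma> f \<gamma>, tr A f \<gamma> a)\<rparr>"

definition reindex :: "(cube \<Rightarrow> 'd \<Rightarrow> 'g) \<Rightarrow> ('g, 'a) fam \<Rightarrow> ('d, 'a) fam" where
  "reindex \<sigma> A = \<lparr>Fib = \<lambda>J \<delta>. Fib A J (\<sigma> J \<delta>), tr = \<lambda>f \<delta>. tr A f (\<sigma> (tgt f) \<delta>)\<rparr>"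

definition const_fam :: "'a psh \<Rightarrow> ('g, 'a) fam" where
  "const_fam X = \<lparr>Fib = \<lambda>J \<gamma>. El X J, tr = \<lambda>f \<gamma>. act X f\<rparr>"

definition sigma_fam :: "('g, 'a) fam \<Rightarrow> ('g \<times> 'a, 'b) fam \<Rightarrow> ('g, 'a \<times> 'b) fam" where
  "sigma_fam A B = \<lparr>Fib = \<lambda>J \<gamma>. SIGMA a : Fib A J \<gamma>. Fib B J (\<gamma>, a),
                    tr = \<lambda>f \<gamma> (a, b). (tr A f \<gamma> a, tr B f (\<gamma>, a) b)\<rparr>"

section \<open>Cofibrations\<close>

text \<open>
  The propositions \<open>\<Omega>\<close> at stage \<open>J\<close> are the sieves on \<open>J\<close>, and a proposition \<open>\<alpha>\<close> at stage \<open>J\<close> holds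
  after restriction along \<open>f\<close> iff \<open>f \<in> \<alpha>\<close>. Conjunction and disjunction are intersection and union.
  The stagewise inductive definition is stable under restriction, so it is the internal one.
\<close>

definition top_sieve :: "cube \<Rightarrow> arr set" where
  "top_sieve J = {f. is_arr f \<and> tgt f = J}"

definition eq_sieve :: "cube \<Rightarrow> pt \<Rightarrow> pt \<Rightarrow> arr set" where
  "eq_sieve J r s = {f \<in> top_sieve J. pt_act f r = pt_act f s}"

definition pull_sieve :: "arr \<Rightarrow> arr set \<Rightarrow> arr set" where
  "pull_sieve f \<alpha> = {g \<in> top_sieve (src f). cube_comp f g \<in> \<alpha>}"

inductive_set cof :: "cube \<Rightarrow> arr set set" for J where
  cof_eq: "r \<in> ipts J \<Longrightarrow> s \<in> ipts J \<Longrightarrow> eq_sieve J r s \<in> cof J"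
| cof_conj: "\<alpha> \<in> cof J \<Longrightarrow> \<beta> \<in> cof J \<Longrightarrow> \<alpha> \<inter> \<beta> \<in> cof J"
| cof_disj: "\<alpha> \<in> cof J \<Longrightarrow> \<beta> \<in> cof J \<Longrightarrow> \<alpha> \<union> \<beta> \<in> cof J"

section \<open>Weak composition, fibrancy, contractibility\<close>

definition on_sieve :: "arr set \<Rightarrow> (arr \<times> pt) set" where
  "on_sieve \<alpha> = {(f, i). f \<in> \<alpha> \<and> i \<in> ipts (src f)}"

definition shift :: "arr \<Rightarrow> arr set \<Rightarrow> (arr \<times> pt \<Rightarrow> 'a) \<Rightarrow> (arr \<times> pt \<Rightarrow> 'a)" where
  "shift f \<alpha> p = restrict (\<lambda>(g, i). p (cube_comp f g, i)) (on_sieve (pull_sieve f \<alpha>))"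

text \<open>
  The exponential \<open>A\<^sup>\<I>\<close>: an element at stage \<open>J\<close> is a natural family of values
  \<open>a (f, i) \<in> A(K)\<close> for \<open>f : K \<rightarrow> J\<close> and \<open>i \<in> \<I>(K)\<close>; the value of \<open>a\<close> at \<open>i \<in> \<I>(J)\<close> is
  \<open>a (cube_id J, i)\<close>.
\<close>

definition interval_exp :: "'a psh \<Rightarrow> (arr \<times> pt \<Rightarrow> 'a) psh" where
  "interval_exp A =
     \<lparr>El = \<lambda>J. {a \<in> extensional (on_sieve (top_sieve J)).
         \<forall>(f, i) \<in> on_sieve (top_sieve J). a (f, i) \<in> El A (src f) \<and>
           (\<forall>g. is_arr g \<and> tgt g = src f \<longrightarrow>
              act A g (a (f, i)) = a (cube_comp f g, pt_act g i))},
      act = \<lambda>f. shift f (top_sieve (tgt f))\<rparr>"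

text \<open>Elements of \<open>[\<alpha>] \<rightarrow> (s : \<I>) \<rightarrow> B(a(s))\<close> at the stage on which \<open>a\<close> and \<open>\<alpha>\<close> live.\<close>

definition partial_lines ::
  "('a, 'b) fam \<Rightarrow> (arr \<times> pt \<Rightarrow> 'a) \<Rightarrow> arr set \<Rightarrow> (arr \<times> pt \<Rightarrow> 'b) set" where
  "partial_lines B a \<alpha> =
     {t \<in> extensional (on_sieve \<alpha>).
        \<forall>(f, i) \<in> on_sieve \<alpha>. t (f, i) \<in> Fib B (src f) (a (f, i)) \<and>
          (\<forall>g. is_arr g \<and> tgt g = src f \<longrightarrow>
             tr B g (a (f, i)) (t (f, i)) = t (cube_comp f g, pt_act g i))}"

text \<open>
  The context \<open>a : A\<^sup>\<I>\<close>, \<open>r : \<I>\<close>, \<open>\<alpha> : Cof\<close>, \<open>t : [\<alpha>] \<rightarrow> (s : \<I>) \<rightarrow> B(a(s))\<close>, \<open>b : B(a(r))\<close> with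
  \<open>[\<alpha>] \<rightarrow> t(r) = b\<close>.
\<close>

type_synonym ('a, 'b) box =
  "(arr \<times> pt \<Rightarrow> 'a) \<times> pt \<times> arr set \<times> (arr \<times> pt \<Rightarrow> 'b) \<times> 'b"

definition boxes :: "'a psh \<Rightarrow> ('a, 'b) fam \<Rightarrow> ('a, 'b) box psh" where
  "boxes A B =
     \<lparr>El = \<lambda>J. {(a, r, \<alpha>, t, b).
         a \<in> El (interval_exp A) J \<and> r \<in> ipts J \<and> \<alpha> \<in> cof J \<and>
         t \<in> partial_lines B a \<alpha> \<and> b \<in> Fib B J (a (cube_id J, r)) \<and>
         (\<forall>f\<in>\<alpha>. t (f, pt_act f r) = tr B f (a (cube_id J, r)) b)},
      act = \<lambda>f (a, r, \<alpha>, t, b).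
         (act (interval_exp A) f a, pt_act f r, pull_sieve f \<alpha>, shift f \<alpha> t,
          tr B f (a (cube_id (tgt f), r)) b)\<rparr>"

text \<open>
  A global element of \<open>(a : A\<^sup>\<I>) \<rightarrow> HasWCom(\<lambda>i. B(a(i)))\<close>, fully uncurried: \<open>w\<close> also takes the target
  \<open>s : \<I>\<close> of the composition, and \<open>p\<close> also takes the parameter \<open>i : \<I>\<close> of the path
  from \<open>wcom\<^sup>r\<^sup>\<rightarrow>\<^sup>r(t,b)\<close> to \<open>b\<close>.
\<close>

definition fibrant :: "'a psh \<Rightarrow> ('a, 'b) fam \<Rightarrow> bool" where
  "fibrant A B \<longleftrightarrow> (\<exists>w p.
     sect (ext (boxes A B) (const_fam interval))
          (reindex (\<lambda>J ((a, r, \<alpha>, t, b), s). a (cube_id J, s)) B) w \<and>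
     sect (ext (boxes A B) (const_fam interval))
          (reindex (\<lambda>J ((a, r, \<alpha>, t, b), i). a (cube_id J, r)) B) p \<and>
     (\<forall>J a r \<alpha> t b. finite J \<and> (a, r, \<alpha>, t, b) \<in> El (boxes A B) J \<longrightarrow>
        (\<forall>s\<in>ipts J. \<forall>f\<in>\<alpha>.
           tr B f (a (cube_id J, s)) (w J ((a, r, \<alpha>, t, b), s)) = t (f, pt_act f s)) \<and>
        p J ((a, r, \<alpha>, t, b), Zero) = w J ((a, r, \<alpha>, t, b), r) \<and>
        p J ((a, r, \<alpha>, t, b), One) = b \<and>
        (\<forall>i\<in>ipts J. \<forall>f\<in>\<alpha>.
           tr B f (a (cube_id J, r)) (p J ((a, r, \<alpha>, t, b), i)) = tr B f (a (cube_id J, r)) b)))"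

text \<open>A term of type \<open>isContr(A)\<close> in context \<open>\<Gamma>\<close>; the paths from the centre \<open>c\<close> are uncurried in \<open>h\<close>.\<close>

definition contractible :: "'g psh \<Rightarrow> ('g, 'a) fam \<Rightarrow> bool" where
  "contractible \<Gamma> A \<longleftrightarrow> (\<exists>c h.
     sect \<Gamma> A c \<and>
     sect (ext (ext \<Gamma> A) (const_fam interval)) (reindex (\<lambda>J ((\<gamma>, y), i). \<gamma>) A) h \<and>
     (\<forall>J. finite J \<longrightarrow> (\<forall>\<gamma>\<in>El \<Gamma> J. \<forall>y\<in>Fib A J \<gamma>.
        h J ((\<gamma>, y), Zero) = c J \<gamma> \<and> h J ((\<gamma>, y), One) = y)))"

section \<open>Internal categories\<close>

text \<open>
  The type \<open>'u\<close> plays the role of the universe: an internal category in context \<open>\<Gamma>\<close> has its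
  objects and morphisms in \<open>'u\<close> (an infinite type in the theorem: a finite type is too small to be a
  universe of sets). \<open>Cmp C J \<gamma> x y z g f\<close> is the composite of \<open>f : x \<rightarrow> y\<close>
  and \<open>g : y \<rightarrow> z\<close>. \<open>EqHom\<close> is a family of propositions, given by its forcing predicate.
\<close>

record ('g, 'u) icat =
  Ob :: "('g, 'u) fam"
  Hom :: "(('g \<times> 'u) \<times> 'u, 'u) fam"
  EqHom :: "cube \<Rightarrow> 'g \<Rightarrow> 'u \<Rightarrow> 'u \<Rightarrow> 'u \<Rightarrow> 'u \<Rightarrow> bool"
  Idn :: "cube \<Rightarrow> 'g \<Rightarrow> 'u \<Rightarrow> 'u"
  Cmp :: "cube \<Rightarrow> 'g \<Rightarrow> 'u \<Rightarrow> 'u \<Rightarrow> 'u \<Rightarrow> 'u \<Rightarrow> 'u \<Rightarrow> 'u"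

abbreviation ob :: "('g, 'u) icat \<Rightarrow> cube \<Rightarrow> 'g \<Rightarrow> 'u set" where
  "ob C J \<gamma> \<equiv> Fib (Ob C) J \<gamma>"

abbreviation hom :: "('g, 'u) icat \<Rightarrow> cube \<Rightarrow> 'g \<Rightarrow> 'u \<Rightarrow> 'u \<Rightarrow> 'u set" where
  "hom C J \<gamma> x y \<equiv> Fib (Hom C) J ((\<gamma>, x), y)"

abbreviation ob_tr :: "('g, 'u) icat \<Rightarrow> arr \<Rightarrow> 'g \<Rightarrow> 'u \<Rightarrow> 'u" where
  "ob_tr C f \<gamma> x \<equiv> tr (Ob C) f \<gamma> x"

abbreviation hom_tr :: "('g, 'u) icat \<Rightarrow> arr \<Rightarrow> 'g \<Rightarrow> 'u \<Rightarrow> 'u \<Rightarrow> 'u \<Rightarrow> 'u" where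
  "hom_tr C f \<gamma> x y m \<equiv> tr (Hom C) f ((\<gamma>, x), y) m"

text \<open>The contexts \<open>\<Gamma>, x y : Ob\<close>; \<open>\<Gamma>, x y : Ob, f : Hom x y\<close>; and \<open>\<Gamma>, x y : Ob, f g : Hom x y\<close>.\<close>

definition ob2_ctx :: "'g psh \<Rightarrow> ('g, 'u) icat \<Rightarrow> (('g \<times> 'u) \<times> 'u) psh" where
  "ob2_ctx \<Gamma> C = ext (ext \<Gamma> (Ob C)) (reindex (\<lambda>J. fst) (Ob C))"

definition hom_ctx :: "'g psh \<Rightarrow> ('g, 'u) icat \<Rightarrow> ((('g \<times> 'u) \<times> 'u) \<times> 'u) psh" where
  "hom_ctx \<Gamma> C = ext (ob2_ctx \<Gamma> C) (Hom C)"

definition par_ctx :: "'g psh \<Rightarrow> ('g, 'u) icat \<Rightarrow> (((('g \<times> 'u) \<times> 'u) \<times> 'u) \<times> 'u) psh" where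
  "par_ctx \<Gamma> C = ext (hom_ctx \<Gamma> C) (reindex (\<lambda>J. fst) (Hom C))"

definition eq_fam :: "('g, 'u) icat \<Rightarrow> (((('g \<times> 'u) \<times> 'u) \<times> 'u) \<times> 'u, unit) fam" where
  "eq_fam C = \<lparr>Fib = \<lambda>J ((((\<gamma>, x), y), f), g). {_. EqHom C J \<gamma> x y f g}, tr = \<lambda>f q u. u\<rparr>"

definition is_icat :: "'g psh \<Rightarrow> ('g, 'u) icat \<Rightarrow> bool" where
  "is_icat \<Gamma> C \<longleftrightarrow>
     family \<Gamma> (Ob C) \<and> family (ob2_ctx \<Gamma> C) (Hom C) \<and> family (par_ctx \<Gamma> C) (eq_fam C) \<and>
     (\<forall>J \<gamma>. finite J \<and> \<gamma> \<in> El \<Gamma> J \<longrightarrow>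
        (\<forall>x\<in>ob C J \<gamma>. \<forall>y\<in>ob C J \<gamma>. \<forall>f\<in>hom C J \<gamma> x y. \<forall>g\<in>hom C J \<gamma> x y.
           EqHom C J \<gamma> x y f g \<longleftrightarrow> f = g) \<and>
        (\<forall>x\<in>ob C J \<gamma>. Idn C J \<gamma> x \<in> hom C J \<gamma> x x) \<and>
        (\<forall>x\<in>ob C J \<gamma>. \<forall>y\<in>ob C J \<gamma>. \<forall>z\<in>ob C J \<gamma>. \<forall>f\<in>hom C J \<gamma> x y. \<forall>g\<in>hom C J \<gamma> y z.
           Cmp C J \<gamma> x y z g f \<in> hom C J \<gamma> x z) \<and>
        (\<forall>x\<in>ob C J \<gamma>. \<forall>y\<in>ob C J \<gamma>. \<forall>f\<in>hom C J \<gamma> x y.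
           Cmp C J \<gamma> x x y f (Idn C J \<gamma> x) = f \<and> Cmp C J \<gamma> x y y (Idn C J \<gamma> y) f = f) \<and>
        (\<forall>x\<in>ob C J \<gamma>. \<forall>y\<in>ob C J \<gamma>. \<forall>z\<in>ob C J \<gamma>. \<forall>w\<in>ob C J \<gamma>.
           \<forall>f\<in>hom C J \<gamma> x y. \<forall>g\<in>hom C J \<gamma> y z. \<forall>h\<in>hom C J \<gamma> z w.
           Cmp C J \<gamma> x z w h (Cmp C J \<gamma> x y z g f) = Cmp C J \<gamma> x y w (Cmp C J \<gamma> y z w h g) f)) \<and>
     (\<forall>u \<gamma>. is_arr u \<and> \<gamma> \<in> El \<Gamma> (tgt u) \<longrightarrow>
        (\<forall>x\<in>ob C (tgt u) \<gamma>.
           hom_tr C u \<gamma> x x (Idn C (tgt u) \<gamma> x) = Idn C (src u) (act \<Gamma> u \<gamma>) (ob_tr C u \<gamma> x)) \<and>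
        (\<forall>x\<in>ob C (tgt u) \<gamma>. \<forall>y\<in>ob C (tgt u) \<gamma>. \<forall>z\<in>ob C (tgt u) \<gamma>.
           \<forall>f\<in>hom C (tgt u) \<gamma> x y. \<forall>g\<in>hom C (tgt u) \<gamma> y z.
           hom_tr C u \<gamma> x z (Cmp C (tgt u) \<gamma> x y z g f) =
           Cmp C (src u) (act \<Gamma> u \<gamma>) (ob_tr C u \<gamma> x) (ob_tr C u \<gamma> y) (ob_tr C u \<gamma> z)
             (hom_tr C u \<gamma> y z g) (hom_tr C u \<gamma> x y f)))"

definition iso_fam :: "('g, 'u) icat \<Rightarrow> (('g \<times> 'u) \<times> 'u, 'u) fam" where
  "iso_fam C =
     \<lparr>Fib = \<lambda>J ((\<gamma>, x), y). {f \<in> hom C J \<gamma> x y. \<exists>g\<in>hom C J \<gamma> y x.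
         Cmp C J \<gamma> x y x g f = Idn C J \<gamma> x \<and> Cmp C J \<gamma> y x y f g = Idn C J \<gamma> y},
      tr = tr (Hom C)\<rparr>"

definition fibrant_components :: "(unit, 'u) icat \<Rightarrow> bool" where
  "fibrant_components C \<longleftrightarrow>
     fibrant terminal_psh (Ob C) \<and>
     fibrant (ob2_ctx terminal_psh C) (Hom C) \<and>
     fibrant (par_ctx terminal_psh C) (eq_fam C)"

definition complete :: "(unit, 'u) icat \<Rightarrow> bool" where
  "complete C \<longleftrightarrow>
     contractible (ext terminal_psh (Ob C)) (sigma_fam (reindex (\<lambda>J. fst) (Ob C)) (iso_fam C)) \<and>
     contractible (hom_ctx terminal_psh C) (sigma_fam (reindex (\<lambda>J. fst) (Hom C)) (eq_fam C)) \<and>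
     contractible (ext (par_ctx terminal_psh C) (eq_fam C)) (reindex (\<lambda>J. fst) (eq_fam C))"

section \<open>Internal functors and algebraic cofibrations\<close>

record ('g, 'u) ifun =
  FOb :: "cube \<Rightarrow> 'g \<Rightarrow> 'u \<Rightarrow> 'u"
  FHom :: "cube \<Rightarrow> 'g \<Rightarrow> 'u \<Rightarrow> 'u \<Rightarrow> 'u \<Rightarrow> 'u"

definition is_ifun ::
  "'g psh \<Rightarrow> ('g, 'u) icat \<Rightarrow> ('g, 'u) icat \<Rightarrow> ('g, 'u) ifun \<Rightarrow> bool" where
  "is_ifun \<Gamma> C D F \<longleftrightarrow>
     (\<forall>J \<gamma>. finite J \<and> \<gamma> \<in> El \<Gamma> J \<longrightarrow>
        (\<forall>x\<in>ob C J \<gamma>. FOb F J \<gamma> x \<in> ob D J \<gamma>) \<and>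
        (\<forall>x\<in>ob C J \<gamma>. \<forall>y\<in>ob C J \<gamma>. \<forall>f\<in>hom C J \<gamma> x y.
           FHom F J \<gamma> x y f \<in> hom D J \<gamma> (FOb F J \<gamma> x) (FOb F J \<gamma> y)) \<and>
        (\<forall>x\<in>ob C J \<gamma>. \<forall>y\<in>ob C J \<gamma>. \<forall>f\<in>hom C J \<gamma> x y. \<forall>g\<in>hom C J \<gamma> x y.
           EqHom C J \<gamma> x y f g \<longrightarrow>
           EqHom D J \<gamma> (FOb F J \<gamma> x) (FOb F J \<gamma> y) (FHom F J \<gamma> x y f) (FHom F J \<gamma> x y g)) \<and>
        (\<forall>x\<in>ob C J \<gamma>. FHom F J \<gamma> x x (Idn C J \<gamma> x) = Idn D J \<gamma> (FOb F J \<gamma> x)) \<and>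
        (\<forall>x\<in>ob C J \<gamma>. \<forall>y\<in>ob C J \<gamma>. \<forall>z\<in>ob C J \<gamma>. \<forall>f\<in>hom C J \<gamma> x y. \<forall>g\<in>hom C J \<gamma> y z.
           FHom F J \<gamma> x z (Cmp C J \<gamma> x y z g f) =
           Cmp D J \<gamma> (FOb F J \<gamma> x) (FOb F J \<gamma> y) (FOb F J \<gamma> z)
             (FHom F J \<gamma> y z g) (FHom F J \<gamma> x y f))) \<and>
     (\<forall>u \<gamma>. is_arr u \<and> \<gamma> \<in> El \<Gamma> (tgt u) \<longrightarrow>
        (\<forall>x\<in>ob C (tgt u) \<gamma>.
           ob_tr D u \<gamma> (FOb F (tgt u) \<gamma> x) = FOb F (src u) (act \<Gamma> u \<gamma>) (ob_tr C u \<gamma> x)) \<and>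
        (\<forall>x\<in>ob C (tgt u) \<gamma>. \<forall>y\<in>ob C (tgt u) \<gamma>. \<forall>f\<in>hom C (tgt u) \<gamma> x y.
           hom_tr D u \<gamma> (FOb F (tgt u) \<gamma> x) (FOb F (tgt u) \<gamma> y) (FHom F (tgt u) \<gamma> x y f) =
           FHom F (src u) (act \<Gamma> u \<gamma>) (ob_tr C u \<gamma> x) (ob_tr C u \<gamma> y) (hom_tr C u \<gamma> x y f)))"

definition ifun_comp :: "('g, 'u) ifun \<Rightarrow> ('g, 'u) ifun \<Rightarrow> ('g, 'u) ifun" where
  "ifun_comp G F =
     \<lparr>FOb = \<lambda>J \<gamma> x. FOb G J \<gamma> (FOb F J \<gamma> x),
      FHom = \<lambda>J \<gamma> x y f. FHom G J \<gamma> (FOb F J \<gamma> x) (FOb F J \<gamma> y) (FHom F J \<gamma> x y f)\<rparr>"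

text \<open>
  Splitting of a functor \<open>F : X \<rightarrow> Y\<close>: sections of its actions on objects, and on morphisms
  \<open>X(x,y) \<rightarrow> Y(F x,F y)\<close>. A section of the action on \<open>EqHom\<close>, a map between propositions,
  is an implication.
\<close>

record ('g, 'u) splitting =
  SOb :: "cube \<Rightarrow> 'g \<Rightarrow> 'u \<Rightarrow> 'u"
  SHom :: "cube \<Rightarrow> 'g \<Rightarrow> 'u \<Rightarrow> 'u \<Rightarrow> 'u \<Rightarrow> 'u"

definition split_trivial_fibration ::
  "'g psh \<Rightarrow> ('g, 'u) icat \<Rightarrow> ('g, 'u) icat \<Rightarrow> ('g, 'u) ifun \<Rightarrow> ('g, 'u) splitting \<Rightarrow> bool" where
  "split_trivial_fibration \<Gamma> X Y F S \<longleftrightarrow>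
     is_ifun \<Gamma> X Y F \<and>
     (\<forall>J \<gamma>. finite J \<and> \<gamma> \<in> El \<Gamma> J \<longrightarrow>
        (\<forall>y\<in>ob Y J \<gamma>. SOb S J \<gamma> y \<in> ob X J \<gamma> \<and> FOb F J \<gamma> (SOb S J \<gamma> y) = y) \<and>
        (\<forall>x\<in>ob X J \<gamma>. \<forall>x'\<in>ob X J \<gamma>. \<forall>g\<in>hom Y J \<gamma> (FOb F J \<gamma> x) (FOb F J \<gamma> x').
           SHom S J \<gamma> x x' g \<in> hom X J \<gamma> x x' \<and> FHom F J \<gamma> x x' (SHom S J \<gamma> x x' g) = g) \<and>
        (\<forall>x\<in>ob X J \<gamma>. \<forall>x'\<in>ob X J \<gamma>. \<forall>f\<in>hom X J \<gamma> x x'. \<forall>f'\<in>hom X J \<gamma> x x'.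
           EqHom Y J \<gamma> (FOb F J \<gamma> x) (FOb F J \<gamma> x') (FHom F J \<gamma> x x' f) (FHom F J \<gamma> x x' f') \<longrightarrow>
           EqHom X J \<gamma> x x' f f')) \<and>
     (\<forall>u \<gamma>. is_arr u \<and> \<gamma> \<in> El \<Gamma> (tgt u) \<longrightarrow>
        (\<forall>y\<in>ob Y (tgt u) \<gamma>.
           ob_tr X u \<gamma> (SOb S (tgt u) \<gamma> y) = SOb S (src u) (act \<Gamma> u \<gamma>) (ob_tr Y u \<gamma> y)) \<and>
        (\<forall>x\<in>ob X (tgt u) \<gamma>. \<forall>x'\<in>ob X (tgt u) \<gamma>.
           \<forall>g\<in>hom Y (tgt u) \<gamma> (FOb F (tgt u) \<gamma> x) (FOb F (tgt u) \<gamma> x').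
           hom_tr X u \<gamma> x x' (SHom S (tgt u) \<gamma> x x' g) =
           SHom S (src u) (act \<Gamma> u \<gamma>) (ob_tr X u \<gamma> x) (ob_tr X u \<gamma> x')
             (hom_tr Y u \<gamma> (FOb F (tgt u) \<gamma> x) (FOb F (tgt u) \<gamma> x') g)))"

text \<open>
  Equality of families, categories, functors and splittings in context \<open>\<Gamma>\<close>: agreement on the
  relevant arguments, as HOL functions also have values outside their intended domains.
\<close>

definition fam_eq :: "'g psh \<Rightarrow> ('g, 'a) fam \<Rightarrow> ('g, 'a) fam \<Rightarrow> bool" where
  "fam_eq \<Gamma> A B \<longleftrightarrow>
     (\<forall>J. finite J \<longrightarrow> (\<forall>\<gamma>\<in>El \<Gamma> J. Fib A J \<gamma> = Fib B J \<gamma>)) \<and>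
     (\<forall>u. is_arr u \<longrightarrow> (\<forall>\<gamma>\<in>El \<Gamma> (tgt u). \<forall>a\<in>Fib A (tgt u) \<gamma>. tr A u \<gamma> a = tr B u \<gamma> a))"

definition icat_eq :: "'g psh \<Rightarrow> ('g, 'u) icat \<Rightarrow> ('g, 'u) icat \<Rightarrow> bool" where
  "icat_eq \<Gamma> C D \<longleftrightarrow>
     fam_eq \<Gamma> (Ob C) (Ob D) \<and> fam_eq (ob2_ctx \<Gamma> C) (Hom C) (Hom D) \<and>
     fam_eq (par_ctx \<Gamma> C) (eq_fam C) (eq_fam D) \<and>
     (\<forall>J \<gamma>. finite J \<and> \<gamma> \<in> El \<Gamma> J \<longrightarrow>
        (\<forall>x\<in>ob C J \<gamma>. Idn C J \<gamma> x = Idn D J \<gamma> x) \<and>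
        (\<forall>x\<in>ob C J \<gamma>. \<forall>y\<in>ob C J \<gamma>. \<forall>z\<in>ob C J \<gamma>. \<forall>f\<in>hom C J \<gamma> x y. \<forall>g\<in>hom C J \<gamma> y z.
           Cmp C J \<gamma> x y z g f = Cmp D J \<gamma> x y z g f))"

definition ifun_eq ::
  "'g psh \<Rightarrow> ('g, 'u) icat \<Rightarrow> ('g, 'u) ifun \<Rightarrow> ('g, 'u) ifun \<Rightarrow> bool" where
  "ifun_eq \<Gamma> C F G \<longleftrightarrow>
     (\<forall>J \<gamma>. finite J \<and> \<gamma> \<in> El \<Gamma> J \<longrightarrow>
        (\<forall>x\<in>ob C J \<gamma>. FOb F J \<gamma> x = FOb G J \<gamma> x) \<and>
        (\<forall>x\<in>ob C J \<gamma>. \<forall>y\<in>ob C J \<gamma>. \<forall>f\<in>hom C J \<gamma> x y. FHom F J \<gamma> x y f = FHom G J \<gamma> x y f))"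

definition splitting_eq ::
  "'g psh \<Rightarrow> ('g, 'u) icat \<Rightarrow> ('g, 'u) icat \<Rightarrow> ('g, 'u) ifun \<Rightarrow>
   ('g, 'u) splitting \<Rightarrow> ('g, 'u) splitting \<Rightarrow> bool" where
  "splitting_eq \<Gamma> X Y F S T \<longleftrightarrow>
     (\<forall>J \<gamma>. finite J \<and> \<gamma> \<in> El \<Gamma> J \<longrightarrow>
        (\<forall>y\<in>ob Y J \<gamma>. SOb S J \<gamma> y = SOb T J \<gamma> y) \<and>
        (\<forall>x\<in>ob X J \<gamma>. \<forall>x'\<in>ob X J \<gamma>. \<forall>g\<in>hom Y J \<gamma> (FOb F J \<gamma> x) (FOb F J \<gamma> x').
           SHom S J \<gamma> x x' g = SHom T J \<gamma> x x' g))"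

definition reindex_icat :: "(cube \<Rightarrow> 'd \<Rightarrow> 'g) \<Rightarrow> ('g, 'u) icat \<Rightarrow> ('d, 'u) icat" where
  "reindex_icat \<sigma> C =
     \<lparr>Ob = reindex \<sigma> (Ob C), Hom = reindex (\<lambda>J ((\<delta>, x), y). ((\<sigma> J \<delta>, x), y)) (Hom C),
      EqHom = \<lambda>J \<delta>. EqHom C J (\<sigma> J \<delta>), Idn = \<lambda>J \<delta>. Idn C J (\<sigma> J \<delta>),
      Cmp = \<lambda>J \<delta>. Cmp C J (\<sigma> J \<delta>)\<rparr>"

definition reindex_ifun :: "(cube \<Rightarrow> 'd \<Rightarrow> 'g) \<Rightarrow> ('g, 'u) ifun \<Rightarrow> ('d, 'u) ifun" where
  "reindex_ifun \<sigma> F = \<lparr>FOb = \<lambda>J \<delta>. FOb F J (\<sigma> J \<delta>), FHom = \<lambda>J \<delta>. FHom F J (\<sigma> J \<delta>)\<rparr>"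

definition reindex_splitting ::
  "(cube \<Rightarrow> 'd \<Rightarrow> 'g) \<Rightarrow> ('g, 'u) splitting \<Rightarrow> ('d, 'u) splitting" where
  "reindex_splitting \<sigma> S = \<lparr>SOb = \<lambda>J \<delta>. SOb S J (\<sigma> J \<delta>), SHom = \<lambda>J \<delta>. SHom S J (\<sigma> J \<delta>)\<rparr>"

text \<open>Weakening of global data, and substitution along a morphism \<open>f : K \<rightarrow> J\<close> of cubes.\<close>

abbreviation wk :: "cube \<Rightarrow> 'd \<Rightarrow> unit" where
  "wk \<equiv> \<lambda>J \<delta>. ()"

abbreviation along :: "arr \<Rightarrow> cube \<Rightarrow> arr \<Rightarrow> arr" where
  "along f \<equiv> \<lambda>L g. cube_comp f g"

text \<open>
  A global functor \<open>P : A \<rightarrow> B\<close> is an algebraic cofibration if there is an internal operation \<open>L\<close>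
  that sends each split trivial fibration \<open>F : X \<rightarrow> Y\<close> with splitting \<open>S\<close>, and each commutative square
  \<open>U : A \<rightarrow> X\<close>, \<open>V : B \<rightarrow> Y\<close>, to a diagonal filler. As \<open>X\<close>, \<open>Y\<close>, \<open>F\<close>, \<open>S\<close>, \<open>U\<close>, \<open>V\<close> are bound
  internally, at stage \<open>J\<close> they live in the context \<open>yoneda J\<close>, and \<open>L\<close> is natural in \<open>J\<close>.
\<close>

definition lifting_problem ::
  "cube \<Rightarrow> (unit, 'u) icat \<Rightarrow> (unit, 'u) icat \<Rightarrow> (unit, 'u) ifun \<Rightarrow>
   (arr, 'u) icat \<Rightarrow> (arr, 'u) icat \<Rightarrow> (arr, 'u) ifun \<Rightarrow> (arr, 'u) splitting \<Rightarrow>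
   (arr, 'u) ifun \<Rightarrow> (arr, 'u) ifun \<Rightarrow> bool" where
  "lifting_problem J A B P X Y F S U V \<longleftrightarrow>
     is_icat (yoneda J) X \<and> is_icat (yoneda J) Y \<and>
     split_trivial_fibration (yoneda J) X Y F S \<and>
     is_ifun (yoneda J) (reindex_icat wk A) X U \<and>
     is_ifun (yoneda J) (reindex_icat wk B) Y V \<and>
     ifun_eq (yoneda J) (reindex_icat wk A) (ifun_comp F U) (ifun_comp V (reindex_ifun wk P))"

definition algebraic_cofibration ::
  "(unit, 'u) icat \<Rightarrow> (unit, 'u) icat \<Rightarrow> (unit, 'u) ifun \<Rightarrow> bool" where
  "algebraic_cofibration A B P \<longleftrightarrow> (\<exists>L.
     \<forall>J X Y F S U V. finite J \<and> lifting_problem J A B P X Y F S U V \<longrightarrow>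
       is_ifun (yoneda J) (reindex_icat wk B) X (L J X Y F S U V) \<and>
       ifun_eq (yoneda J) (reindex_icat wk B) (ifun_comp F (L J X Y F S U V)) V \<and>
       ifun_eq (yoneda J) (reindex_icat wk A)
         (ifun_comp (L J X Y F S U V) (reindex_ifun wk P)) U \<and>
       (\<forall>f X' Y' F' S' U' V'.
          is_arr f \<and> tgt f = J \<and> lifting_problem (src f) A B P X' Y' F' S' U' V' \<and>
          icat_eq (yoneda (src f)) X' (reindex_icat (along f) X) \<and>
          icat_eq (yoneda (src f)) Y' (reindex_icat (along f) Y) \<and>
          ifun_eq (yoneda (src f)) X' F' (reindex_ifun (along f) F) \<and>
          splitting_eq (yoneda (src f)) X' Y' F' S' (reindex_splitting (along f) S) \<and>
          ifun_eq (yoneda (src f)) (reindex_icat wk A) U' (reindex_ifun (along f) U) \<and>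
          ifun_eq (yoneda (src f)) (reindex_icat wk B) V' (reindex_ifun (along f) V) \<longrightarrow>
          ifun_eq (yoneda (src f)) (reindex_icat wk B)
            (L (src f) X' Y' F' S' U' V') (reindex_ifun (along f) (L J X Y F S U V))))"

definition empty_icat :: "(unit, 'u) icat" where
  "empty_icat =
     \<lparr>Ob = \<lparr>Fib = \<lambda>J \<gamma>. {}, tr = \<lambda>u \<gamma> x. x\<rparr>, Hom = \<lparr>Fib = \<lambda>J \<gamma>. {}, tr = \<lambda>u \<gamma> f. f\<rparr>,
      EqHom = \<lambda>J \<gamma> x y f g. f = g, Idn = \<lambda>J \<gamma> x. undefined, Cmp = \<lambda>J \<gamma> x y z g f. undefined\<rparr>"

definition empty_ifun :: "(unit, 'u) ifun" where
  "empty_ifun = \<lparr>FOb = \<lambda>J \<gamma> x. undefined, FHom = \<lambda>J \<gamma> x y f. undefined\<rparr>"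

definition algebraically_cofibrant :: "(unit, 'u) icat \<Rightarrow> bool" where
  "algebraically_cofibrant C \<longleftrightarrow> algebraic_cofibration empty_icat C empty_ifun"

section \<open>Ordinary categories and evaluation at the terminal cube\<close>

text \<open>\<open>ocmp C x y z g f\<close> is the composite of \<open>f : x \<rightarrow> y\<close> and \<open>g : y \<rightarrow> z\<close>.\<close>

record 'u ocat =
  oobj :: "'u set"
  ohom :: "'u \<Rightarrow> 'u \<Rightarrow> 'u set"
  oid :: "'u \<Rightarrow> 'u"
  ocmp :: "'u \<Rightarrow> 'u \<Rightarrow> 'u \<Rightarrow> 'u \<Rightarrow> 'u \<Rightarrow> 'u"

record 'u ofun =
  oFob :: "'u \<Rightarrow> 'u"
  oFhom :: "'u \<Rightarrow> 'u \<Rightarrow> 'u \<Rightarrow> 'u"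

definition isomorphic_in :: "'u ocat \<Rightarrow> 'u \<Rightarrow> 'u \<Rightarrow> bool" where
  "isomorphic_in C x y \<longleftrightarrow> (\<exists>f\<in>ohom C x y. \<exists>g\<in>ohom C y x.
     ocmp C x y x g f = oid C x \<and> ocmp C y x y f g = oid C y)"

definition essentially_surjective :: "'u ocat \<Rightarrow> 'u ocat \<Rightarrow> 'u ofun \<Rightarrow> bool" where
  "essentially_surjective C D F \<longleftrightarrow> (\<forall>d\<in>oobj D. \<exists>c\<in>oobj C. isomorphic_in D (oFob F c) d)"

definition fully_faithful :: "'u ocat \<Rightarrow> 'u ocat \<Rightarrow> 'u ofun \<Rightarrow> bool" where
  "fully_faithful C D F \<longleftrightarrow> (\<forall>x\<in>oobj C. \<forall>y\<in>oobj C.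
     bij_betw (oFhom F x y) (ohom C x y) (ohom D (oFob F x) (oFob F y)))"

definition weak_equivalence :: "'u ocat \<Rightarrow> 'u ocat \<Rightarrow> 'u ofun \<Rightarrow> bool" where
  "weak_equivalence C D F \<longleftrightarrow> essentially_surjective C D F \<and> fully_faithful C D F"

text \<open>The terminal object of the cube category is the empty set.\<close>

definition eval_cat :: "(unit, 'u) icat \<Rightarrow> 'u ocat" where
  "eval_cat C = \<lparr>oobj = ob C {} (), ohom = hom C {} (), oid = Idn C {} (), ocmp = Cmp C {} ()\<rparr>"

definition eval_fun :: "(unit, 'u) ifun \<Rightarrow> 'u ofun" where
  "eval_fun F = \<lparr>oFob = FOb F {} (), oFhom = FHom F {} ()\<rparr>"

definition strict_rezk_completion ::
  "(unit, 'u) icat \<Rightarrow> (unit, 'u) icat \<Rightarrow> (unit, 'u) ifun \<Rightarrow> bool" where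
  "strict_rezk_completion C D i \<longleftrightarrow>
     is_icat terminal_psh D \<and> fibrant_components D \<and> complete D \<and>
     is_ifun terminal_psh C D i \<and>
     weak_equivalence (eval_cat C) (eval_cat D) (eval_fun i)"

end

theory Submission
  imports Defs
begin

text \<open>
  Let \<open>E\<close> be the category of global elements of \<open>C\<close>, that is, the value of \<open>C\<close> at the zero-dimensional
  cube. The completion is the isomorphism nerve of \<open>E\<close>: over a cube \<open>J\<close> its objects are the functors to
  \<open>E\<close> from the chaotic groupoid on the vertices \<open>{0,1}\<^sup>J\<close> (the groupoid with exactly one arrow between any
  two vertices), and its morphisms are the natural transformations. A zero-dimensional cube has a single
  vertex, so the nerve has \<open>E\<close> as its category of global elements.

  The nerve is fibrant and complete because an object can be replaced by an isomorphic one at each vertex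
  separately: given a functor from the chaotic groupoid and any choice of isomorphisms out of its values,
  conjugation yields a functor with the new values (\<open>conj_ob\<close>). A cofibration is a sieve, and an element
  of the nerve over a face is determined by what it does at the vertices of that face. Hence a box of
  objects is filled by moving along the given line at the vertices that satisfy the cofibration and by
  changing nothing at the others (\<open>nerve_ob_fibrant\<close>); likewise, the path that contracts an isomorphism
  \<open>f : x \<cong> y\<close> to the identity of \<open>x\<close> has the value of \<open>y\<close> at the vertices where its parameter is \<open>1\<close>, and
  that of \<open>x\<close> at the others (\<open>nerve_complete\<close>). Morphisms are transported by conjugation
  (\<open>nerve_hom_fibrant\<close>).

  For the functor from \<open>C\<close> to the nerve, an object \<open>x\<close> over \<open>J\<close> is sent to its values at the vertices of
  \<open>J\<close>, and these have to be compared by a coherent system of isomorphisms. As \<open>EqHom\<close> is equality, its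
  fibrancy means that two lines of morphisms that agree at one point agree everywhere. In particular a path of
  morphisms between fixed objects is constant, so that the weak composition of \<open>Hom\<close> becomes a strict
  one. Therefore restriction from the morphisms \<open>x \<rightarrow> y\<close> over \<open>J\<close> to those over a vertex is injective
  (\<open>hom_eq_from_vertex\<close>) and surjective (\<open>hom_from_vertex\<close>). Extending the identity of the value of \<open>x\<close> at
  a vertex \<open>V\<close> to a morphism from the constant cube at that value to \<open>x\<close>, and evaluating it at the vertex
  \<open>W\<close>, gives the comparison from \<open>V\<close> to \<open>W\<close>; uniqueness of such extensions yields all the coherence laws
  (\<open>compare_from_constant\<close>).
\<close>

section \<open>Cubes, their vertices, and presheaves\<close>

lemma arr_eqI:
  assumes "src f = src g" and "tgt f = tgt g" and "is_arr f" and "is_arr g"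
    and "\<And>j. j \<in> tgt f \<Longrightarrow> amap f j = amap g j"
  shows "f = g"
proof -
  have "amap f = amap g"
    using assms unfolding is_arr_def by (intro extensionalityI[of _ "tgt f"]) (auto simp: PiE_def)
  then show ?thesis using assms(1,2) by (cases f, cases g) auto
qed

lemma pt_act_in [simp]: "is_arr f \<Longrightarrow> i \<in> ipts (tgt f) \<Longrightarrow> pt_act f i \<in> ipts (src f)"
  by (cases i) (auto simp: is_arr_def ipts_def)

lemma ends_in_ipts [simp]: "Zero \<in> ipts J" "One \<in> ipts J"
  by (auto simp: ipts_def)

lemma Var_in_ipts [simp]: "Var j \<in> ipts J \<longleftrightarrow> j \<in> J"
  by (auto simp: ipts_def)

lemma amap_in_ipts: "is_arr f \<Longrightarrow> j \<in> tgt f \<Longrightarrow> amap f j \<in> ipts (src f)"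
  by (auto simp: is_arr_def)

lemma src_cube_comp [simp]: "src (cube_comp f g) = src g"
  and tgt_cube_comp [simp]: "tgt (cube_comp f g) = tgt f"
  and amap_cube_comp: "amap (cube_comp f g) = (\<lambda>j\<in>tgt f. pt_act g (amap f j))"
  and amap_cube_comp_in [simp]: "j \<in> tgt f \<Longrightarrow> amap (cube_comp f g) j = pt_act g (amap f j)"
  by (auto simp: cube_comp_def)

lemma cube_id_simps [simp]: "src (cube_id J) = J" "tgt (cube_id J) = J"
  "j \<in> J \<Longrightarrow> amap (cube_id J) j = Var j"
  by (auto simp: cube_id_def)

lemma is_arr_cube_id [simp]: "finite J \<Longrightarrow> is_arr (cube_id J)"
  by (auto simp: is_arr_def cube_id_def)

lemma finite_src [simp]: "is_arr f \<Longrightarrow> finite (src f)"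
  and finite_tgt [simp]: "is_arr f \<Longrightarrow> finite (tgt f)"
  by (auto simp: is_arr_def)

lemma is_arr_cube_comp [simp]:
  "is_arr f \<Longrightarrow> is_arr g \<Longrightarrow> tgt g = src f \<Longrightarrow> is_arr (cube_comp f g)"
  using pt_act_in[of g] amap_in_ipts[of f] unfolding is_arr_def[of "cube_comp f g"]
  by (auto simp: cube_comp_def)

lemma pt_act_cube_comp [simp]:
  "i \<in> ipts (tgt f) \<Longrightarrow> pt_act (cube_comp f g) i = pt_act g (pt_act f i)"
  by (cases i) (auto simp: ipts_def)

lemma pt_act_cube_id [simp]: "i \<in> ipts J \<Longrightarrow> pt_act (cube_id J) i = i"
  by (cases i) (auto simp: ipts_def)

lemma cube_comp_assoc:
  assumes "is_arr f" and "is_arr g" and "is_arr h" and "tgt g = src f" and "tgt h = src g"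
  shows "cube_comp (cube_comp f g) h = cube_comp f (cube_comp g h)"
proof (rule arr_eqI)
  fix j assume "j \<in> tgt (cube_comp (cube_comp f g) h)"
  then show "amap (cube_comp (cube_comp f g) h) j = amap (cube_comp f (cube_comp g h)) j"
    using amap_in_ipts[OF assms(1), of j] assms(4) by simp
qed (use assms in auto)

lemma cube_comp_id [simp]:
  assumes "is_arr f"
  shows "tgt f = J \<Longrightarrow> cube_comp (cube_id J) f = f"
    and "src f = J \<Longrightarrow> cube_comp f (cube_id J) = f"
  using assms amap_in_ipts[OF assms] by (auto intro!: arr_eqI)

text \<open>
  A vertex of the cube \<open>J\<close> is the set \<open>V \<subseteq> J\<close> of the coordinates that are \<open>1\<close>. The value of a point
  of the interval at a vertex is a boolean, and \<open>push f\<close> is the action of \<open>f\<close> on vertices.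
\<close>

primrec coord :: "nat set \<Rightarrow> pt \<Rightarrow> bool" where
  "coord V Zero = False"
| "coord V One = True"
| "coord V (Var k) = (k \<in> V)"

definition end_pt :: "bool \<Rightarrow> pt" where
  "end_pt b = (if b then One else Zero)"

definition push :: "arr \<Rightarrow> nat set \<Rightarrow> nat set" where
  "push f V = {j \<in> tgt f. coord V (amap f j)}"

lemma end_pt_simps [simp]: "pt_act f (end_pt b) = end_pt b" "coord V (end_pt b) = b"
    "end_pt b \<in> ipts J"
  by (auto simp: end_pt_def)

lemma push_subset [simp]: "push f V \<subseteq> tgt f"
  by (auto simp: push_def)

lemma coord_push [simp]: "i \<in> ipts (tgt f) \<Longrightarrow> coord (push f V) i = coord V (pt_act f i)"
  by (cases i) (auto simp: push_def)

lemma push_comp [simp]: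
  assumes "is_arr f" and "tgt g = src f"
  shows "push (cube_comp f g) V = push f (push g V)"
  using amap_in_ipts[OF assms(1)] assms(2) by (auto simp: push_def[of f] push_def[of "cube_comp f g"])

lemma push_id [simp]: "V \<subseteq> J \<Longrightarrow> push (cube_id J) V = V"
  by (auto simp: push_def)

text \<open>
  Degenerate lines: \<open>const_line J V\<close> is the line that stays at the vertex \<open>V\<close> of \<open>J\<close>. It gives access
  at once to a vertex and to a direction along which to move.
\<close>

definition const_line :: "cube \<Rightarrow> nat set \<Rightarrow> arr" where
  "const_line J V = Arr {0} J (\<lambda>j\<in>J. end_pt (j \<in> V))"

definition tip :: "bool \<Rightarrow> nat set" where
  "tip p = (if p then {0} else {})"

lemma tip_subset [simp]: "tip p \<subseteq> {0}" and zero_in_tip [simp]: "0 \<in> tip p \<longleftrightarrow> p"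
  by (auto simp: tip_def)

lemma const_line_simps [simp]: "src (const_line J V) = {0}" "tgt (const_line J V) = J"
  "finite J \<Longrightarrow> is_arr (const_line J V)"
  "i \<in> ipts J \<Longrightarrow> pt_act (const_line J V) i = end_pt (coord V i)"
  by (cases i; auto simp: const_line_def is_arr_def ipts_def end_pt_def)+

lemma amap_const_line [simp]: "j \<in> J \<Longrightarrow> amap (const_line J V) j = end_pt (j \<in> V)"
  by (simp add: const_line_def)

lemma push_const_line [simp]: "V \<subseteq> J \<Longrightarrow> push (const_line J V) W = V"
  by (auto simp: push_def const_line_def)

text \<open>
  A morphism of cubes maps the constant line at a vertex to the constant line at the image vertex, so that
  constructions made on constant lines commute with restriction.
\<close>

lemma comp_const_line:
  assumes "is_arr f"
  shows "cube_comp f (const_line (src f) V) = const_line (tgt f) (push f V)"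
proof (rule arr_eqI)
  fix j assume j: "j \<in> tgt (cube_comp f (const_line (src f) V))"
  then have "amap f j \<in> ipts (src f)" using assms amap_in_ipts by simp
  then show "amap (cube_comp f (const_line (src f) V)) j = amap (const_line (tgt f) (push f V)) j"
    using j by (simp add: const_line_def[of "tgt f"] push_def)
qed (use assms in auto)

lemma interval_exp_El:
  "a \<in> El (interval_exp A) J \<longleftrightarrow> a \<in> extensional (on_sieve (top_sieve J)) \<and>
     (\<forall>f i. is_arr f \<and> tgt f = J \<and> i \<in> ipts (src f) \<longrightarrow> a (f, i) \<in> El A (src f) \<and>
        (\<forall>g. is_arr g \<and> tgt g = src f \<longrightarrow> act A g (a (f, i)) = a (cube_comp f g, pt_act g i)))"
  by (auto simp: interval_exp_def on_sieve_def top_sieve_def)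

lemma presheaf_ext:
  assumes "presheaf \<Gamma>" and "family \<Gamma> A"
  shows "presheaf (ext \<Gamma> A)"
  using assms unfolding presheaf_def family_def ext_def by (auto simp: split_beta)

lemma presheaf_terminal: "presheaf terminal_psh"
  by (auto simp: presheaf_def terminal_psh_def)

lemma terminal_simps [simp]: "El terminal_psh J = UNIV" "act terminal_psh f \<gamma> = \<gamma>"
  by (auto simp: terminal_psh_def)

text \<open>
  As cofibrations are sieves, a cell that lies on a face has all its vertices on that face; boxes in the
  nerve can therefore be filled vertex by vertex.
\<close>

lemma cof_sieve:
  assumes "\<alpha> \<in> cof J"
  shows "f \<in> \<alpha> \<Longrightarrow> is_arr f \<and> tgt f = J"
    and "f \<in> \<alpha> \<Longrightarrow> is_arr g \<Longrightarrow> tgt g = src f \<Longrightarrow> cube_comp f g \<in> \<alpha>"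
  using assms by (induction arbitrary: f g) (auto simp: eq_sieve_def top_sieve_def)

lemma empty_cof: "{} \<in> cof J"
proof -
  have "eq_sieve J Zero One = {}" by (auto simp: eq_sieve_def)
  then show ?thesis using cof_eq[of Zero J One] by simp
qed

section \<open>Coding finite families of elements of an infinite type\<close>

text \<open>
  An infinite type contains its own square, hence all its finite powers. A family indexed by the
  entries of a fixed list can therefore be stored in a single element.
\<close>

definition pairing :: "'u \<times> 'u \<Rightarrow> 'u" where
  "pairing = (SOME h. inj h)"

definition code :: "'k list \<Rightarrow> ('k \<Rightarrow> 'u) \<Rightarrow> 'u" where
  "code ks F = foldr (\<lambda>k u. pairing (F k, u)) ks undefined"

definition decode :: "'k list \<Rightarrow> 'u \<Rightarrow> 'k \<Rightarrow> 'u" where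
  "decode ks u = (SOME F. code ks F = u)"

lemma inj_pairing:
  assumes "infinite (UNIV :: 'u set)"
  shows "inj (pairing :: 'u \<times> 'u \<Rightarrow> 'u)"
proof -
  have "(card_of ((UNIV :: 'u set) \<times> (UNIV :: 'u set)), card_of (UNIV :: 'u set)) \<in> ordIso"
    using assms by (rule card_of_Times_same_infinite)
  then obtain h :: "'u \<times> 'u \<Rightarrow> 'u" where "bij_betw h (UNIV \<times> UNIV) UNIV"
    using card_of_ordIso by blast
  then have "inj h" by (simp add: bij_betw_def)
  then show ?thesis unfolding pairing_def by (rule someI[where P = inj])
qed

lemma code_cong: "(\<And>k. k \<in> set ks \<Longrightarrow> F k = G k) \<Longrightarrow> code ks F = code ks G"
  by (induction ks) (auto simp: code_def)

lemma code_inj: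
  assumes "infinite (UNIV :: 'u set)" and "code ks F = (code ks G :: 'u)" and "k \<in> set ks"
  shows "F k = G k"
  using assms(2,3)
proof (induction ks)
  case (Cons a ks)
  from Cons.prems have "F a = G a \<and> code ks F = code ks G"
    using inj_pairing[OF assms(1)] by (auto simp: code_def dest: injD)
  with Cons show ?case by auto
qed (simp add: code_def)

lemma decode_code:
  assumes "infinite (UNIV :: 'u set)" and "k \<in> set ks"
  shows "decode ks (code ks F :: 'u) k = F k"
proof -
  have "code ks (decode ks (code ks F)) = code ks F"
    unfolding decode_def by (rule someI[where P = "\<lambda>G. code ks G = code ks F"]) (rule refl)
  from code_inj[OF assms(1) this assms(2)] show ?thesis .
qed

section \<open>Ordinary categories\<close>

text \<open>
  Associativity is oriented towards right nesting, and all laws carry the objects explicitly, so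
  that they work as rewrite rules.
\<close>

locale ordinary_category =
  fixes E :: "'u ocat"
  assumes id_in [simp]: "x \<in> oobj E \<Longrightarrow> oid E x \<in> ohom E x x"
    and cmp_in [simp]: "\<lbrakk>x \<in> oobj E; y \<in> oobj E; z \<in> oobj E; f \<in> ohom E x y; g \<in> ohom E y z\<rbrakk>
      \<Longrightarrow> ocmp E x y z g f \<in> ohom E x z"
    and cmp_id_right [simp]: "\<lbrakk>x \<in> oobj E; y \<in> oobj E; f \<in> ohom E x y\<rbrakk> \<Longrightarrow> ocmp E x x y f (oid E x) = f"
    and cmp_id_left [simp]: "\<lbrakk>x \<in> oobj E; y \<in> oobj E; f \<in> ohom E x y\<rbrakk> \<Longrightarrow> ocmp E x y y (oid E y) f = f"
    and cmp_assoc [simp]: "\<lbrakk>x \<in> oobj E; y \<in> oobj E; z \<in> oobj E; w \<in> oobj E;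
        f \<in> ohom E x y; g \<in> ohom E y z; h \<in> ohom E z w\<rbrakk>
      \<Longrightarrow> ocmp E x y w (ocmp E y z w h g) f = ocmp E x z w h (ocmp E x y z g f)"
begin

definition inverses :: "'u \<Rightarrow> 'u \<Rightarrow> 'u \<Rightarrow> 'u \<Rightarrow> bool" where
  "inverses x y f g \<longleftrightarrow> f \<in> ohom E x y \<and> g \<in> ohom E y x \<and>
     ocmp E x y x g f = oid E x \<and> ocmp E y x y f g = oid E y"

lemma inverses_id: "x \<in> oobj E \<Longrightarrow> inverses x x (oid E x) (oid E x)"
  by (auto simp: inverses_def)

lemma inverses_cancel:
  assumes "inverses x y f g" and "x \<in> oobj E" and "y \<in> oobj E" and "w \<in> oobj E"
  shows "h \<in> ohom E w x \<Longrightarrow> ocmp E w y x g (ocmp E w x y f h) = h"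
    and "h \<in> ohom E w y \<Longrightarrow> ocmp E w x y f (ocmp E w y x g h) = h"
  using assms cmp_assoc[of w x y x h f g] cmp_assoc[of w y x y h g f]
  by (auto simp: inverses_def simp del: cmp_assoc)

end

section \<open>The isomorphism nerve\<close>

text \<open>
  An object of the nerve of \<open>E\<close> over the cube \<open>J\<close> is a functor to \<open>E\<close> from the chaotic groupoid on the
  vertices of \<open>J\<close>, with values \<open>vtx J u V\<close> on vertices and \<open>edge J u V W\<close> on the unique arrow from
  \<open>V\<close> to \<open>W\<close>. A morphism is a natural transformation, with components \<open>cpt J m V\<close>. Both are stored
  as elements of \<open>'u\<close> through \<open>code\<close>; the equation with \<open>mk_ob\<close> or \<open>mk_hom\<close> makes them extensional.
\<close>

definition vertices :: "cube \<Rightarrow> cube list" where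
  "vertices J = (SOME Vs. set Vs = Pow J)"

definition ob_keys :: "cube \<Rightarrow> (cube + cube \<times> cube) list" where
  "ob_keys J = map Inl (vertices J) @ map Inr (List.product (vertices J) (vertices J))"

definition mk_ob :: "cube \<Rightarrow> (cube \<Rightarrow> 'u) \<Rightarrow> (cube \<Rightarrow> cube \<Rightarrow> 'u) \<Rightarrow> 'u" where
  "mk_ob J X e = code (ob_keys J) (case_sum X (case_prod e))"

definition vtx :: "cube \<Rightarrow> 'u \<Rightarrow> cube \<Rightarrow> 'u" where
  "vtx J u V = decode (ob_keys J) u (Inl V)"

definition edge :: "cube \<Rightarrow> 'u \<Rightarrow> cube \<Rightarrow> cube \<Rightarrow> 'u" where
  "edge J u V W = decode (ob_keys J) u (Inr (V, W))"

definition mk_hom :: "cube \<Rightarrow> (cube \<Rightarrow> 'u) \<Rightarrow> 'u" where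
  "mk_hom J m = code (vertices J) m"

definition cpt :: "cube \<Rightarrow> 'u \<Rightarrow> cube \<Rightarrow> 'u" where
  "cpt J m V = decode (vertices J) m V"

definition chaotic_functor :: "'u ocat \<Rightarrow> cube \<Rightarrow> (cube \<Rightarrow> 'u) \<Rightarrow> (cube \<Rightarrow> cube \<Rightarrow> 'u) \<Rightarrow> bool" where
  "chaotic_functor E J X e \<longleftrightarrow>
     (\<forall>V\<subseteq>J. X V \<in> oobj E \<and> e V V = oid E (X V)) \<and>
     (\<forall>V\<subseteq>J. \<forall>W\<subseteq>J. e V W \<in> ohom E (X V) (X W)) \<and>
     (\<forall>V\<subseteq>J. \<forall>W\<subseteq>J. \<forall>Z\<subseteq>J. ocmp E (X V) (X W) (X Z) (e W Z) (e V W) = e V Z)"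

definition nerve_ob :: "'u ocat \<Rightarrow> cube \<Rightarrow> 'u set" where
  "nerve_ob E J = {u. u = mk_ob J (vtx J u) (edge J u) \<and> chaotic_functor E J (vtx J u) (edge J u)}"

definition natural_cpts :: "'u ocat \<Rightarrow> cube \<Rightarrow> 'u \<Rightarrow> 'u \<Rightarrow> (cube \<Rightarrow> 'u) \<Rightarrow> bool" where
  "natural_cpts E J x y m \<longleftrightarrow>
     (\<forall>V\<subseteq>J. m V \<in> ohom E (vtx J x V) (vtx J y V)) \<and>
     (\<forall>V\<subseteq>J. \<forall>W\<subseteq>J. ocmp E (vtx J x V) (vtx J y V) (vtx J y W) (edge J y V W) (m V) =
                    ocmp E (vtx J x V) (vtx J x W) (vtx J y W) (m W) (edge J x V W))"

definition nerve_hom :: "'u ocat \<Rightarrow> cube \<Rightarrow> 'u \<Rightarrow> 'u \<Rightarrow> 'u set" where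
  "nerve_hom E J x y = {m. m = mk_hom J (cpt J m) \<and> natural_cpts E J x y (cpt J m)}"

definition res_ob :: "arr \<Rightarrow> 'u \<Rightarrow> 'u" where
  "res_ob f u = mk_ob (src f) (\<lambda>V. vtx (tgt f) u (push f V))
                              (\<lambda>V W. edge (tgt f) u (push f V) (push f W))"

definition res_hom :: "arr \<Rightarrow> 'u \<Rightarrow> 'u" where
  "res_hom f m = mk_hom (src f) (\<lambda>V. cpt (tgt f) m (push f V))"

definition nerve :: "'u ocat \<Rightarrow> (unit, 'u) icat" where
  "nerve E =
     \<lparr>Ob = \<lparr>Fib = \<lambda>J _. nerve_ob E J, tr = \<lambda>f _. res_ob f\<rparr>,
      Hom = \<lparr>Fib = \<lambda>J ((_, x), y). nerve_hom E J x y, tr = \<lambda>f _. res_hom f\<rparr>,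
      EqHom = \<lambda>J _ x y f g. f = g,
      Idn = \<lambda>J _ x. mk_hom J (\<lambda>V. oid E (vtx J x V)),
      Cmp = \<lambda>J _ x y z g f. mk_hom J (\<lambda>V. ocmp E (vtx J x V) (vtx J y V) (vtx J z V) (cpt J g V) (cpt J f V))\<rparr>"

lemma nerve_simps [simp]:
  "ob (nerve E) J \<gamma> = nerve_ob E J" "ob_tr (nerve E) f \<gamma> = res_ob f"
  "hom (nerve E) J \<gamma> x y = nerve_hom E J x y" "tr (Hom (nerve E)) f q = res_hom f"
  "EqHom (nerve E) J \<gamma> x y m m' \<longleftrightarrow> m = m'"
  "Idn (nerve E) J \<gamma> x = mk_hom J (\<lambda>V. oid E (vtx J x V))"
  "Cmp (nerve E) J \<gamma> x y z m' m =
     mk_hom J (\<lambda>V. ocmp E (vtx J x V) (vtx J y V) (vtx J z V) (cpt J m' V) (cpt J m V))"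
  by (auto simp: nerve_def)

lemma set_vertices: "finite J \<Longrightarrow> set (vertices J) = Pow J"
  unfolding vertices_def by (rule someI_ex) (simp add: finite_list)

lemma set_ob_keys: "finite J \<Longrightarrow> set (ob_keys J) = Inl ` Pow J \<union> Inr ` (Pow J \<times> Pow J)"
  by (simp add: ob_keys_def set_vertices)

locale iso_nerve = ordinary_category E for E :: "'u ocat" +
  assumes infinite: "infinite (UNIV :: 'u set)"
begin

lemma mk_ob_simps [simp]:
  assumes "finite J" and "V \<subseteq> J"
  shows "vtx J (mk_ob J X e :: 'u) V = X V"
    and "W \<subseteq> J \<Longrightarrow> edge J (mk_ob J X e :: 'u) V W = e V W"
  using assms by (auto simp: vtx_def edge_def mk_ob_def decode_code[OF infinite] set_ob_keys)

lemma mk_hom_simps [simp]: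
  assumes "finite J" and "V \<subseteq> J"
  shows "cpt J (mk_hom J m :: 'u) V = m V"
  using assms by (auto simp: cpt_def mk_hom_def decode_code[OF infinite] set_vertices)

lemma mk_ob_cong:
  assumes "finite J" and "\<And>V. V \<subseteq> J \<Longrightarrow> X V = X' V"
    and "\<And>V W. V \<subseteq> J \<Longrightarrow> W \<subseteq> J \<Longrightarrow> e V W = e' V W"
  shows "mk_ob J X e = (mk_ob J X' e' :: 'u)"
  using assms unfolding mk_ob_def by (intro code_cong) (auto simp: set_ob_keys)

lemma mk_hom_cong:
  assumes "finite J" and "\<And>V. V \<subseteq> J \<Longrightarrow> m V = m' V"
  shows "mk_hom J m = (mk_hom J m' :: 'u)"
  using assms unfolding mk_hom_def by (intro code_cong) (auto simp: set_vertices)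

lemma mk_ob_in:
  assumes "finite J" and "chaotic_functor E J X e"
  shows "mk_ob J X e \<in> nerve_ob E J"
  using assms by (auto simp: nerve_ob_def chaotic_functor_def intro!: mk_ob_cong)

lemma mk_hom_in:
  assumes "finite J" and "natural_cpts E J x y m"
  shows "mk_hom J m \<in> nerve_hom E J x y"
  using assms by (auto simp: nerve_hom_def natural_cpts_def intro!: mk_hom_cong)

lemma nerve_ob_eqI:
  assumes "finite J" and "u \<in> nerve_ob E J" and "u' \<in> nerve_ob E J"
    and "\<And>V. V \<subseteq> J \<Longrightarrow> vtx J u V = vtx J u' V"
    and "\<And>V W. V \<subseteq> J \<Longrightarrow> W \<subseteq> J \<Longrightarrow> edge J u V W = edge J u' V W"
  shows "u = u'"
proof -
  have "u = mk_ob J (vtx J u) (edge J u)" using assms(2) unfolding nerve_ob_def by blast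
  also have "\<dots> = mk_ob J (vtx J u') (edge J u')" using assms(1,4,5) by (rule mk_ob_cong)
  also have "\<dots> = u'" using assms(3) unfolding nerve_ob_def by (auto dest: sym)
  finally show ?thesis .
qed

lemma nerve_hom_eqI:
  assumes "finite J" and "m \<in> nerve_hom E J x y" and "m' \<in> nerve_hom E J x' y'"
    and "\<And>V. V \<subseteq> J \<Longrightarrow> cpt J m V = cpt J m' V"
  shows "m = m'"
proof -
  have "m = mk_hom J (cpt J m)" using assms(2) unfolding nerve_hom_def by blast
  also have "\<dots> = mk_hom J (cpt J m')" using assms(1,4) by (rule mk_hom_cong)
  also have "\<dots> = m'" using assms(3) unfolding nerve_hom_def by (auto dest: sym)
  finally show ?thesis .
qed

lemma nerve_obD:
  assumes "u \<in> nerve_ob E J"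
  shows "V \<subseteq> J \<Longrightarrow> vtx J u V \<in> oobj E"
    and "V \<subseteq> J \<Longrightarrow> edge J u V V = oid E (vtx J u V)"
    and "V \<subseteq> J \<Longrightarrow> W \<subseteq> J \<Longrightarrow> edge J u V W \<in> ohom E (vtx J u V) (vtx J u W)"
    and "V \<subseteq> J \<Longrightarrow> W \<subseteq> J \<Longrightarrow> Z \<subseteq> J \<Longrightarrow>
      ocmp E (vtx J u V) (vtx J u W) (vtx J u Z) (edge J u W Z) (edge J u V W) = edge J u V Z"
proof -
  have "chaotic_functor E J (vtx J u) (edge J u)" using assms unfolding nerve_ob_def by blast
  then show "V \<subseteq> J \<Longrightarrow> vtx J u V \<in> oobj E"
    and "V \<subseteq> J \<Longrightarrow> edge J u V V = oid E (vtx J u V)"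
    and "V \<subseteq> J \<Longrightarrow> W \<subseteq> J \<Longrightarrow> edge J u V W \<in> ohom E (vtx J u V) (vtx J u W)"
    and "V \<subseteq> J \<Longrightarrow> W \<subseteq> J \<Longrightarrow> Z \<subseteq> J \<Longrightarrow>
      ocmp E (vtx J u V) (vtx J u W) (vtx J u Z) (edge J u W Z) (edge J u V W) = edge J u V Z"
    by (simp_all add: chaotic_functor_def)
qed

lemma edge_inverses:
  assumes "u \<in> nerve_ob E J" and "V \<subseteq> J" and "W \<subseteq> J"
  shows "inverses (vtx J u V) (vtx J u W) (edge J u V W) (edge J u W V)"
  using nerve_obD[OF assms(1)] assms(2,3) by (simp add: inverses_def)

lemma nerve_homD:
  assumes "m \<in> nerve_hom E J x y"
  shows "V \<subseteq> J \<Longrightarrow> cpt J m V \<in> ohom E (vtx J x V) (vtx J y V)"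
    and "V \<subseteq> J \<Longrightarrow> W \<subseteq> J \<Longrightarrow>
      ocmp E (vtx J x V) (vtx J y V) (vtx J y W) (edge J y V W) (cpt J m V) =
      ocmp E (vtx J x V) (vtx J x W) (vtx J y W) (cpt J m W) (edge J x V W)"
proof -
  have "natural_cpts E J x y (cpt J m)" using assms unfolding nerve_hom_def by blast
  then show "V \<subseteq> J \<Longrightarrow> cpt J m V \<in> ohom E (vtx J x V) (vtx J y V)"
    and "V \<subseteq> J \<Longrightarrow> W \<subseteq> J \<Longrightarrow>
      ocmp E (vtx J x V) (vtx J y V) (vtx J y W) (edge J y V W) (cpt J m V) =
      ocmp E (vtx J x V) (vtx J x W) (vtx J y W) (cpt J m W) (edge J x V W)"
    by (simp_all add: natural_cpts_def)
qed

lemma res_simps [simp]: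
  assumes "is_arr f" and "V \<subseteq> src f"
  shows "vtx (src f) (res_ob f u :: 'u) V = vtx (tgt f) u (push f V)"
    and "W \<subseteq> src f \<Longrightarrow> edge (src f) (res_ob f u :: 'u) V W = edge (tgt f) u (push f V) (push f W)"
    and "cpt (src f) (res_hom f m :: 'u) V = cpt (tgt f) m (push f V)"
  using assms by (auto simp: res_ob_def res_hom_def)

lemma res_ob_in [simp]:
  assumes "is_arr f" and "u \<in> nerve_ob E (tgt f)"
  shows "res_ob f u \<in> nerve_ob E (src f)"
  unfolding res_ob_def using assms nerve_obD[OF assms(2)]
  by (intro mk_ob_in) (auto simp: chaotic_functor_def)

lemma res_hom_in [simp]:
  assumes "is_arr f" and "m \<in> nerve_hom E (tgt f) x y"
  shows "res_hom f m \<in> nerve_hom E (src f) (res_ob f x) (res_ob f y)"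
  unfolding res_hom_def using assms nerve_homD[OF assms(2)]
  by (intro mk_hom_in) (auto simp: natural_cpts_def)

lemma res_ob_functorial:
  shows "finite J \<Longrightarrow> u \<in> nerve_ob E J \<Longrightarrow> res_ob (cube_id J) u = u"
    and "is_arr f \<Longrightarrow> is_arr g \<Longrightarrow> tgt g = src f \<Longrightarrow> res_ob (cube_comp f g) u = res_ob g (res_ob f u :: 'u)"
proof -
  assume J: "finite J" and u: "u \<in> nerve_ob E J"
  have "res_ob (cube_id J) u = mk_ob J (vtx J u) (edge J u)"
    unfolding res_ob_def using J by (auto intro!: mk_ob_cong)
  also have "\<dots> = u" using u unfolding nerve_ob_def by (auto dest: sym)
  finally show "res_ob (cube_id J) u = u" .
next
  assume fg: "is_arr f" "is_arr g" "tgt g = src f"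
  note res_simps[OF fg(1), simp del]
  have [simp]: "push g V \<subseteq> src f" for V using fg(3) push_subset[of g V] by simp
  show "res_ob (cube_comp f g) u = res_ob g (res_ob f u)"
    using fg by (auto simp: res_ob_def[of g] res_ob_def[of "cube_comp f g"] res_simps[OF fg(1)]
        intro!: mk_ob_cong)
qed

lemma res_hom_functorial:
  shows "finite J \<Longrightarrow> m \<in> nerve_hom E J x y \<Longrightarrow> res_hom (cube_id J) m = m"
    and "is_arr f \<Longrightarrow> is_arr g \<Longrightarrow> tgt g = src f \<Longrightarrow> res_hom (cube_comp f g) m = res_hom g (res_hom f m :: 'u)"
proof -
  assume J: "finite J" and m: "m \<in> nerve_hom E J x y"
  have "res_hom (cube_id J) m = mk_hom J (cpt J m)"
    unfolding res_hom_def using J by (auto intro!: mk_hom_cong)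
  also have "\<dots> = m" using m unfolding nerve_hom_def by (auto dest: sym)
  finally show "res_hom (cube_id J) m = m" .
next
  assume fg: "is_arr f" "is_arr g" "tgt g = src f"
  have [simp]: "push g V \<subseteq> src f" for V using fg(3) push_subset[of g V] by simp
  show "res_hom (cube_comp f g) m = res_hom g (res_hom f m)"
    using fg by (auto simp: res_hom_def[of g] res_hom_def[of "cube_comp f g"] res_simps[OF fg(1)]
        intro!: mk_hom_cong)
qed

lemma nerve_id_in:
  assumes "finite J" and "x \<in> nerve_ob E J"
  shows "mk_hom J (\<lambda>V. oid E (vtx J x V)) \<in> nerve_hom E J x x"
  using assms nerve_obD[OF assms(2)] by (intro mk_hom_in) (auto simp: natural_cpts_def)

lemma nerve_cmp_in:
  assumes "finite J" and x: "x \<in> nerve_ob E J" and y: "y \<in> nerve_ob E J" and z: "z \<in> nerve_ob E J"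
    and f: "f \<in> nerve_hom E J x y" and g: "g \<in> nerve_hom E J y z"
  shows "mk_hom J (\<lambda>V. ocmp E (vtx J x V) (vtx J y V) (vtx J z V) (cpt J g V) (cpt J f V))
    \<in> nerve_hom E J x z"
proof (intro mk_hom_in)
  note D = nerve_obD[OF x] nerve_obD[OF y] nerve_obD[OF z] nerve_homD(1)[OF f] nerve_homD(1)[OF g]
  show "natural_cpts E J x z (\<lambda>V. ocmp E (vtx J x V) (vtx J y V) (vtx J z V) (cpt J g V) (cpt J f V))"
    unfolding natural_cpts_def
  proof (intro conjI allI impI)
    fix V W assume VW: "V \<subseteq> J" "W \<subseteq> J"
    show "ocmp E (vtx J x V) (vtx J y V) (vtx J z V) (cpt J g V) (cpt J f V)
        \<in> ohom E (vtx J x V) (vtx J z V)"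
      using D VW by simp
    have "ocmp E (vtx J x V) (vtx J z V) (vtx J z W) (edge J z V W)
          (ocmp E (vtx J x V) (vtx J y V) (vtx J z V) (cpt J g V) (cpt J f V)) =
        ocmp E (vtx J x V) (vtx J y V) (vtx J z W)
          (ocmp E (vtx J y V) (vtx J z V) (vtx J z W) (edge J z V W) (cpt J g V)) (cpt J f V)"
      using D VW by simp
    also have "\<dots> = ocmp E (vtx J x V) (vtx J y W) (vtx J z W) (cpt J g W)
          (ocmp E (vtx J x V) (vtx J y V) (vtx J y W) (edge J y V W) (cpt J f V))"
      unfolding nerve_homD(2)[OF g VW] using D VW by simp
    also have "\<dots> = ocmp E (vtx J x V) (vtx J x W) (vtx J z W)
          (ocmp E (vtx J x W) (vtx J y W) (vtx J z W) (cpt J g W) (cpt J f W)) (edge J x V W)"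
      unfolding nerve_homD(2)[OF f VW] using D VW by simp
    finally show "ocmp E (vtx J x V) (vtx J z V) (vtx J z W) (edge J z V W)
          (ocmp E (vtx J x V) (vtx J y V) (vtx J z V) (cpt J g V) (cpt J f V)) =
        ocmp E (vtx J x V) (vtx J x W) (vtx J z W)
          (ocmp E (vtx J x W) (vtx J y W) (vtx J z W) (cpt J g W) (cpt J f W)) (edge J x V W)" .
  qed
qed fact

lemma nerve_ctx [simp]:
  "q \<in> El (ob2_ctx terminal_psh (nerve E)) J \<longleftrightarrow> snd (fst q) \<in> nerve_ob E J \<and> snd q \<in> nerve_ob E J"
  "act (ob2_ctx terminal_psh (nerve E)) f q = (((), res_ob f (snd (fst q))), res_ob f (snd q))"
  "q' \<in> El (par_ctx terminal_psh (nerve E)) J \<longleftrightarrow>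
     snd (fst (fst (fst q'))) \<in> nerve_ob E J \<and> snd (fst (fst q')) \<in> nerve_ob E J \<and>
     snd (fst q') \<in> nerve_hom E J (snd (fst (fst (fst q')))) (snd (fst (fst q'))) \<and>
     snd q' \<in> nerve_hom E J (snd (fst (fst (fst q')))) (snd (fst (fst q')))"
  "act (par_ctx terminal_psh (nerve E)) f q' =
     (((((), res_ob f (snd (fst (fst (fst q'))))), res_ob f (snd (fst (fst q')))),
       res_hom f (snd (fst q'))), res_hom f (snd q'))"
  by (cases q; cases "fst q"; cases q'; cases "fst q'"; cases "fst (fst q')"; cases "fst (fst (fst q'))";
      auto simp: ob2_ctx_def par_ctx_def hom_ctx_def ext_def reindex_def terminal_psh_def nerve_def)+

lemma nerve_id_laws:
  assumes "finite J" and x: "x \<in> nerve_ob E J" and y: "y \<in> nerve_ob E J" and f: "f \<in> nerve_hom E J x y"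
  shows "Cmp (nerve E) J \<gamma> x x y f (Idn (nerve E) J \<gamma> x) = f"
    and "Cmp (nerve E) J \<gamma> x y y (Idn (nerve E) J \<gamma> y) f = f"
proof -
  note D = assms nerve_obD(1)[OF x] nerve_obD(1)[OF y] nerve_homD(1)[OF f] nerve_id_in nerve_cmp_in
  show "Cmp (nerve E) J \<gamma> x x y f (Idn (nerve E) J \<gamma> x) = f"
    by (rule nerve_hom_eqI[of J _ x y _ x y]) (simp_all add: D)
  show "Cmp (nerve E) J \<gamma> x y y (Idn (nerve E) J \<gamma> y) f = f"
    by (rule nerve_hom_eqI[of J _ x y _ x y]) (simp_all add: D)
qed

lemma nerve_assoc:
  assumes "finite J" and x: "x \<in> nerve_ob E J" and y: "y \<in> nerve_ob E J"
    and z: "z \<in> nerve_ob E J" and w: "w \<in> nerve_ob E J"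
    and f: "f \<in> nerve_hom E J x y" and g: "g \<in> nerve_hom E J y z" and h: "h \<in> nerve_hom E J z w"
  shows "Cmp (nerve E) J \<gamma> x z w h (Cmp (nerve E) J \<gamma> x y z g f) =
         Cmp (nerve E) J \<gamma> x y w (Cmp (nerve E) J \<gamma> y z w h g) f"
  using assms(1) nerve_obD(1)[OF x] nerve_obD(1)[OF y] nerve_obD(1)[OF z] nerve_obD(1)[OF w]
    nerve_homD(1)[OF f] nerve_homD(1)[OF g] nerve_homD(1)[OF h]
  by (auto intro!: mk_hom_cong)

lemma nerve_res_laws:
  assumes "is_arr u"
  shows "res_hom u (Idn (nerve E) (tgt u) \<gamma> x) = Idn (nerve E) (src u) \<gamma> (res_ob u x)"
    and "res_hom u (Cmp (nerve E) (tgt u) \<gamma> x y z g f) = Cmp (nerve E) (src u) \<gamma>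
      (res_ob u x) (res_ob u y) (res_ob u z) (res_hom u g) (res_hom u f)"
  using assms by (auto simp: res_hom_def[of _ "mk_hom _ _"] intro!: mk_hom_cong)

theorem nerve_is_icat: "is_icat terminal_psh (nerve E)"
proof -
  have fams: "family terminal_psh (Ob (nerve E))" "family (ob2_ctx terminal_psh (nerve E)) (Hom (nerve E))"
    "family (par_ctx terminal_psh (nerve E)) (eq_fam (nerve E))"
    using res_ob_functorial res_hom_functorial by (auto simp: family_def eq_fam_def split: if_splits)
  have id: "Idn (nerve E) J \<gamma> x \<in> nerve_hom E J x x"
    if "finite J" "x \<in> nerve_ob E J" for J x \<gamma>
    using that nerve_id_in by simp
  have cmp: "Cmp (nerve E) J \<gamma> x y z g f \<in> nerve_hom E J x z"
    if "finite J" "x \<in> nerve_ob E J" "y \<in> nerve_ob E J" "z \<in> nerve_ob E J"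
      "f \<in> nerve_hom E J x y" "g \<in> nerve_hom E J y z" for J x y z f g \<gamma>
    using that nerve_cmp_in by simp
  show ?thesis
    unfolding is_icat_def nerve_simps(1-5)
    by (intro conjI allI impI ballI)
      (simp_all only: fams id cmp nerve_id_laws nerve_assoc nerve_res_laws terminal_simps)
qed

end

section \<open>Lines in the nerve\<close>

definition sieve :: "cube \<Rightarrow> arr set \<Rightarrow> bool" where
  "sieve J \<alpha> \<longleftrightarrow> (\<forall>f\<in>\<alpha>. is_arr f \<and> tgt f = J \<and>
     (\<forall>g. is_arr g \<and> tgt g = src f \<longrightarrow> cube_comp f g \<in> \<alpha>))"

lemma sieve_cof: "\<alpha> \<in> cof J \<Longrightarrow> sieve J \<alpha>"
  using cof_sieve[of \<alpha> J] by (auto simp: sieve_def)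

lemma sieve_top: "sieve J (top_sieve J)"
  by (auto simp: sieve_def top_sieve_def)

text \<open>
  Elements of exponentials and partial lines are all families of values over a sieve that are compatible
  with the restriction \<open>R\<close>; dealing with them uniformly avoids repeating each argument for objects and for
  morphisms, and for total and for partial lines.
\<close>

definition natural_on :: "(arr \<Rightarrow> 'a \<Rightarrow> 'a) \<Rightarrow> arr set \<Rightarrow> (arr \<times> pt \<Rightarrow> 'a) \<Rightarrow> bool" where
  "natural_on R \<alpha> t \<longleftrightarrow> (\<forall>f\<in>\<alpha>. \<forall>i\<in>ipts (src f). \<forall>g. is_arr g \<and> tgt g = src f \<longrightarrow>
     R g (t (f, i)) = t (cube_comp f g, pt_act g i))"

lemma natural_onD:
  "\<lbrakk>natural_on R \<alpha> t; f \<in> \<alpha>; i \<in> ipts (src f); is_arr g; tgt g = src f\<rbrakk>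
    \<Longrightarrow> R g (t (f, i)) = t (cube_comp f g, pt_act g i)"
  by (auto simp: natural_on_def)

text \<open>
  Over a vertex \<open>V\<close>, a natural line \<open>t\<close> is determined by its value at the degenerate line at \<open>V\<close> and the
  generic point \<open>Var 0\<close> of the interval. This value lives over a one-dimensional cube, whose two end points
  are \<open>tip False\<close> and \<open>tip True\<close>. Its points and the
  isomorphisms between them are \<open>at\<close> and \<open>move\<close>; the components of a line of morphisms are \<open>cpt_at\<close>.
\<close>

definition line_at :: "cube \<Rightarrow> (arr \<times> pt \<Rightarrow> 'u) \<Rightarrow> cube \<Rightarrow> 'u" where
  "line_at J t V = t (const_line J V, Var 0)"

definition at :: "cube \<Rightarrow> (arr \<times> pt \<Rightarrow> 'u) \<Rightarrow> cube \<Rightarrow> bool \<Rightarrow> 'u" where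
  "at J t V p = vtx {0} (line_at J t V) (tip p)"

definition move :: "cube \<Rightarrow> (arr \<times> pt \<Rightarrow> 'u) \<Rightarrow> cube \<Rightarrow> bool \<Rightarrow> bool \<Rightarrow> 'u" where
  "move J t V p q = edge {0} (line_at J t V) (tip p) (tip q)"

definition cpt_at :: "cube \<Rightarrow> (arr \<times> pt \<Rightarrow> 'u) \<Rightarrow> cube \<Rightarrow> bool \<Rightarrow> 'u" where
  "cpt_at J m V p = cpt {0} (line_at J m V) (tip p)"

definition end_arr :: "bool \<Rightarrow> arr" where
  "end_arr p = Arr {0} {0} (\<lambda>j\<in>{0}. end_pt p)"

lemma end_arr_simps [simp]: "src (end_arr p) = {0}" "tgt (end_arr p) = {0}" "is_arr (end_arr p)"
  "amap (end_arr p) 0 = end_pt p" "push (end_arr p) V = tip p"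
  by (auto simp: end_arr_def is_arr_def push_def tip_def)

lemma const_line_end: "finite J \<Longrightarrow> cube_comp (const_line J V) (end_arr p) = const_line J V"
  by (intro arr_eqI) simp_all

lemma const_line_in:
  assumes "sieve J \<alpha>" and "f \<in> \<alpha>"
  shows "const_line J (push f V) \<in> \<alpha>"
proof -
  have "is_arr f" "tgt f = J" using assms by (auto simp: sieve_def)
  moreover from this have "cube_comp f (const_line (src f) V) \<in> \<alpha>"
    using assms unfolding sieve_def by simp
  ultimately show ?thesis by (simp add: comp_const_line)
qed

text \<open>
  Restricting \<open>t (f, i)\<close> to the degenerate line at a vertex gives the constant line at a point of
  the line of \<open>t\<close> over that vertex.
\<close>

lemma natural_on_at_vertex:
  assumes "sieve J \<alpha>" and "natural_on R \<alpha> t" and "f \<in> \<alpha>" and "i \<in> ipts (src f)"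
  shows "R (const_line (src f) V) (t (f, i)) = R (end_arr (coord V i)) (line_at J t (push f V))"
proof -
  have f: "is_arr f" "tgt f = J" using assms by (auto simp: sieve_def)
  then have "finite J" by auto
  have c: "const_line J (push f V) \<in> \<alpha>" using assms const_line_in by blast
  have "R (const_line (src f) V) (t (f, i)) = t (const_line J (push f V), end_pt (coord V i))"
    using natural_onD[OF assms(2,3,4), of "const_line (src f) V"] f assms(4)
    by (simp add: comp_const_line)
  also have "\<dots> = R (end_arr (coord V i)) (line_at J t (push f V))"
    using natural_onD[OF assms(2) c, of "Var 0" "end_arr (coord V i)"]
    by (simp add: line_at_def const_line_end \<open>finite J\<close>)
  finally show ?thesis .
qed

context iso_nerve
begin

lemma vtx_eq_at:
  assumes "sieve J \<alpha>" and "natural_on res_ob \<alpha> (t :: _ \<Rightarrow> 'u)" and "f \<in> \<alpha>" and "i \<in> ipts (src f)"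
    and "V \<subseteq> src f"
  shows "vtx (src f) (t (f, i)) V = at J t (push f V) (coord V i)"
proof -
  have "finite (src f)" using assms by (auto simp: sieve_def)
  then have "vtx (src f) (t (f, i)) V = vtx {0} (res_ob (const_line (src f) V) (t (f, i))) {}"
    using res_simps(1)[of "const_line (src f) V" "{}"] assms(5) by simp
  also have "\<dots> = at J t (push f V) (coord V i)"
    using res_simps(1)[of "end_arr (coord V i)" "{}"]
    unfolding natural_on_at_vertex[OF assms(1-4)] by (simp add: at_def)
  finally show ?thesis .
qed

lemma cpt_eq_at:
  assumes "sieve J \<alpha>" and "natural_on res_hom \<alpha> (m :: _ \<Rightarrow> 'u)" and "f \<in> \<alpha>" and "i \<in> ipts (src f)"
    and "V \<subseteq> src f"
  shows "cpt (src f) (m (f, i)) V = cpt_at J m (push f V) (coord V i)"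
proof -
  have "finite (src f)" using assms by (auto simp: sieve_def)
  then have "cpt (src f) (m (f, i)) V = cpt {0} (res_hom (const_line (src f) V) (m (f, i))) {}"
    using res_simps(3)[of "const_line (src f) V" "{}"] assms(5) by simp
  also have "\<dots> = cpt_at J m (push f V) (coord V i)"
    using res_simps(3)[of "end_arr (coord V i)" "{}"]
    unfolding natural_on_at_vertex[OF assms(1-4)] by (simp add: cpt_at_def)
  finally show ?thesis .
qed

definition ob_line :: "arr set \<Rightarrow> (arr \<times> pt \<Rightarrow> 'u) \<Rightarrow> bool" where
  "ob_line \<alpha> t \<longleftrightarrow> natural_on res_ob \<alpha> t \<and> (\<forall>f\<in>\<alpha>. \<forall>i\<in>ipts (src f). t (f, i) \<in> nerve_ob E (src f))"

definition hom_line :: "arr set \<Rightarrow> (arr \<times> pt \<Rightarrow> 'u) \<Rightarrow> (arr \<times> pt \<Rightarrow> 'u) \<Rightarrow> (arr \<times> pt \<Rightarrow> 'u) \<Rightarrow> bool" where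
  "hom_line \<alpha> x y m \<longleftrightarrow> natural_on res_hom \<alpha> m \<and>
     (\<forall>f\<in>\<alpha>. \<forall>i\<in>ipts (src f). m (f, i) \<in> nerve_hom E (src f) (x (f, i)) (y (f, i)))"

lemma line_at_in:
  assumes "ob_line \<alpha> t" and "const_line J V \<in> \<alpha>"
  shows "line_at J t V \<in> nerve_ob E {0}"
proof -
  have "Var 0 \<in> ipts (src (const_line J V))" by simp
  then have "t (const_line J V, Var 0) \<in> nerve_ob E (src (const_line J V))"
    using assms unfolding ob_line_def by blast
  then show ?thesis by (simp add: line_at_def)
qed

text \<open>
  Over a vertex, a line of objects is a functor on the chaotic groupoid with two objects.
\<close>

lemma at_move:
  assumes "ob_line \<alpha> t" and "const_line J V \<in> \<alpha>"
  shows "at J t V p \<in> oobj E"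
    and "move J t V p p = oid E (at J t V p)"
    and "move J t V p q \<in> ohom E (at J t V p) (at J t V q)"
    and "inverses (at J t V p) (at J t V q) (move J t V p q) (move J t V q p)"
    and "ocmp E (at J t V p) (at J t V q) (at J t V p') (move J t V q p') (move J t V p q) = move J t V p p'"
  using nerve_obD[OF line_at_in[OF assms]] edge_inverses[OF line_at_in[OF assms]]
  by (simp_all add: at_def move_def)

lemma cpt_at_move:
  assumes "hom_line \<alpha> x y m" and "const_line J V \<in> \<alpha>"
  shows "cpt_at J m V p \<in> ohom E (at J x V p) (at J y V p)"
    and "ocmp E (at J x V p) (at J y V p) (at J y V q) (move J y V p q) (cpt_at J m V p) =
         ocmp E (at J x V p) (at J x V q) (at J y V q) (cpt_at J m V q) (move J x V p q)"
proof -
  have "Var 0 \<in> ipts (src (const_line J V))" by simp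
  then have "m (const_line J V, Var 0) \<in>
      nerve_hom E (src (const_line J V)) (x (const_line J V, Var 0)) (y (const_line J V, Var 0))"
    using assms unfolding hom_line_def by blast
  then have m: "line_at J m V \<in> nerve_hom E {0} (line_at J x V) (line_at J y V)"
    by (simp add: line_at_def)
  from nerve_homD[OF m]
  show "cpt_at J m V p \<in> ohom E (at J x V p) (at J y V p)"
    and "ocmp E (at J x V p) (at J y V p) (at J y V q) (move J y V p q) (cpt_at J m V p) =
         ocmp E (at J x V p) (at J x V q) (at J y V q) (cpt_at J m V q) (move J x V p q)"
    by (simp_all add: cpt_at_def at_def move_def)
qed

text \<open>
  The isomorphisms \<open>move\<close> are compatible with the edges of the values of the line: all of them are
  edges of the single value of \<open>t\<close> at the generic point of the line, which lives over the cube \<open>src f\<close>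
  extended by a fresh coordinate \<open>k\<close>.
\<close>

lemma move_edge:
  assumes s: "sieve J \<alpha>" and t: "ob_line \<alpha> t" and f: "f \<in> \<alpha>"
    and i: "i \<in> ipts (src f)" "i' \<in> ipts (src f)" and VW: "V \<subseteq> src f" "W \<subseteq> src f"
  shows "ocmp E (vtx (src f) (t (f, i)) V) (vtx (src f) (t (f, i)) W) (vtx (src f) (t (f, i')) W)
      (move J t (push f W) (coord W i) (coord W i')) (edge (src f) (t (f, i)) V W) =
    ocmp E (vtx (src f) (t (f, i)) V) (vtx (src f) (t (f, i')) V) (vtx (src f) (t (f, i')) W)
      (edge (src f) (t (f, i')) V W) (move J t (push f V) (coord V i) (coord V i'))"
proof -
  define K where "K = src f"
  have fa: "is_arr f" "tgt f = J" "finite K" using s f by (auto simp: sieve_def K_def)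
  have nat: "natural_on res_ob \<alpha> t" using t by (simp add: ob_line_def)
  obtain k where k: "k \<notin> K" using ex_new_if_finite[OF infinite_UNIV_nat fa(3)] by auto
  define K' where "K' = insert k K"
  have kK: "k \<in> K'" by (simp add: K'_def)
  define \<pi> where "\<pi> = Arr K' K (\<lambda>j\<in>K. Var j)"
  have pi: "src \<pi> = K'" "tgt \<pi> = K" "is_arr \<pi>" "j \<in> K \<Longrightarrow> amap \<pi> j = Var j" for j
    using fa(3) by (auto simp: \<pi>_def K'_def is_arr_def)
  define T where "T = t (cube_comp f \<pi>, Var k)"
  have g: "cube_comp f \<pi> \<in> \<alpha>" using s f pi by (auto simp: sieve_def K_def)
  have T: "T \<in> nerve_ob E K'"
    using t g pi unfolding T_def ob_line_def by (auto simp: K'_def dest!: bspec[of _ _ "cube_comp f \<pi>"])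
  \<comment> \<open>The two vertices of \<open>K'\<close> above a vertex \<open>V\<close> of \<open>K\<close>.\<close>
  define lift where "lift V p = (if p then insert k V else V)" for V p
  have lift: "lift V p \<subseteq> K'" if "V \<subseteq> K" for V p using that by (auto simp: lift_def K'_def)
  \<comment> \<open>The values of the line, and its restrictions to constant lines, are restrictions of \<open>T\<close>.\<close>
  have val: "t (f, i) = res_ob (Arr K K' (\<lambda>j\<in>K'. if j = k then i else Var j)) T" (is "_ = res_ob (?s i) _")
    if "i \<in> ipts K" for i
  proof -
    have s: "src (?s i) = K" "tgt (?s i) = K'" "is_arr (?s i)"
      using that fa(3) by (auto simp: is_arr_def K'_def split: if_splits)
    have "cube_comp f (cube_comp \<pi> (?s i)) = f"
    proof -
      have "cube_comp \<pi> (?s i) = cube_id K"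
        using s pi fa(3) k by (intro arr_eqI) (auto simp: K'_def)
      then show ?thesis using fa by (simp add: K_def)
    qed
    then have f': "cube_comp (cube_comp f \<pi>) (?s i) = f"
      using cube_comp_assoc[of f \<pi> "?s i"] fa pi s by (simp add: K_def)
    have "res_ob (?s i) T = t (cube_comp (cube_comp f \<pi>) (?s i), pt_act (?s i) (Var k))"
      unfolding T_def by (rule natural_onD[OF nat g]) (use pi s kK in simp_all)
    also have "\<dots> = t (f, i)" unfolding f' using kK by simp
    finally show ?thesis by (rule sym)
  qed
  have ps: "push (Arr K K' (\<lambda>j\<in>K'. if j = k then i else Var j)) V = lift V (coord V i)"
    if "V \<subseteq> K" for V i
    using that k by (auto simp: push_def lift_def K'_def)
  have sa: "is_arr (Arr K K' (\<lambda>j\<in>K'. if j = k then i else Var j))" if "i \<in> ipts K" for i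
    using that fa(3) by (auto simp: is_arr_def K'_def split: if_splits)
  have v: "vtx K (t (f, i)) V = vtx K' T (lift V (coord V i))" if "V \<subseteq> K" "i \<in> ipts K" for V i
    unfolding val[OF that(2)] using res_simps(1)[OF sa[OF that(2)], of V T] that by (simp add: ps)
  have e: "edge K (t (f, i)) V W = edge K' T (lift V (coord V i)) (lift W (coord W i))"
    if "V \<subseteq> K" "W \<subseteq> K" "i \<in> ipts K" for V W i
    unfolding val[OF that(3)] using res_simps(2)[OF sa[OF that(3)], of V W T] that by (simp add: ps)
  have m: "move J t (push f V) p q = edge K' T (lift V p) (lift V q)" if "V \<subseteq> K" for V p q
  proof -
    let ?l = "Arr {0} K' (\<lambda>j\<in>K'. if j = k then Var 0 else end_pt (j \<in> V))"
    have l: "src ?l = {0}" "tgt ?l = K'" "is_arr ?l"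
      using fa(3) by (auto simp: is_arr_def K'_def split: if_splits)
    have pl: "push ?l (tip p) = lift V p" for p
      using that k by (auto simp: push_def lift_def K'_def)
    have "cube_comp \<pi> ?l = const_line K V"
      using l pi fa(3) k by (intro arr_eqI) (auto simp: K'_def)
    then have "cube_comp (cube_comp f \<pi>) ?l = const_line J (push f V)"
      using cube_comp_assoc[of f \<pi> ?l] fa pi l comp_const_line[of f V] by (simp add: K_def)
    then have "line_at J t (push f V) = res_ob ?l T"
      using natural_onD[OF nat g, of "Var k" ?l] pi l by (simp add: T_def K'_def line_at_def)
    then show ?thesis
      using res_simps(2)[OF l(3), of "tip p" "tip q" T] pl by (simp add: move_def)
  qed
  show ?thesis
    using i VW unfolding K_def[symmetric] by (simp add: v e m nerve_obD[OF T] lift)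
qed

section \<open>The objects of the nerve are fibrant\<close>

text \<open>
  Objects of the nerve can be changed along isomorphisms \<open>k V\<close> from \<open>vtx J b V\<close> to \<open>X V\<close>, one vertex at a
  time and without any coherence condition: the edges of the new object are the conjugates of the old
  ones. This is the reason why the nerve is fibrant and complete. The inverses are chosen in \<open>E\<close>, for
  each morphism of \<open>E\<close> separately, so that the construction commutes with restriction (\<open>res_conj_ob\<close>).
\<close>

definition inv_of :: "'u \<Rightarrow> 'u \<Rightarrow> 'u \<Rightarrow> 'u" where
  "inv_of x y k = (SOME g. inverses x y k g)"

definition conj_ob :: "cube \<Rightarrow> 'u \<Rightarrow> (cube \<Rightarrow> 'u) \<Rightarrow> (cube \<Rightarrow> 'u) \<Rightarrow> 'u" where
  "conj_ob J b X k = mk_ob J X (\<lambda>V W.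
     ocmp E (X V) (vtx J b W) (X W) (k W)
       (ocmp E (X V) (vtx J b V) (vtx J b W) (edge J b V W) (inv_of (vtx J b V) (X V) (k V))))"

definition iso_cpts :: "cube \<Rightarrow> 'u \<Rightarrow> (cube \<Rightarrow> 'u) \<Rightarrow> (cube \<Rightarrow> 'u) \<Rightarrow> bool" where
  "iso_cpts J b X k \<longleftrightarrow> (\<forall>V\<subseteq>J. X V \<in> oobj E \<and> (\<exists>g. inverses (vtx J b V) (X V) (k V) g))"

lemma iso_cptsD:
  assumes "iso_cpts J b X k" and "V \<subseteq> J"
  shows "X V \<in> oobj E"
    and "inverses (vtx J b V) (X V) (k V) (inv_of (vtx J b V) (X V) (k V))"
  using assms by (auto simp: iso_cpts_def inv_of_def intro: someI)

lemma conj_ob_in: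
  assumes "finite J" and b: "b \<in> nerve_ob E J" and k: "iso_cpts J b X k"
  shows "conj_ob J b X k \<in> nerve_ob E J"
  unfolding conj_ob_def
proof (intro mk_ob_in assms(1))
  let ?k' = "\<lambda>V. inv_of (vtx J b V) (X V) (k V)"
  note D = iso_cptsD(1)[OF k] nerve_obD[OF b]
  have kk: "k V \<in> ohom E (vtx J b V) (X V)" "?k' V \<in> ohom E (X V) (vtx J b V)"
    "ocmp E (X V) (vtx J b V) (X V) (k V) (?k' V) = oid E (X V)" if "V \<subseteq> J" for V
    using iso_cptsD(2)[OF k that] by (auto simp: inverses_def)
  have canc: "ocmp E w (X V) (vtx J b V) (?k' V) (ocmp E w (vtx J b V) (X V) (k V) h) = h"
    if "V \<subseteq> J" "w \<in> oobj E" "h \<in> ohom E w (vtx J b V)" for V w h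
    using inverses_cancel(1)[OF iso_cptsD(2)[OF k]] D that by simp
  have edges: "ocmp E w (vtx J b W) (vtx J b Z) (edge J b W Z) (ocmp E w (vtx J b V) (vtx J b W) (edge J b V W) h)
      = ocmp E w (vtx J b V) (vtx J b Z) (edge J b V Z) h"
    if "V \<subseteq> J" "W \<subseteq> J" "Z \<subseteq> J" "w \<in> oobj E" "h \<in> ohom E w (vtx J b V)" for V W Z w h
    using cmp_assoc[of w "vtx J b V" "vtx J b W" "vtx J b Z" h "edge J b V W" "edge J b W Z"] D that
    by simp
  show "chaotic_functor E J X (\<lambda>V W. ocmp E (X V) (vtx J b W) (X W) (k W)
       (ocmp E (X V) (vtx J b V) (vtx J b W) (edge J b V W) (?k' V)))"
    unfolding chaotic_functor_def by (auto simp: D kk canc edges)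
qed

lemma conj_ob_cong:
  assumes "finite J" and "\<And>V. V \<subseteq> J \<Longrightarrow> X V = X' V" and "\<And>V. V \<subseteq> J \<Longrightarrow> k V = k' V"
  shows "conj_ob J b X k = conj_ob J b X' k'"
  using assms unfolding conj_ob_def by (intro mk_ob_cong) auto

lemma res_conj_ob:
  assumes "is_arr f"
  shows "res_ob f (conj_ob (tgt f) b X k) =
    conj_ob (src f) (res_ob f b) (\<lambda>V. X (push f V)) (\<lambda>V. k (push f V))"
  using assms unfolding res_ob_def[of f "conj_ob (tgt f) b X k"] conj_ob_def[of "src f"]
  by (intro mk_ob_cong) (simp_all add: conj_ob_def)

lemma conj_ob_simps:
  assumes "finite J" and "V \<subseteq> J"
  shows "vtx J (conj_ob J b X k) V = X V"
    and "W \<subseteq> J \<Longrightarrow> edge J (conj_ob J b X k) V W = ocmp E (X V) (vtx J b W) (X W) (k W)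
       (ocmp E (X V) (vtx J b V) (vtx J b W) (edge J b V W) (inv_of (vtx J b V) (X V) (k V)))"
  using assms by (auto simp: conj_ob_def)

text \<open>
  The conjugate is the only object with the given values for which \<open>k\<close> is natural.
\<close>

lemma conj_ob_eqI:
  assumes "finite J" and b: "b \<in> nerve_ob E J" and k: "iso_cpts J b X k" and u: "u \<in> nerve_ob E J"
    and X: "\<And>V. V \<subseteq> J \<Longrightarrow> vtx J u V = X V"
    and e: "\<And>V W. V \<subseteq> J \<Longrightarrow> W \<subseteq> J \<Longrightarrow>
      ocmp E (vtx J b V) (vtx J b W) (X W) (k W) (edge J b V W) =
      ocmp E (vtx J b V) (X V) (X W) (edge J u V W) (k V)"
  shows "conj_ob J b X k = u"
proof (rule nerve_ob_eqI[OF assms(1)])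
  show "conj_ob J b X k \<in> nerve_ob E J" by (rule conj_ob_in[OF assms(1) b k])
next
  fix V W assume VW: "V \<subseteq> J" "W \<subseteq> J"
  let ?k' = "\<lambda>V. inv_of (vtx J b V) (X V) (k V)"
  note D = iso_cptsD(1)[OF k] nerve_obD(1,3)[OF b]
  have eu: "edge J u V W \<in> ohom E (X V) (X W)" using nerve_obD(3)[OF u VW] X VW by simp
  have kk: "k V \<in> ohom E (vtx J b V) (X V)" "?k' V \<in> ohom E (X V) (vtx J b V)"
    "ocmp E (X V) (vtx J b V) (X V) (k V) (?k' V) = oid E (X V)" if "V \<subseteq> J" for V
    using iso_cptsD(2)[OF k that] by (auto simp: inverses_def)
  have "edge J (conj_ob J b X k) V W =
      ocmp E (X V) (vtx J b V) (X W) (ocmp E (vtx J b V) (vtx J b W) (X W) (k W) (edge J b V W)) (?k' V)"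
    using VW assms(1) by (simp add: conj_ob_simps D kk)
  also have "\<dots> = edge J u V W"
    unfolding e[OF VW] using VW eu by (simp add: D kk)
  finally show "edge J (conj_ob J b X k) V W = edge J u V W" .
qed (simp_all add: conj_ob_simps assms(1) u X)

end

lemma boxes_El:
  "(a, r, \<alpha>, t, b) \<in> El (boxes A B) J \<longleftrightarrow> a \<in> El (interval_exp A) J \<and> r \<in> ipts J \<and> \<alpha> \<in> cof J \<and>
     t \<in> partial_lines B a \<alpha> \<and> b \<in> Fib B J (a (cube_id J, r)) \<and>
     (\<forall>f\<in>\<alpha>. t (f, pt_act f r) = tr B f (a (cube_id J, r)) b)"
  and boxes_act: "act (boxes A B) f (a, r, \<alpha>, t, b) =
     (act (interval_exp A) f a, pt_act f r, pull_sieve f \<alpha>, shift f \<alpha> t, tr B f (a (cube_id (tgt f), r)) b)"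
  by (auto simp: boxes_def)

lemma shift_simps [simp]:
  "g \<in> pull_sieve f \<alpha> \<Longrightarrow> i \<in> ipts (src g) \<Longrightarrow> shift f \<alpha> p (g, i) = p (cube_comp f g, i)"
  by (auto simp: shift_def on_sieve_def)

lemma in_top_sieve [simp]: "f \<in> top_sieve J \<longleftrightarrow> is_arr f \<and> tgt f = J"
  by (auto simp: top_sieve_def)

lemma in_pull_sieve: "g \<in> pull_sieve f \<alpha> \<longleftrightarrow> is_arr g \<and> tgt g = src f \<and> cube_comp f g \<in> \<alpha>"
  by (auto simp: pull_sieve_def)

lemma const_line_pull:
  "is_arr f \<Longrightarrow> const_line (src f) V \<in> pull_sieve f \<alpha> \<longleftrightarrow> const_line (tgt f) (push f V) \<in> \<alpha>"
  by (simp add: in_pull_sieve comp_const_line)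

lemma line_at_shift:
  assumes "is_arr f" and "const_line (tgt f) (push f V) \<in> \<alpha>"
  shows "line_at (src f) (shift f \<alpha> t) V = line_at (tgt f) t (push f V)"
  using assms by (simp add: line_at_def const_line_pull comp_const_line)

lemma at_shift:
  assumes "is_arr f" and "const_line (tgt f) (push f V) \<in> \<alpha>"
  shows "at (src f) (shift f \<alpha> t) V = at (tgt f) t (push f V)"
    and "move (src f) (shift f \<alpha> t) V = move (tgt f) t (push f V)"
  by (auto simp: at_def move_def fun_eq_iff line_at_shift[OF assms])

lemma interval_exp_act: "act (interval_exp A) f = shift f (top_sieve (tgt f))"
  by (simp add: interval_exp_def)

text \<open>
  A composition that is regular, i.e. trivial from \<open>r\<close> to \<open>r\<close>, is in particular a weak composition
  with constant paths.
\<close>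

lemma fibrant_regularI:
  assumes B: "family A B"
    and w: "\<And>J a r \<alpha> t b s. finite J \<Longrightarrow> (a, r, \<alpha>, t, b) \<in> El (boxes A B) J \<Longrightarrow> s \<in> ipts J \<Longrightarrow>
      w J a r \<alpha> t b s \<in> Fib B J (a (cube_id J, s))"
    and nat: "\<And>f a r \<alpha> t b s. is_arr f \<Longrightarrow> (a, r, \<alpha>, t, b) \<in> El (boxes A B) (tgt f) \<Longrightarrow> s \<in> ipts (tgt f) \<Longrightarrow>
      tr B f (a (cube_id (tgt f), s)) (w (tgt f) a r \<alpha> t b s) =
      w (src f) (shift f (top_sieve (tgt f)) a) (pt_act f r) (pull_sieve f \<alpha>) (shift f \<alpha> t)
        (tr B f (a (cube_id (tgt f), r)) b) (pt_act f s)"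
    and ext: "\<And>J a r \<alpha> t b s f. finite J \<Longrightarrow> (a, r, \<alpha>, t, b) \<in> El (boxes A B) J \<Longrightarrow> s \<in> ipts J \<Longrightarrow>
      f \<in> \<alpha> \<Longrightarrow> tr B f (a (cube_id J, s)) (w J a r \<alpha> t b s) = t (f, pt_act f s)"
    and reg: "\<And>J a r \<alpha> t b. finite J \<Longrightarrow> (a, r, \<alpha>, t, b) \<in> El (boxes A B) J \<Longrightarrow> w J a r \<alpha> t b r = b"
  shows "fibrant A B"
  unfolding fibrant_def
proof (intro exI conjI)
  let ?w = "\<lambda>J ((a, r, \<alpha>, t, b), s). w J a r \<alpha> t b s"
  let ?p = "\<lambda>J ((a, r, \<alpha>, t, b), i). b"
  show "sect (ext (boxes A B) (const_fam interval))
      (reindex (\<lambda>J ((a, r, \<alpha>, t, b), s). a (cube_id J, s)) B) ?w"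
    using w nat
    by (auto simp: sect_def ext_def reindex_def const_fam_def interval_def boxes_act interval_exp_act)
  show "sect (ext (boxes A B) (const_fam interval))
      (reindex (\<lambda>J ((a, r, \<alpha>, t, b), i). a (cube_id J, r)) B) ?p"
    by (auto simp: sect_def ext_def reindex_def const_fam_def interval_def boxes_act boxes_El)
  show "\<forall>J a r \<alpha> t b. finite J \<and> (a, r, \<alpha>, t, b) \<in> El (boxes A B) J \<longrightarrow>
        (\<forall>s\<in>ipts J. \<forall>f\<in>\<alpha>.
           tr B f (a (cube_id J, s)) (?w J ((a, r, \<alpha>, t, b), s)) = t (f, pt_act f s)) \<and>
        ?p J ((a, r, \<alpha>, t, b), Zero) = ?w J ((a, r, \<alpha>, t, b), r) \<and>
        ?p J ((a, r, \<alpha>, t, b), One) = b \<and>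
        (\<forall>i\<in>ipts J. \<forall>f\<in>\<alpha>.
           tr B f (a (cube_id J, r)) (?p J ((a, r, \<alpha>, t, b), i)) = tr B f (a (cube_id J, r)) b)"
    using ext reg by auto
qed

context iso_nerve
begin

text \<open>
  The composite of a box of objects from \<open>r\<close> to \<open>s\<close>: at a vertex of the face \<open>\<alpha>\<close> it is the point at \<open>s\<close> of the
  line \<open>t\<close>, reached from the base \<open>b\<close> by the isomorphism of \<open>t\<close> from \<open>r\<close> to \<open>s\<close>; elsewhere it is \<open>b\<close>. A vertex
  lies on the face iff its constant line does, because a constant line and its vertex are restrictions
  of each other.
\<close>

definition ob_target :: "cube \<Rightarrow> pt \<Rightarrow> arr set \<Rightarrow> (arr \<times> pt \<Rightarrow> 'u) \<Rightarrow> 'u \<Rightarrow> pt \<Rightarrow> cube \<Rightarrow> 'u" where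
  "ob_target J r \<alpha> t b s V = (if const_line J V \<in> \<alpha> then at J t V (coord V s) else vtx J b V)"

definition ob_iso :: "cube \<Rightarrow> pt \<Rightarrow> arr set \<Rightarrow> (arr \<times> pt \<Rightarrow> 'u) \<Rightarrow> 'u \<Rightarrow> pt \<Rightarrow> cube \<Rightarrow> 'u" where
  "ob_iso J r \<alpha> t b s V =
     (if const_line J V \<in> \<alpha> then move J t V (coord V r) (coord V s) else oid E (vtx J b V))"

lemma ob_box:
  assumes J: "finite J" and box: "(a, r, \<alpha>, t, b) \<in> El (boxes terminal_psh (Ob (nerve E))) J"
  shows "ob_line \<alpha> t" and "sieve J \<alpha>" and "b \<in> nerve_ob E J"
    and "f \<in> \<alpha> \<Longrightarrow> res_ob f b = t (f, pt_act f r)" and "r \<in> ipts J"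
    and "V \<subseteq> J \<Longrightarrow> const_line J V \<in> \<alpha> \<Longrightarrow> vtx J b V = at J t V (coord V r)"
proof -
  have "t \<in> partial_lines (Ob (nerve E)) a \<alpha>" using box by (simp add: boxes_El)
  then show t: "ob_line \<alpha> t"
    by (auto simp: partial_lines_def on_sieve_def ob_line_def natural_on_def)
  show s: "sieve J \<alpha>" using box by (auto simp: boxes_El intro: sieve_cof)
  show b: "b \<in> nerve_ob E J" using box by (simp add: boxes_El)
  show e: "f \<in> \<alpha> \<Longrightarrow> res_ob f b = t (f, pt_act f r)" for f using box by (simp add: boxes_El)
  show r: "r \<in> ipts J" using box by (simp add: boxes_El)
  show "vtx J b V = at J t V (coord V r)" if V: "V \<subseteq> J" "const_line J V \<in> \<alpha>"
  proof -
    have "vtx J b V = vtx {0} (res_ob (const_line J V) b) {}"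
      using res_simps(1)[of "const_line J V" "{}" b] J V by simp
    also have "\<dots> = vtx (src (const_line J V)) (t (const_line J V, end_pt (coord V r))) {}"
      using e[OF V(2)] r by simp
    also have "\<dots> = at J t V (coord V r)"
      using vtx_eq_at[OF s _ V(2), of t "end_pt (coord V r)" "{}"] t V by (simp add: ob_line_def)
    finally show ?thesis .
  qed
qed

lemma ob_iso_cpts:
  assumes "finite J" and box: "(a, r, \<alpha>, t, b) \<in> El (boxes terminal_psh (Ob (nerve E))) J"
  shows "iso_cpts J b (ob_target J r \<alpha> t b s) (ob_iso J r \<alpha> t b s)"
  using at_move(1,4)[OF ob_box(1)[OF assms]] ob_box(6)[OF assms] nerve_obD(1)[OF ob_box(3)[OF assms]]
    inverses_id
  unfolding iso_cpts_def ob_target_def ob_iso_def by (auto; blast)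

text \<open>
  Restricted along \<open>f \<in> \<alpha>\<close>, all vertices are on the face, and by \<open>move_edge\<close> the isomorphisms from \<open>r\<close> to \<open>s\<close>
  are natural from the value of \<open>t\<close> at \<open>r\<close> to its value at \<open>s\<close>; so \<open>conj_ob_eqI\<close> identifies the composite with
  the latter.
\<close>

theorem nerve_ob_fibrant: "fibrant terminal_psh (Ob (nerve E))"
proof (rule fibrant_regularI)
  let ?w = "\<lambda>J a r \<alpha> t b s. conj_ob J b (ob_target J r \<alpha> t b s) (ob_iso J r \<alpha> t b s)"
  show "family terminal_psh (Ob (nerve E))" using nerve_is_icat by (simp add: is_icat_def)
  fix J :: cube and a :: "arr \<times> pt \<Rightarrow> unit" and r \<alpha> t b s
  assume J: "finite J" and box: "(a, r, \<alpha>, t, b) \<in> El (boxes terminal_psh (Ob (nerve E))) J"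
  note B = ob_box[OF J box]
  show "?w J a r \<alpha> t b s \<in> Fib (Ob (nerve E)) J (a (cube_id J, s))"
    using conj_ob_in[OF J B(3) ob_iso_cpts[OF J box]] by simp
  show "?w J a r \<alpha> t b r = b"
  proof (rule conj_ob_eqI[OF J B(3) ob_iso_cpts[OF J box] B(3)])
    fix V assume "V \<subseteq> J"
    then show X: "vtx J b V = ob_target J r \<alpha> t b r V" using B(6) by (simp add: ob_target_def)
  next
    fix V W assume VW: "V \<subseteq> J" "W \<subseteq> J"
    have X: "ob_target J r \<alpha> t b r U = vtx J b U" "ob_iso J r \<alpha> t b r U = oid E (vtx J b U)" if "U \<subseteq> J" for U
      using B(6) at_move(2)[OF B(1)] that by (auto simp: ob_target_def ob_iso_def)
    show "ocmp E (vtx J b V) (vtx J b W) (ob_target J r \<alpha> t b r W) (ob_iso J r \<alpha> t b r W) (edge J b V W) =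
      ocmp E (vtx J b V) (ob_target J r \<alpha> t b r V) (ob_target J r \<alpha> t b r W) (edge J b V W) (ob_iso J r \<alpha> t b r V)"
      using VW nerve_obD[OF B(3)] by (simp add: X)
  qed
  fix f assume s: "s \<in> ipts J" and f: "f \<in> \<alpha>"
  have fa: "is_arr f" "tgt f = J" using B(2) f by (auto simp: sieve_def)
  have cl: "const_line J (push f V) \<in> \<alpha>" for V using const_line_in[OF B(2) f] .
  have nat: "natural_on res_ob \<alpha> t" using B(1) by (simp add: ob_line_def)
  let ?X = "\<lambda>V. ob_target J r \<alpha> t b s (push f V)" and ?k = "\<lambda>V. ob_iso J r \<alpha> t b s (push f V)"
  have rs: "pt_act f r \<in> ipts (src f)" "pt_act f s \<in> ipts (src f)" using fa B(5) s by auto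
  have bX: "vtx (src f) (res_ob f b) V = at J t (push f V) (coord V (pt_act f r))" if "V \<subseteq> src f" for V
    unfolding B(4)[OF f] using vtx_eq_at[OF B(2) nat f rs(1) that] .
  have tX: "vtx (src f) (t (f, pt_act f s)) V = ?X V" if "V \<subseteq> src f" for V
    using vtx_eq_at[OF B(2) nat f rs(2) that] fa s by (simp add: ob_target_def cl)
  have "conj_ob (src f) (res_ob f b) ?X ?k = t (f, pt_act f s)"
  proof (rule conj_ob_eqI)
    show "finite (src f)" using fa by simp
    show "res_ob f b \<in> nerve_ob E (src f)" using fa B(3) by simp
    show "t (f, pt_act f s) \<in> nerve_ob E (src f)" using B(1) f rs by (simp add: ob_line_def)
    show "iso_cpts (src f) (res_ob f b) ?X ?k"
      unfolding iso_cpts_def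
      using at_move(1)[OF B(1) cl] at_move(4)[OF B(1) cl, THEN exI[of "inverses _ _ _"]] bX fa B(5)
      by (auto simp: ob_target_def ob_iso_def cl)
    show "vtx (src f) (t (f, pt_act f s)) V = ?X V" if "V \<subseteq> src f" for V using tX[OF that] .
  next
    fix V W assume VW: "V \<subseteq> src f" "W \<subseteq> src f"
    show "ocmp E (vtx (src f) (res_ob f b) V) (vtx (src f) (res_ob f b) W) (?X W) (?k W) (edge (src f) (res_ob f b) V W) =
      ocmp E (vtx (src f) (res_ob f b) V) (?X V) (?X W) (edge (src f) (t (f, pt_act f s)) V W) (?k V)"
      using move_edge[OF B(2,1) f rs VW] fa s B(5) tX[OF VW(1)] tX[OF VW(2)] unfolding B(4)[OF f]
      by (simp add: ob_iso_def cl)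
  qed
  then show "tr (Ob (nerve E)) f (a (cube_id J, s)) (?w J a r \<alpha> t b s) = t (f, pt_act f s)"
    using res_conj_ob[OF fa(1), of b] fa by simp
next
  let ?w = "\<lambda>J a r \<alpha> t b s. conj_ob J b (ob_target J r \<alpha> t b s) (ob_iso J r \<alpha> t b s)"
  fix f and a :: "arr \<times> pt \<Rightarrow> unit" and r \<alpha> t b s
  assume f: "is_arr f" and box: "(a, r, \<alpha>, t, b) \<in> El (boxes terminal_psh (Ob (nerve E))) (tgt f)"
    and s: "s \<in> ipts (tgt f)"
  have r: "r \<in> ipts (tgt f)" using box by (simp add: boxes_El)
  have "conj_ob (src f) (res_ob f b) (\<lambda>V. ob_target (tgt f) r \<alpha> t b s (push f V)) (\<lambda>V. ob_iso (tgt f) r \<alpha> t b s (push f V))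
    = ?w (src f) a (pt_act f r) (pull_sieve f \<alpha>) (shift f \<alpha> t) (res_ob f b) (pt_act f s)"
    using f r s by (intro conj_ob_cong) (auto simp: ob_target_def ob_iso_def const_line_pull at_shift)
  then show "tr (Ob (nerve E)) f (a (cube_id (tgt f), s)) (?w (tgt f) a r \<alpha> t b s) =
      ?w (src f) (shift f (top_sieve (tgt f)) a) (pt_act f r) (pull_sieve f \<alpha>) (shift f \<alpha> t)
        (tr (Ob (nerve E)) f (a (cube_id (tgt f), r)) b) (pt_act f s)"
    using res_conj_ob[OF f, of b] by simp
qed

section \<open>The morphisms of the nerve are fibrant\<close>

text \<open>
  Transport of a component at \<open>V\<close> from the point \<open>p\<close> to the point \<open>q\<close> of the lines \<open>x\<close> and \<open>y\<close>, by conjugation.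
\<close>

definition hom_comp :: "cube \<Rightarrow> (arr \<times> pt \<Rightarrow> 'u) \<Rightarrow> (arr \<times> pt \<Rightarrow> 'u) \<Rightarrow> bool \<Rightarrow> bool \<Rightarrow> cube \<Rightarrow> 'u \<Rightarrow> 'u" where
  "hom_comp J x y p q V m =
     ocmp E (at J x V q) (at J y V p) (at J y V q) (move J y V p q)
       (ocmp E (at J x V q) (at J x V p) (at J y V p) m (move J x V q p))"

lemma hom_comp_in:
  assumes x: "ob_line \<alpha> x" and y: "ob_line \<alpha> y" and c: "const_line J V \<in> \<alpha>"
    and m: "m \<in> ohom E (at J x V p) (at J y V p)"
  shows "hom_comp J x y p q V m \<in> ohom E (at J x V q) (at J y V q)"
    and "hom_comp J x y p p V m = m"
  using m at_move[OF x c] at_move[OF y c] by (simp_all add: hom_comp_def)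

text \<open>This is naturality of the restriction of \<open>m\<close> to the constant line at \<open>V\<close>.\<close>

lemma hom_comp_line:
  assumes x: "ob_line \<alpha> x" and y: "ob_line \<alpha> y" and m: "hom_line \<alpha> x y m" and c: "const_line J V \<in> \<alpha>"
  shows "hom_comp J x y p q V (cpt_at J m V p) = cpt_at J m V q"
proof -
  note D = at_move[OF x c] at_move[OF y c] cpt_at_move[OF m c]
  have "hom_comp J x y p q V (cpt_at J m V p) = ocmp E (at J x V q) (at J x V p) (at J y V q)
      (ocmp E (at J x V p) (at J y V p) (at J y V q) (move J y V p q) (cpt_at J m V p)) (move J x V q p)"
    unfolding hom_comp_def using D(1,3,6,8,11) by simp
  also have "\<dots> = cpt_at J m V q"
    unfolding cpt_at_move(2)[OF m c] using D(1-3,5,6,8,11) by simp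
  finally show ?thesis .
qed

end

context iso_nerve
begin

lemma ob_lines:
  assumes "a \<in> El (interval_exp (ob2_ctx terminal_psh (nerve E))) J"
  shows "ob_line (top_sieve J) (\<lambda>q. snd (fst (a q)))" and "ob_line (top_sieve J) (\<lambda>q. snd (a q))"
proof -
  have "a (f, i) \<in> El (ob2_ctx terminal_psh (nerve E)) (src f)"
    "is_arr g \<Longrightarrow> tgt g = src f \<Longrightarrow>
      act (ob2_ctx terminal_psh (nerve E)) g (a (f, i)) = a (cube_comp f g, pt_act g i)"
    if "is_arr f" "tgt f = J" "i \<in> ipts (src f)" for f i g
    using assms that unfolding interval_exp_El by blast+
  note a = this[unfolded nerve_ctx]
  show "ob_line (top_sieve J) (\<lambda>q. snd (fst (a q)))" and "ob_line (top_sieve J) (\<lambda>q. snd (a q))"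
    unfolding ob_line_def natural_on_def using a(1) by (auto simp flip: a(2))
qed

lemma par_lines:
  assumes "a \<in> El (interval_exp (par_ctx terminal_psh (nerve E))) J"
  defines "x \<equiv> \<lambda>q. snd (fst (fst (fst (a q))))" and "y \<equiv> \<lambda>q. snd (fst (fst (a q)))"
  shows "ob_line (top_sieve J) x" and "ob_line (top_sieve J) y"
    and "hom_line (top_sieve J) x y (\<lambda>q. snd (fst (a q)))"
    and "hom_line (top_sieve J) x y (\<lambda>q. snd (a q))"
proof -
  have "a (f, i) \<in> El (par_ctx terminal_psh (nerve E)) (src f)"
    "is_arr g \<Longrightarrow> tgt g = src f \<Longrightarrow>
      act (par_ctx terminal_psh (nerve E)) g (a (f, i)) = a (cube_comp f g, pt_act g i)"
    if "is_arr f" "tgt f = J" "i \<in> ipts (src f)" for f i g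
    using assms(1) that unfolding interval_exp_El by blast+
  note a = this[unfolded nerve_ctx]
  show "ob_line (top_sieve J) x" and "ob_line (top_sieve J) y"
    "hom_line (top_sieve J) x y (\<lambda>q. snd (fst (a q)))" "hom_line (top_sieve J) x y (\<lambda>q. snd (a q))"
    unfolding ob_line_def hom_line_def natural_on_def x_def y_def
    using a(1) by (auto simp flip: a(2))
qed

lemma at_endpoint:
  assumes "finite J" and "ob_line (top_sieve J) x" and "r \<in> ipts J" and "V \<subseteq> J"
  shows "vtx J (x (cube_id J, r)) V = at J x V (coord V r)"
  using vtx_eq_at[OF sieve_top, of J x "cube_id J" r V] assms by (simp add: ob_line_def)

text \<open>
  The conjugates of the components of a natural transformation are again natural, as the conjugating
  isomorphisms are compatible with the edges of \<open>x\<close> and of \<open>y\<close>.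
\<close>

lemma hom_comp_natural:
  assumes "finite J" and x: "ob_line (top_sieve J) x" and y: "ob_line (top_sieve J) y"
    and r: "r \<in> ipts J" and s: "s \<in> ipts J"
    and b: "b \<in> nerve_hom E J (x (cube_id J, r)) (y (cube_id J, r))"
  shows "mk_hom J (\<lambda>V. hom_comp J x y (coord V r) (coord V s) V (cpt J b V))
    \<in> nerve_hom E J (x (cube_id J, s)) (y (cube_id J, s))"
proof (intro mk_hom_in assms(1))
  have i: "cube_id J \<in> top_sieve J" using assms(1) by simp
  note ax = at_endpoint[OF assms(1) x] and ay = at_endpoint[OF assms(1) y]
  have c: "const_line J V \<in> top_sieve J" for V using assms(1) by simp
  have xr: "x (cube_id J, r) \<in> nerve_ob E J" "x (cube_id J, s) \<in> nerve_ob E J"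
      "y (cube_id J, r) \<in> nerve_ob E J" "y (cube_id J, s) \<in> nerve_ob E J"
    using x y i r s by (force simp: ob_line_def)+
  show "natural_cpts E J (x (cube_id J, s)) (y (cube_id J, s))
      (\<lambda>V. hom_comp J x y (coord V r) (coord V s) V (cpt J b V))"
    unfolding natural_cpts_def
  proof (intro conjI allI impI)
    fix V assume V: "V \<subseteq> J"
    show "hom_comp J x y (coord V r) (coord V s) V (cpt J b V)
        \<in> ohom E (vtx J (x (cube_id J, s)) V) (vtx J (y (cube_id J, s)) V)"
      using hom_comp_in(1)[OF x y c] nerve_homD(1)[OF b V] V r s by (simp add: ax ay)
  next
    fix V W assume VW: "V \<subseteq> J" "W \<subseteq> J"
    let ?x = "\<lambda>V r. vtx J (x (cube_id J, r)) V" and ?y = "\<lambda>V r. vtx J (y (cube_id J, r)) V"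
    let ?ex = "\<lambda>r. edge J (x (cube_id J, r)) V W" and ?ey = "\<lambda>r. edge J (y (cube_id J, r)) V W"
    let ?mx = "\<lambda>V r s. move J x V (coord V r) (coord V s)" and ?my = "\<lambda>V r s. move J y V (coord V r) (coord V s)"
    let ?b = "\<lambda>V. cpt J b V"
    have ob: "?x U t \<in> oobj E" "?y U t \<in> oobj E" if "U \<subseteq> J" "t = r \<or> t = s" for U t
      using nerve_obD(1)[OF xr(1)] nerve_obD(1)[OF xr(2)] nerve_obD(1)[OF xr(3)] nerve_obD(1)[OF xr(4)] that
      by auto
    have mv: "?mx U t t' \<in> ohom E (?x U t) (?x U t')" "?my U t t' \<in> ohom E (?y U t) (?y U t')"
      if "U \<subseteq> J" "t = r \<or> t = s" "t' = r \<or> t' = s" for U t t'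
      using at_move(3)[OF x c] at_move(3)[OF y c] r s that by (auto simp: ax ay)
    have ed: "?ex t \<in> ohom E (?x V t) (?x W t)" "?ey t \<in> ohom E (?y V t) (?y W t)" if "t = r \<or> t = s" for t
      using nerve_obD(3)[OF xr(1) VW] nerve_obD(3)[OF xr(2) VW] nerve_obD(3)[OF xr(3) VW]
        nerve_obD(3)[OF xr(4) VW] that by auto
    have bb: "?b U \<in> ohom E (?x U r) (?y U r)" if "U \<subseteq> J" for U using nerve_homD(1)[OF b that] .
    note T = ob mv ed bb
    have ex: "ocmp E (?x V s) (?x W s) (?x W r) (?mx W s r) (?ex s) =
              ocmp E (?x V s) (?x V r) (?x W r) (?ex r) (?mx V s r)"
      using move_edge[OF sieve_top x i, of s r V W] VW r s assms(1) by simp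
    have ey: "ocmp E (?y V r) (?y W r) (?y W s) (?my W r s) (?ey r) =
              ocmp E (?y V r) (?y V s) (?y W s) (?ey s) (?my V r s)"
      using move_edge[OF sieve_top y i, of r s V W] VW r s assms(1) by simp
    have hc: "hom_comp J x y (coord U r) (coord U s) U (?b U) =
        ocmp E (?x U s) (?y U r) (?y U s) (?my U r s) (ocmp E (?x U s) (?x U r) (?y U r) (?b U) (?mx U s r))"
      if "U \<subseteq> J" for U
      using that r s by (simp add: hom_comp_def ax ay)
    have "ocmp E (?x V s) (?y V s) (?y W s) (?ey s) (hom_comp J x y (coord V r) (coord V s) V (?b V)) =
        ocmp E (?x V s) (?y V r) (?y W s) (ocmp E (?y V r) (?y V s) (?y W s) (?ey s) (?my V r s))
          (ocmp E (?x V s) (?x V r) (?y V r) (?b V) (?mx V s r))"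
      using VW by (simp add: hc T)
    also have "\<dots> = ocmp E (?x V s) (?y W r) (?y W s) (?my W r s)
        (ocmp E (?x V s) (?x V r) (?y W r) (ocmp E (?x V r) (?y V r) (?y W r) (?ey r) (?b V)) (?mx V s r))"
      unfolding ey[symmetric] using VW by (simp add: T)
    also have "\<dots> = ocmp E (?x V s) (?y W r) (?y W s) (?my W r s)
        (ocmp E (?x V s) (?x W r) (?y W r) (?b W) (ocmp E (?x V s) (?x V r) (?x W r) (?ex r) (?mx V s r)))"
      unfolding nerve_homD(2)[OF b VW] using VW by (simp add: T)
    also have "\<dots> = ocmp E (?x V s) (?x W s) (?y W s) (hom_comp J x y (coord W r) (coord W s) W (?b W)) (?ex s)"
      unfolding ex[symmetric] using VW by (simp add: hc T)
    finally show "ocmp E (?x V s) (?y V s) (?y W s) (?ey s) (hom_comp J x y (coord V r) (coord V s) V (?b V)) =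
        ocmp E (?x V s) (?x W s) (?y W s) (hom_comp J x y (coord W r) (coord W s) W (?b W)) (?ex s)" .
  qed
qed

text \<open>
  On the face of the box, the transported components are those of the given partial line by
  \<open>hom_comp_line\<close>.
\<close>

theorem nerve_hom_fibrant: "fibrant (ob2_ctx terminal_psh (nerve E)) (Hom (nerve E))"
proof (rule fibrant_regularI)
  let ?w = "\<lambda>J (a :: arr \<times> pt \<Rightarrow> (unit \<times> 'u) \<times> 'u) r \<alpha> t b s. mk_hom J
    (\<lambda>V. hom_comp J (\<lambda>q. snd (fst (a q))) (\<lambda>q. snd (a q)) (coord V r) (coord V s) V (cpt J b V)) :: 'u"
  show "family (ob2_ctx terminal_psh (nerve E)) (Hom (nerve E))"
    using nerve_is_icat by (simp add: is_icat_def)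
  have fib: "Fib (Hom (nerve E)) J q = nerve_hom E J (snd (fst q)) (snd q)" for J q
    by (simp add: nerve_def split_beta)
  fix J a r \<alpha> t b s
  assume J: "finite J" and box: "(a, r, \<alpha>, t, b) \<in> El (boxes (ob2_ctx terminal_psh (nerve E)) (Hom (nerve E))) J"
  let ?x = "\<lambda>q. snd (fst (a q))" and ?y = "\<lambda>q. snd (a q)"
  have r: "r \<in> ipts J" and b: "b \<in> nerve_hom E J (?x (cube_id J, r)) (?y (cube_id J, r))"
    and \<alpha>: "sieve J \<alpha>" and tb: "\<And>f. f \<in> \<alpha> \<Longrightarrow> res_hom f b = t (f, pt_act f r)"
    and a: "a \<in> El (interval_exp (ob2_ctx terminal_psh (nerve E))) J"
    and t: "t \<in> partial_lines (Hom (nerve E)) a \<alpha>"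
    using box by (auto simp: boxes_El fib intro: sieve_cof)
  note xy = ob_lines[OF a]
  have c: "const_line J V \<in> top_sieve J" for V using J by simp
  note ax = at_endpoint[OF J xy(1)] and ay = at_endpoint[OF J xy(2)]
  show w: "?w J a r \<alpha> t b s \<in> Fib (Hom (nerve E)) J (a (cube_id J, s))" if "s \<in> ipts J" for s
    unfolding fib using hom_comp_natural[OF J xy r that b] .
  show "?w J a r \<alpha> t b r = b"
  proof (rule nerve_hom_eqI[OF J w[OF r, unfolded fib] b])
    fix V assume V: "V \<subseteq> J"
    then show "cpt J (?w J a r \<alpha> t b r) V = cpt J b V"
      using hom_comp_in(2)[OF xy c] nerve_homD(1)[OF b V] ax[OF r V] ay[OF r V] J by simp
  qed
  fix f assume s: "s \<in> ipts J" and f: "f \<in> \<alpha>"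
  have fa: "is_arr f" "tgt f = J" using \<alpha> f by (auto simp: sieve_def)
  have sub: "f \<in> top_sieve J" "\<alpha> \<subseteq> top_sieve J" using fa \<alpha> by (auto simp: sieve_def)
  have m: "hom_line \<alpha> ?x ?y t" and xy': "ob_line \<alpha> ?x" "ob_line \<alpha> ?y"
    using t xy sub(2) unfolding partial_lines_def on_sieve_def hom_line_def ob_line_def natural_on_def
    by (auto simp: fib)
  show "tr (Hom (nerve E)) f (a (cube_id J, s)) (?w J a r \<alpha> t b s) = t (f, pt_act f s)"
  proof (simp del: One_nat_def, rule nerve_hom_eqI)
    show "finite (src f)" using fa by simp
    show "res_hom f (?w J a r \<alpha> t b s) \<in> nerve_hom E (src f) (res_ob f (?x (cube_id J, s))) (res_ob f (?y (cube_id J, s)))"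
      using w[OF s] fa by (simp add: fib)
    show "t (f, pt_act f s) \<in> nerve_hom E (src f) (?x (f, pt_act f s)) (?y (f, pt_act f s))"
      using m f fa s by (simp add: hom_line_def)
  next
    fix V assume V: "V \<subseteq> src f"
    have i: "pt_act f r \<in> ipts (src f)" "pt_act f s \<in> ipts (src f)" using fa r s by auto
    have nat: "natural_on res_hom \<alpha> t" using m by (simp add: hom_line_def)
    have "cpt J b (push f V) = cpt (src f) (t (f, pt_act f r)) V"
      using tb[OF f] res_simps(3)[OF fa(1) V, of b] fa by simp
    also have "\<dots> = cpt_at J t (push f V) (coord V (pt_act f r))"
      using cpt_eq_at[OF \<alpha> nat f i(1) V] .
    finally have b': "cpt J b (push f V) = cpt_at J t (push f V) (coord V (pt_act f r))" .
    have "cpt (src f) (res_hom f (?w J a r \<alpha> t b s)) V =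
        hom_comp J ?x ?y (coord V (pt_act f r)) (coord V (pt_act f s)) (push f V) (cpt J b (push f V))"
      using res_simps(3)[OF fa(1) V, of "?w J a r \<alpha> t b s"] fa J r s push_subset[of f V] by simp
    also have "\<dots> = cpt_at J t (push f V) (coord V (pt_act f s))"
      unfolding b' by (rule hom_comp_line[OF xy' m const_line_in[OF \<alpha> f]])
    also have "\<dots> = cpt (src f) (t (f, pt_act f s)) V"
      using cpt_eq_at[OF \<alpha> nat f i(2) V] by simp
    finally show "cpt (src f) (res_hom f (?w J a r \<alpha> t b s)) V = cpt (src f) (t (f, pt_act f s)) V" .
  qed
next
  let ?w = "\<lambda>J (a :: arr \<times> pt \<Rightarrow> (unit \<times> 'u) \<times> 'u) r \<alpha> t b s. mk_hom J
    (\<lambda>V. hom_comp J (\<lambda>q. snd (fst (a q))) (\<lambda>q. snd (a q)) (coord V r) (coord V s) V (cpt J b V)) :: 'u"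
  fix f a r \<alpha> t b s
  assume f: "is_arr f" and s: "s \<in> ipts (tgt f)"
    and box: "(a, r, \<alpha>, t, b) \<in> El (boxes (ob2_ctx terminal_psh (nerve E)) (Hom (nerve E))) (tgt f)"
  have r: "r \<in> ipts (tgt f)" using box by (simp add: boxes_El)
  have sh: "line_at (src f) (\<lambda>q. h (shift f (top_sieve (tgt f)) a q)) V = line_at (tgt f) (\<lambda>q. h (a q)) (push f V)"
    for h :: "(unit \<times> 'u) \<times> 'u \<Rightarrow> 'u" and V
    using line_at_shift[OF f, of V "top_sieve (tgt f)" a] f by (simp add: line_at_def)
  have "hom_comp (src f) (\<lambda>q. snd (fst (shift f (top_sieve (tgt f)) a q))) (\<lambda>q. snd (shift f (top_sieve (tgt f)) a q)) p q V =
      hom_comp (tgt f) (\<lambda>q. snd (fst (a q))) (\<lambda>q. snd (a q)) p q (push f V)" for p q V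
    using sh[of "\<lambda>q. snd (fst q)" V] sh[of snd V] by (simp add: hom_comp_def fun_eq_iff at_def move_def)
  then show "tr (Hom (nerve E)) f (a (cube_id (tgt f), s)) (?w (tgt f) a r \<alpha> t b s) =
      ?w (src f) (shift f (top_sieve (tgt f)) a) (pt_act f r) (pull_sieve f \<alpha>) (shift f \<alpha> t)
        (tr (Hom (nerve E)) f (a (cube_id (tgt f), r)) b) (pt_act f s)"
    using f r s unfolding nerve_simps(4) res_hom_def[of f "mk_hom _ _"] by (intro mk_hom_cong) auto
qed

text \<open>
  Two lines of morphisms that agree at \<open>r\<close> agree at \<open>s\<close>, since their components at \<open>s\<close> are the transports of
  those at \<open>r\<close>.
\<close>

theorem nerve_eq_fibrant: "fibrant (par_ctx terminal_psh (nerve E)) (eq_fam (nerve E))"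
proof (rule fibrant_regularI)
  show "family (par_ctx terminal_psh (nerve E)) (eq_fam (nerve E))"
    using nerve_is_icat by (simp add: is_icat_def)
  have fib: "Fib (eq_fam (nerve E)) J q = {_. snd (fst q) = snd q}" for J q
    by (simp add: eq_fam_def split_beta)
  fix J a r \<alpha> t b s
  assume J: "finite J" and s: "s \<in> ipts J"
    and box: "(a, r, \<alpha>, t, b) \<in> El (boxes (par_ctx terminal_psh (nerve E)) (eq_fam (nerve E))) J"
  let ?x = "\<lambda>q. snd (fst (fst (fst (a q))))" and ?y = "\<lambda>q. snd (fst (fst (a q)))"
  let ?m = "\<lambda>q. snd (fst (a q))" and ?n = "\<lambda>q. snd (a q)"
  have r: "r \<in> ipts J" and eq: "?m (cube_id J, r) = ?n (cube_id J, r)"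
    and a: "a \<in> El (interval_exp (par_ctx terminal_psh (nerve E))) J"
    using box by (auto simp: boxes_El fib split: if_splits)
  note L = par_lines[OF a]
  have i: "cube_id J \<in> top_sieve J" and c: "const_line J V \<in> top_sieve J" for V using J by auto
  have nat: "natural_on res_hom (top_sieve J) ?m" "natural_on res_hom (top_sieve J) ?n"
    using L(3,4) by (auto simp: hom_line_def)
  have cpt: "cpt J (?m (cube_id J, i)) V = cpt_at J ?m V (coord V i)"
    "cpt J (?n (cube_id J, i)) V = cpt_at J ?n V (coord V i)" if "i \<in> ipts J" "V \<subseteq> J" for i V
    using cpt_eq_at[OF sieve_top nat(1) i, of i V] cpt_eq_at[OF sieve_top nat(2) i, of i V] that by simp_all
  have mem: "?m (cube_id J, s) \<in> nerve_hom E J (?x (cube_id J, s)) (?y (cube_id J, s))"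
    "?n (cube_id J, s) \<in> nerve_hom E J (?x (cube_id J, s)) (?y (cube_id J, s))"
    using L(3,4) i s by (force simp: hom_line_def)+
  have "?m (cube_id J, s) = ?n (cube_id J, s)"
  proof (rule nerve_hom_eqI[OF J mem])
    fix V assume V: "V \<subseteq> J"
    have "cpt_at J ?m V (coord V r) = cpt_at J ?n V (coord V r)" using eq cpt[OF r V] by simp
    then have "cpt_at J ?m V (coord V s) = cpt_at J ?n V (coord V s)"
      using hom_comp_line[OF L(1,2,3) c, of "coord V r" "coord V s" V]
        hom_comp_line[OF L(1,2,4) c, of "coord V r" "coord V s" V] by simp
    then show "cpt J (?m (cube_id J, s)) V = cpt J (?n (cube_id J, s)) V"
      using cpt[OF s V] by simp
  qed
  then show "() \<in> Fib (eq_fam (nerve E)) J (a (cube_id J, s))" by (simp add: fib)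
qed auto

section \<open>The nerve is complete\<close>

text \<open>
  The path from \<open>(x, id)\<close> to \<open>(y, f)\<close> has at the parameter \<open>i\<close> the object that agrees with \<open>y\<close> on the
  vertices where \<open>i\<close> is \<open>1\<close> and with \<open>x\<close> elsewhere.
\<close>

definition path_vtx :: "cube \<Rightarrow> 'u \<Rightarrow> 'u \<Rightarrow> pt \<Rightarrow> cube \<Rightarrow> 'u" where
  "path_vtx J x y i V = (if coord V i then vtx J y V else vtx J x V)"

definition path_iso :: "cube \<Rightarrow> 'u \<Rightarrow> 'u \<Rightarrow> pt \<Rightarrow> cube \<Rightarrow> 'u" where
  "path_iso J x f i V = (if coord V i then cpt J f V else oid E (vtx J x V))"

definition nerve_iso :: "cube \<Rightarrow> 'u \<Rightarrow> 'u \<Rightarrow> 'u set" where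
  "nerve_iso J x y = {f \<in> nerve_hom E J x y. \<exists>g\<in>nerve_hom E J y x.
     Cmp (nerve E) J () x y x g f = Idn (nerve E) J () x \<and> Cmp (nerve E) J () y x y f g = Idn (nerve E) J () y}"

text \<open>
  Inverses taken vertex by vertex are automatically natural. This reduces isomorphisms in the nerve to
  their components, which can be mixed freely.
\<close>

lemma nerve_iso_iff:
  assumes J: "finite J" and x: "x \<in> nerve_ob E J" and y: "y \<in> nerve_ob E J"
  shows "f \<in> nerve_iso J x y \<longleftrightarrow> f \<in> nerve_hom E J x y \<and>
    (\<forall>V\<subseteq>J. \<exists>g. inverses (vtx J x V) (vtx J y V) (cpt J f V) g)" (is "_ \<longleftrightarrow> ?R")
proof
  assume f: "f \<in> nerve_iso J x y"
  then obtain g where fg: "f \<in> nerve_hom E J x y" "g \<in> nerve_hom E J y x"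
    "Cmp (nerve E) J () x y x g f = Idn (nerve E) J () x"
    "Cmp (nerve E) J () y x y f g = Idn (nerve E) J () y" unfolding nerve_iso_def by blast
  have "inverses (vtx J x V) (vtx J y V) (cpt J f V) (cpt J g V)" if V: "V \<subseteq> J" for V
    using arg_cong[OF fg(3), of "\<lambda>m. cpt J m V"] arg_cong[OF fg(4), of "\<lambda>m. cpt J m V"]
      nerve_homD(1)[OF fg(1) V] nerve_homD(1)[OF fg(2) V] J V by (simp add: inverses_def)
  with fg(1) show ?R by blast
next
  assume R: ?R
  define k where "k V = inv_of (vtx J x V) (vtx J y V) (cpt J f V)" for V
  have k: "inverses (vtx J x V) (vtx J y V) (cpt J f V) (k V)" if "V \<subseteq> J" for V
    using R that unfolding k_def inv_of_def by (blast intro: someI)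
  note K = k[unfolded inverses_def]
  note D = nerve_obD(1,3)[OF x] nerve_obD(1,3)[OF y] nerve_homD[OF conjunct1[OF R]]
  have "mk_hom J k \<in> nerve_hom E J y x"
  proof (intro mk_hom_in J, unfold natural_cpts_def, intro conjI allI impI)
    fix V W assume VW: "V \<subseteq> J" "W \<subseteq> J"
    let ?x = "vtx J x" and ?y = "vtx J y"
    have "ocmp E (?y V) (?x V) (?x W) (edge J x V W) (k V) =
      ocmp E (?y V) (?y W) (?x W) (k W) (ocmp E (?y V) (?x W) (?y W) (cpt J f W)
        (ocmp E (?y V) (?x V) (?x W) (edge J x V W) (k V)))"
      using inverses_cancel(1)[OF k[OF VW(2)]] K VW D(1-5) by simp
    also have "\<dots> = ocmp E (?y V) (?y W) (?x W) (k W) (ocmp E (?y V) (?x V) (?y W)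
        (ocmp E (?x V) (?x W) (?y W) (cpt J f W) (edge J x V W)) (k V))"
      using K VW D(1-5) by simp
    also have "\<dots> = ocmp E (?y V) (?y W) (?x W) (k W) (edge J y V W)"
      unfolding D(6)[OF VW, symmetric] using K VW D(1-5) by simp
    finally show "ocmp E (?y V) (?x V) (?x W) (edge J x V W) (k V) =
      ocmp E (?y V) (?y W) (?x W) (k W) (edge J y V W)" .
  qed (use K in blast)
  moreover have "Cmp (nerve E) J () x y x (mk_hom J k) f = Idn (nerve E) J () x"
    "Cmp (nerve E) J () y x y f (mk_hom J k) = Idn (nerve E) J () y"
    using J K by (auto intro!: mk_hom_cong)
  ultimately show "f \<in> nerve_iso J x y" using R unfolding nerve_iso_def by blast
qed

lemma path_iso_cpts:
  assumes J: "finite J" and x: "x \<in> nerve_ob E J" and y: "y \<in> nerve_ob E J" and f: "f \<in> nerve_iso J x y"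
  shows "iso_cpts J x (path_vtx J x y i) (path_iso J x f i)"
  using nerve_obD(1)[OF x] nerve_obD(1)[OF y] nerve_iso_iff[OF J x y] f inverses_id
  unfolding iso_cpts_def path_vtx_def path_iso_def by (auto; blast)

lemma path_in:
  assumes J: "finite J" and x: "x \<in> nerve_ob E J" and y: "y \<in> nerve_ob E J" and f: "f \<in> nerve_iso J x y"
  shows "mk_hom J (path_iso J x f i) \<in> nerve_iso J x (conj_ob J x (path_vtx J x y i) (path_iso J x f i))"
proof -
  note k = path_iso_cpts[OF assms, of i]
  let ?X = "path_vtx J x y i" and ?k = "path_iso J x f i"
  let ?k' = "\<lambda>V. inv_of (vtx J x V) (?X V) (?k V)"
  let ?z = "conj_ob J x ?X ?k"
  note z = conj_ob_in[OF J x k]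
  have kk: "?k V \<in> ohom E (vtx J x V) (?X V)" "?k' V \<in> ohom E (?X V) (vtx J x V)"
    "ocmp E (vtx J x V) (?X V) (vtx J x V) (?k' V) (?k V) = oid E (vtx J x V)" if "V \<subseteq> J" for V
    using iso_cptsD(2)[OF k that] by (auto simp: inverses_def)
  note D = iso_cptsD(1)[OF k] nerve_obD(1,3)[OF x]
  have "mk_hom J ?k \<in> nerve_hom E J x ?z"
    using J by (intro mk_hom_in) (auto simp: natural_cpts_def conj_ob_simps kk D)
  then show ?thesis
    unfolding nerve_iso_iff[OF J x z] using iso_cptsD(2)[OF k] J by (auto simp: conj_ob_simps)
qed

lemma path_ends:
  assumes J: "finite J" and x: "x \<in> nerve_ob E J" and y: "y \<in> nerve_ob E J" and f: "f \<in> nerve_iso J x y"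
  shows "conj_ob J x (path_vtx J x y Zero) (path_iso J x f Zero) = x"
    and "mk_hom J (path_iso J x f Zero) = mk_hom J (\<lambda>V. oid E (vtx J x V))"
    and "conj_ob J x (path_vtx J x y One) (path_iso J x f One) = y"
    and "mk_hom J (path_iso J x f One) = f"
proof -
  have fh: "f \<in> nerve_hom E J x y" using f by (simp add: nerve_iso_def)
  show "conj_ob J x (path_vtx J x y Zero) (path_iso J x f Zero) = x"
    by (rule conj_ob_eqI[OF J x path_iso_cpts[OF assms] x])
      (simp_all add: path_vtx_def path_iso_def nerve_obD[OF x])
  show "conj_ob J x (path_vtx J x y One) (path_iso J x f One) = y"
    by (rule conj_ob_eqI[OF J x path_iso_cpts[OF assms] y])
      (simp_all add: path_vtx_def path_iso_def nerve_homD(2)[OF fh])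
  show "mk_hom J (path_iso J x f Zero) = mk_hom J (\<lambda>V. oid E (vtx J x V))"
    by (rule mk_hom_cong[OF J]) (simp add: path_iso_def)
  have "mk_hom J (path_iso J x f One) = mk_hom J (cpt J f)"
    by (rule mk_hom_cong[OF J]) (simp add: path_iso_def)
  then show "mk_hom J (path_iso J x f One) = f" using fh unfolding nerve_hom_def by (auto dest: sym)
qed

lemma path_natural:
  assumes u: "is_arr u" and i: "i \<in> ipts (tgt u)"
  shows "res_ob u (conj_ob (tgt u) x (path_vtx (tgt u) x y i) (path_iso (tgt u) x f i)) =
      conj_ob (src u) (res_ob u x) (path_vtx (src u) (res_ob u x) (res_ob u y) (pt_act u i))
        (path_iso (src u) (res_ob u x) (res_hom u f) (pt_act u i))"
    and "res_hom u (mk_hom (tgt u) (path_iso (tgt u) x f i)) =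
      mk_hom (src u) (path_iso (src u) (res_ob u x) (res_hom u f) (pt_act u i))"
proof -
  show "res_ob u (conj_ob (tgt u) x (path_vtx (tgt u) x y i) (path_iso (tgt u) x f i)) =
      conj_ob (src u) (res_ob u x) (path_vtx (src u) (res_ob u x) (res_ob u y) (pt_act u i))
        (path_iso (src u) (res_ob u x) (res_hom u f) (pt_act u i))"
    unfolding res_conj_ob[OF u] using u i
    by (intro conj_ob_cong) (auto simp: path_vtx_def path_iso_def)
  show "res_hom u (mk_hom (tgt u) (path_iso (tgt u) x f i)) =
      mk_hom (src u) (path_iso (src u) (res_ob u x) (res_hom u f) (pt_act u i))"
    unfolding res_hom_def[of u "mk_hom _ _"] using u i by (intro mk_hom_cong) (auto simp: path_iso_def)
qed

lemma id_iso:
  assumes "finite J" and "x \<in> nerve_ob E J"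
  shows "mk_hom J (\<lambda>V. oid E (vtx J x V)) \<in> nerve_iso J x x"
  unfolding nerve_iso_iff[OF assms assms(2)]
  using nerve_id_in[OF assms] inverses_id nerve_obD(1)[OF assms(2)] assms(1) by auto

lemma iso_fam_nerve: "Fib (iso_fam (nerve E)) J ((\<gamma>, x), y) = nerve_iso J x y"
  "tr (iso_fam (nerve E)) f q = res_hom f"
  by (simp_all add: iso_fam_def nerve_iso_def)

text \<open>
  Only the contractibility of the objects isomorphic to a given one has content: \<open>EqHom\<close> is equality in the
  nerve, so the two other sets have exactly one element.
\<close>

theorem nerve_complete: "complete (nerve E)"
  unfolding complete_def
proof (intro conjI)
  show "contractible (ext terminal_psh (Ob (nerve E))) (sigma_fam (reindex (\<lambda>J. fst) (Ob (nerve E))) (iso_fam (nerve E)))"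
    unfolding contractible_def
  proof (intro exI conjI)
    let ?c = "\<lambda>J (\<gamma> :: unit, x). (x, mk_hom J (\<lambda>V. oid E (vtx J x V)))"
    let ?h = "\<lambda>J (((\<gamma> :: unit, x), (y, f)), i).
      (conj_ob J x (path_vtx J x y i) (path_iso J x f i), mk_hom J (path_iso J x f i))"
    let ?A = "sigma_fam (reindex (\<lambda>J. fst) (Ob (nerve E))) (iso_fam (nerve E))"
    show "sect (ext terminal_psh (Ob (nerve E))) ?A ?c"
      using id_iso nerve_res_laws(1)
      by (auto simp: sect_def ext_def sigma_fam_def reindex_def iso_fam_nerve)
    show "sect (ext (ext (ext terminal_psh (Ob (nerve E))) ?A) (const_fam interval))
        (reindex (\<lambda>J ((\<gamma>, y), i). \<gamma>) ?A) ?h"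
      using conj_ob_in path_iso_cpts path_in
      by (auto simp: sect_def ext_def sigma_fam_def reindex_def iso_fam_nerve const_fam_def interval_def
          path_natural)
    show "\<forall>J. finite J \<longrightarrow> (\<forall>\<gamma>\<in>El (ext terminal_psh (Ob (nerve E))) J. \<forall>y\<in>Fib ?A J \<gamma>.
        ?h J ((\<gamma>, y), Zero) = ?c J \<gamma> \<and> ?h J ((\<gamma>, y), One) = y)"
      using path_ends by (auto simp: ext_def sigma_fam_def reindex_def iso_fam_nerve)
  qed
  show "contractible (hom_ctx terminal_psh (nerve E)) (sigma_fam (reindex (\<lambda>J. fst) (Hom (nerve E))) (eq_fam (nerve E)))"
    unfolding contractible_def
    by (intro exI[of _ "\<lambda>J q. (snd q, ())"] exI[of _ "\<lambda>J q. (snd (fst (fst q)), ())"])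
      (auto simp: sect_def ext_def hom_ctx_def ob2_ctx_def sigma_fam_def reindex_def eq_fam_def const_fam_def nerve_def split: if_splits)
  show "contractible (ext (par_ctx terminal_psh (nerve E)) (eq_fam (nerve E))) (reindex (\<lambda>J. fst) (eq_fam (nerve E)))"
    unfolding contractible_def
    by (intro exI[of _ "\<lambda>J q. ()"])
      (auto simp: sect_def ext_def par_ctx_def hom_ctx_def ob2_ctx_def reindex_def eq_fam_def const_fam_def nerve_def split: if_splits)
qed

end

section \<open>Transport along a coordinate\<close>

definition set_coord :: "arr \<Rightarrow> nat \<Rightarrow> pt \<Rightarrow> arr" where
  "set_coord f j i = Arr (src f) (tgt f) ((amap f)(j := i))"

abbreviation freeze :: "cube \<Rightarrow> nat \<Rightarrow> pt \<Rightarrow> arr" where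
  "freeze J j i \<equiv> set_coord (cube_id J) j i"

lemma set_coord_simps [simp]:
  "src (set_coord f j i) = src f" "tgt (set_coord f j i) = tgt f"
  "amap (set_coord f j i) k = (if k = j then i else amap f k)"
  by (auto simp: set_coord_def)

lemma is_arr_set_coord [simp]:
  assumes "is_arr f" and "j \<in> tgt f" and "i \<in> ipts (src f)"
  shows "is_arr (set_coord f j i)"
proof -
  have "(amap f)(j := i) \<in> insert j (tgt f) \<rightarrow>\<^sub>E ipts (src f)"
    using assms unfolding is_arr_def by (intro PiE_fun_upd) auto
  moreover have "insert j (tgt f) = tgt f" using assms(2) by auto
  ultimately show ?thesis
    using assms(1) unfolding set_coord_def is_arr_def by simp
qed

lemma set_coord_comp:
  assumes "is_arr f" and "is_arr g" and "tgt g = src f" and "j \<in> tgt f" and "i \<in> ipts (src f)"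
  shows "cube_comp (set_coord f j i) g = set_coord (cube_comp f g) j (pt_act g i)"
  using assms by (intro arr_eqI) (auto simp: amap_cube_comp)

text \<open>
  Resetting the coordinate \<open>j\<close> undoes any freezing of it. Hence the line below does not change when it is
  restricted along a morphism that freezes \<open>j\<close>.
\<close>

lemma set_coord_freeze_comp:
  assumes "is_arr f" and "tgt f = J" and "j \<in> J" and "i \<in> ipts (src f)"
  shows "set_coord (cube_comp (freeze J j (end_pt c)) f) j i = set_coord f j i"
  using assms finite_tgt[OF assms(1)] by (intro arr_eqI) auto

lemma freeze_Var: "finite J \<Longrightarrow> j \<in> J \<Longrightarrow> freeze J j (Var j) = cube_id J"
  by (intro arr_eqI) auto

lemma presheafD:
  assumes "presheaf A"
  shows "is_arr f \<Longrightarrow> z \<in> El A (tgt f) \<Longrightarrow> act A f z \<in> El A (src f)"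
    and "finite J \<Longrightarrow> z \<in> El A J \<Longrightarrow> act A (cube_id J) z = z"
    and "is_arr f \<Longrightarrow> is_arr g \<Longrightarrow> tgt g = src f \<Longrightarrow> z \<in> El A (tgt f) \<Longrightarrow>
      act A (cube_comp f g) z = act A g (act A f z)"
  using assms by (simp_all add: presheaf_def)

text \<open>The line in the direction of the coordinate \<open>j\<close> through an element over the cube \<open>J\<close>.\<close>

definition coord_line :: "'a psh \<Rightarrow> cube \<Rightarrow> nat \<Rightarrow> 'a \<Rightarrow> (arr \<times> pt \<Rightarrow> 'a)" where
  "coord_line A J j z = restrict (\<lambda>(f, i). act A (set_coord f j i) z) (on_sieve (top_sieve J))"

lemma coord_line_apply:
  "is_arr f \<Longrightarrow> tgt f = J \<Longrightarrow> i \<in> ipts (src f) \<Longrightarrow> coord_line A J j z (f, i) = act A (set_coord f j i) z"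
  by (simp add: coord_line_def on_sieve_def)

lemma coord_line_in:
  assumes A: "presheaf A" and j: "j \<in> J" and z: "z \<in> El A J"
  shows "coord_line A J j z \<in> El (interval_exp A) J"
  unfolding interval_exp_El
proof (intro conjI allI impI; (elim conjE)?)
  fix f i assume f: "is_arr f" "tgt f = J" "i \<in> ipts (src f)"
  have s: "is_arr (set_coord f j i)" using f j by simp
  show "coord_line A J j z (f, i) \<in> El A (src f)"
    unfolding coord_line_apply[OF f] using presheafD(1)[OF A s] z f by simp
  fix g assume g: "is_arr g" "tgt g = src f"
  have "act A g (act A (set_coord f j i) z) = act A (cube_comp (set_coord f j i) g) z"
    using presheafD(3)[OF A s g(1)] z f g by simp
  then show "act A g (coord_line A J j z (f, i)) = coord_line A J j z (cube_comp f g, pt_act g i)"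
    using f g j by (simp add: coord_line_apply set_coord_comp)
qed (simp add: coord_line_def)

lemma coord_line_freeze:
  assumes "finite J" and "j \<in> J"
  shows "shift (freeze J j (end_pt c)) (top_sieve J) (coord_line A J j z) = coord_line A J j z"
proof
  fix q
  have "on_sieve (pull_sieve (freeze J j (end_pt c)) (top_sieve J)) = on_sieve (top_sieve J)"
    using assms by (auto simp: on_sieve_def in_pull_sieve)
  then show "shift (freeze J j (end_pt c)) (top_sieve J) (coord_line A J j z) q = coord_line A J j z q"
    using assms
    by (cases q) (auto simp: shift_def coord_line_def on_sieve_def set_coord_freeze_comp restrict_def)
qed

lemma sectD:
  assumes "sect \<Gamma> A \<sigma>"
  shows "finite J \<Longrightarrow> \<gamma> \<in> El \<Gamma> J \<Longrightarrow> \<sigma> J \<gamma> \<in> Fib A J \<gamma>"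
    and "is_arr f \<Longrightarrow> \<gamma> \<in> El \<Gamma> (tgt f) \<Longrightarrow>
      tr A f \<gamma> (\<sigma> (tgt f) \<gamma>) = \<sigma> (src f) (act \<Gamma> f \<gamma>)"
  using assms by (simp_all add: sect_def)

lemma on_sieve_empty [simp]: "on_sieve {} = {}"
  by (simp add: on_sieve_def)

text \<open>
  Weak composition along the coordinate line, with the empty cofibration, starting from an element
  that does not depend on \<open>j\<close>. The box is then invariant under freezing \<open>j\<close>, so that \<open>w\<close>, the composite
  at the generic point \<open>j\<close> of the line, and \<open>p\<close>, the generic point of the path, are compatible
  on the nose at the end points.
\<close>

lemma fibrant_transport:
  fixes e :: bool
  assumes A: "presheaf A" and fib: "fibrant A B" and J: "finite J" and j: "j \<in> J" and z: "z \<in> El A J"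
  defines "z' \<equiv> act A (freeze J j (end_pt e)) z"
  assumes b: "b \<in> Fib B J z'" and inv: "\<And>c. tr B (freeze J j (end_pt c)) z' b = b"
  obtains w p where "w \<in> Fib B J z" and "p \<in> Fib B J z'"
    and "tr B (freeze J j (end_pt e)) z w = tr B (freeze J j (end_pt False)) z' p"
    and "tr B (freeze J j (end_pt True)) z' p = b"
proof -
  let ?a = "coord_line A J j z" and ?f = "\<lambda>c. freeze J j (end_pt c)"
  let ?box = "(?a, end_pt e, {}, \<lambda>_. undefined, b) :: ('a, 'b) box"
  have f: "is_arr (?f c)" "src (?f c) = J" "tgt (?f c) = J" for c using J j by simp_all
  have ae: "?a (cube_id J, end_pt e) = z'" using J by (simp add: coord_line_apply z'_def)
  have aj: "?a (cube_id J, Var j) = z"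
    using presheafD(2)[OF A J z] J j by (simp add: coord_line_apply freeze_Var)
  have box: "?box \<in> El (boxes A B) J"
    using coord_line_in[OF A j z] empty_cof b ae by (auto simp: boxes_El partial_lines_def)
  have actbox: "act (boxes A B) (?f c) ?box = ?box" for c
    using coord_line_freeze[OF J j] inv
    by (simp add: boxes_act interval_exp_act ae pull_sieve_def shift_def on_sieve_def restrict_def)
  have "\<exists>w p. sect (ext (boxes A B) (const_fam interval))
        (reindex (\<lambda>J ((a, r, \<alpha>, t, b), s). a (cube_id J, s)) B) w \<and>
      sect (ext (boxes A B) (const_fam interval))
        (reindex (\<lambda>J ((a, r, \<alpha>, t, b), i). a (cube_id J, r)) B) p \<and>
      (\<forall>J a r \<alpha> t b. finite J \<and> (a, r, \<alpha>, t, b) \<in> El (boxes A B) J \<longrightarrow>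
        p J ((a, r, \<alpha>, t, b), Zero) = w J ((a, r, \<alpha>, t, b), r) \<and> p J ((a, r, \<alpha>, t, b), One) = b)"
    using fib unfolding fibrant_def by - (elim exE conjE, intro exI conjI, assumption, assumption, simp)
  then obtain w p where w: "sect (ext (boxes A B) (const_fam interval))
      (reindex (\<lambda>J ((a, r, \<alpha>, t, b), s). a (cube_id J, s)) B) w"
    and p: "sect (ext (boxes A B) (const_fam interval))
      (reindex (\<lambda>J ((a, r, \<alpha>, t, b), i). a (cube_id J, r)) B) p"
    and wp: "\<forall>J a r \<alpha> t b. finite J \<and> (a, r, \<alpha>, t, b) \<in> El (boxes A B) J \<longrightarrow>
      p J ((a, r, \<alpha>, t, b), Zero) = w J ((a, r, \<alpha>, t, b), r) \<and> p J ((a, r, \<alpha>, t, b), One) = b"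
    by - (elim exE conjE, rule that)
  have q: "(?box, Var j) \<in> El (ext (boxes A B) (const_fam interval)) J"
    using box j by (auto simp: ext_def const_fam_def interval_def)
  have actq: "act (ext (boxes A B) (const_fam interval)) (?f c) (?box, Var j) = (?box, end_pt c)" for c
    using actbox j by (simp add: ext_def const_fam_def interval_def del: split_paired_All)
  let ?w = "w J (?box, Var j)" and ?p = "p J (?box, Var j)"
  have w1: "?w \<in> Fib B J z"
    using sectD(1)[OF w J q] by (simp add: reindex_def aj)
  have p1: "?p \<in> Fib B J z'"
    using sectD(1)[OF p J q] by (simp add: reindex_def ae)
  have w2: "tr B (?f c) z ?w = w J (?box, end_pt c)" for c
  proof -
    have "tr (reindex (\<lambda>J ((a, r, \<alpha>, t, b), s). a (cube_id J, s)) B) (?f c) (?box, Var j) (w (tgt (?f c)) (?box, Var j))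
      = w (src (?f c)) (act (ext (boxes A B) (const_fam interval)) (?f c) (?box, Var j))"
      by (rule sectD(2)[OF w f(1)]) (use q f in simp)
    then show ?thesis unfolding actq by (simp add: reindex_def aj)
  qed
  have p2: "tr B (?f c) z' ?p = p J (?box, end_pt c)" for c
  proof -
    have "tr (reindex (\<lambda>J ((a, r, \<alpha>, t, b), i). a (cube_id J, r)) B) (?f c) (?box, Var j) (p (tgt (?f c)) (?box, Var j))
      = p (src (?f c)) (act (ext (boxes A B) (const_fam interval)) (?f c) (?box, Var j))"
      by (rule sectD(2)[OF p f(1)]) (use q f in simp)
    then show ?thesis unfolding actq by (simp add: reindex_def ae)
  qed
  have ends: "p J (?box, end_pt False) = w J (?box, end_pt e)" "p J (?box, end_pt True) = b"
    using wp J box by (auto simp: end_pt_def)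
  show ?thesis
    by (rule that[of ?w ?p]) (use w1 p1 w2 p2 ends in simp_all)
qed

definition vert :: "cube \<Rightarrow> nat set \<Rightarrow> arr" where
  "vert J V = Arr {} J (\<lambda>j\<in>J. end_pt (j \<in> V))"

lemma vert_simps [simp]: "src (vert J V) = {}" "tgt (vert J V) = J" "finite J \<Longrightarrow> is_arr (vert J V)"
  "j \<in> J \<Longrightarrow> amap (vert J V) j = end_pt (j \<in> V)"
  by (auto simp: vert_def is_arr_def)

lemma pt_act_vert [simp]: "i \<in> ipts J \<Longrightarrow> pt_act (vert J V) i = end_pt (coord V i)"
  by (cases i) (auto simp: ipts_def end_pt_def)

lemma comp_vert:
  assumes "is_arr f"
  shows "cube_comp f (vert (src f) V) = vert (tgt f) (push f V)"
proof (rule arr_eqI)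
  fix j assume j: "j \<in> tgt (cube_comp f (vert (src f) V))"
  then have "amap f j \<in> ipts (src f)" using assms amap_in_ipts by simp
  then show "amap (cube_comp f (vert (src f) V)) j = amap (vert (tgt f) (push f V)) j"
    using j by (simp add: push_def)
qed (use assms in auto)

lemma vert_empty: "vert {} V = cube_id {}"
  by (intro arr_eqI) auto

definition face :: "cube \<Rightarrow> nat \<Rightarrow> bool \<Rightarrow> arr" where
  "face J j p = Arr J (insert j J) (\<lambda>k\<in>insert j J. if k = j then end_pt p else Var k)"

definition proj :: "cube \<Rightarrow> nat \<Rightarrow> arr" where
  "proj J j = Arr (insert j J) J (\<lambda>k\<in>J. Var k)"

lemma face_simps [simp]: "src (face J j p) = J" "tgt (face J j p) = insert j J"
  "finite J \<Longrightarrow> is_arr (face J j p)"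
  "k = j \<or> k \<in> J \<Longrightarrow> amap (face J j p) k = (if k = j then end_pt p else Var k)"
  by (auto simp: face_def is_arr_def split: if_splits)

lemma proj_simps [simp]: "src (proj J j) = insert j J" "tgt (proj J j) = J"
  "finite J \<Longrightarrow> is_arr (proj J j)" "k \<in> J \<Longrightarrow> amap (proj J j) k = Var k"
  by (auto simp: proj_def is_arr_def)

text \<open>
  Freezing the coordinate \<open>j\<close> is the projection away from \<open>j\<close> followed by the inclusion of a face. This
  is what allows an induction on the dimension that adds one coordinate at a time.
\<close>

lemma face_equations:
  assumes "finite J" and "j \<notin> J"
  shows "cube_comp (face J j p) (proj J j) = freeze (insert j J) j (end_pt p)"
    and "cube_comp (proj J j) (face J j p) = cube_id J"
    and "cube_comp (proj J j) (freeze (insert j J) j (end_pt c)) = proj J j"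
    and "cube_comp (face J j (j \<in> V)) (vert J V) = vert (insert j J) V"
    and "cube_comp (freeze (insert j J) j (end_pt p)) (face J j p) = face J j p"
  using assms by (auto intro!: arr_eqI)

section \<open>Morphisms are determined at a vertex\<close>

locale hom_fibrant_category =
  fixes C :: "(unit, 'u) icat"
  assumes icat: "is_icat terminal_psh C"
    and hom_fibrant: "fibrant (ob2_ctx terminal_psh C) (Hom C)"
    and eq_fibrant: "fibrant (par_ctx terminal_psh C) (eq_fam C)"
    and infinite_type: "infinite (UNIV :: 'u set)"
begin

abbreviation rs :: "arr \<Rightarrow> 'u \<Rightarrow> 'u" where
  "rs f x \<equiv> ob_tr C f () x"

abbreviation rh :: "arr \<Rightarrow> 'u \<Rightarrow> 'u \<Rightarrow> 'u \<Rightarrow> 'u" where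
  "rh f x y m \<equiv> hom_tr C f () x y m"

lemma ctx_simps:
  "(((), x), y) \<in> El (ob2_ctx terminal_psh C) J \<longleftrightarrow> x \<in> ob C J () \<and> y \<in> ob C J ()"
  "act (ob2_ctx terminal_psh C) f (((), x), y) = (((), rs f x), rs f y)"
  "((((((), x), y), m), n) \<in> El (par_ctx terminal_psh C) J) \<longleftrightarrow> x \<in> ob C J () \<and> y \<in> ob C J () \<and>
     m \<in> hom C J () x y \<and> n \<in> hom C J () x y"
  "act (par_ctx terminal_psh C) f (((((), x), y), m), n) = (((((), rs f x), rs f y), rh f x y m), rh f x y n)"
  by (auto simp: ob2_ctx_def par_ctx_def hom_ctx_def ext_def reindex_def terminal_psh_def)

lemma families:
  "family terminal_psh (Ob C)" "family (ob2_ctx terminal_psh C) (Hom C)" "family (par_ctx terminal_psh C) (eq_fam C)"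
  using icat by (auto simp: is_icat_def)

lemma rs_in [simp]: "is_arr f \<Longrightarrow> x \<in> ob C (tgt f) () \<Longrightarrow> rs f x \<in> ob C (src f) ()"
  and rs_id [simp]: "finite J \<Longrightarrow> x \<in> ob C J () \<Longrightarrow> rs (cube_id J) x = x"
  and rs_comp: "is_arr f \<Longrightarrow> is_arr g \<Longrightarrow> tgt g = src f \<Longrightarrow> x \<in> ob C (tgt f) () \<Longrightarrow>
    rs (cube_comp f g) x = rs g (rs f x)"
  using families(1) by (auto simp: family_def)

lemma rh_in [simp]: "is_arr f \<Longrightarrow> x \<in> ob C (tgt f) () \<Longrightarrow> y \<in> ob C (tgt f) () \<Longrightarrow>
    m \<in> hom C (tgt f) () x y \<Longrightarrow> rh f x y m \<in> hom C (src f) () (rs f x) (rs f y)"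
  and rh_id [simp]: "finite J \<Longrightarrow> x \<in> ob C J () \<Longrightarrow> y \<in> ob C J () \<Longrightarrow> m \<in> hom C J () x y \<Longrightarrow>
    rh (cube_id J) x y m = m"
  and rh_comp: "is_arr f \<Longrightarrow> is_arr g \<Longrightarrow> tgt g = src f \<Longrightarrow> x \<in> ob C (tgt f) () \<Longrightarrow> y \<in> ob C (tgt f) () \<Longrightarrow>
    m \<in> hom C (tgt f) () x y \<Longrightarrow> rh (cube_comp f g) x y m = rh g (rs f x) (rs f y) (rh f x y m)"
  using families(2) unfolding family_def
  by (metis ctx_simps(1,2))+

lemma idn_in [simp]: "finite J \<Longrightarrow> x \<in> ob C J () \<Longrightarrow> Idn C J () x \<in> hom C J () x x"
  and comp_in [simp]: "finite J \<Longrightarrow> x \<in> ob C J () \<Longrightarrow> y \<in> ob C J () \<Longrightarrow> z \<in> ob C J () \<Longrightarrow>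
    m \<in> hom C J () x y \<Longrightarrow> n \<in> hom C J () y z \<Longrightarrow> Cmp C J () x y z n m \<in> hom C J () x z"
  and comp_id [simp]: "finite J \<Longrightarrow> x \<in> ob C J () \<Longrightarrow> y \<in> ob C J () \<Longrightarrow> m \<in> hom C J () x y \<Longrightarrow>
    Cmp C J () x x y m (Idn C J () x) = m"
    "finite J \<Longrightarrow> x \<in> ob C J () \<Longrightarrow> y \<in> ob C J () \<Longrightarrow> m \<in> hom C J () x y \<Longrightarrow>
    Cmp C J () x y y (Idn C J () y) m = m"
  and comp_assoc: "finite J \<Longrightarrow> x \<in> ob C J () \<Longrightarrow> y \<in> ob C J () \<Longrightarrow> z \<in> ob C J () \<Longrightarrow> w \<in> ob C J () \<Longrightarrow>
    m \<in> hom C J () x y \<Longrightarrow> n \<in> hom C J () y z \<Longrightarrow> k \<in> hom C J () z w \<Longrightarrow>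
    Cmp C J () x z w k (Cmp C J () x y z n m) = Cmp C J () x y w (Cmp C J () y z w k n) m"
  and EqHom_iff: "finite J \<Longrightarrow> x \<in> ob C J () \<Longrightarrow> y \<in> ob C J () \<Longrightarrow> m \<in> hom C J () x y \<Longrightarrow>
    n \<in> hom C J () x y \<Longrightarrow> EqHom C J () x y m n \<longleftrightarrow> m = n"
  using icat unfolding is_icat_def by simp_all

lemma rh_idn: "is_arr f \<Longrightarrow> x \<in> ob C (tgt f) () \<Longrightarrow> rh f x x (Idn C (tgt f) () x) = Idn C (src f) () (rs f x)"
  and rh_cmp: "is_arr f \<Longrightarrow> x \<in> ob C (tgt f) () \<Longrightarrow> y \<in> ob C (tgt f) () \<Longrightarrow> z \<in> ob C (tgt f) () \<Longrightarrow>
    m \<in> hom C (tgt f) () x y \<Longrightarrow> n \<in> hom C (tgt f) () y z \<Longrightarrow>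
    rh f x z (Cmp C (tgt f) () x y z n m) =
    Cmp C (src f) () (rs f x) (rs f y) (rs f z) (rh f y z n) (rh f x y m)"
  using icat unfolding is_icat_def by simp_all

lemma presheaf_ob2: "presheaf (ob2_ctx terminal_psh C)"
proof -
  have "presheaf (ext terminal_psh (Ob C))"
    using presheaf_ext presheaf_terminal families(1) by blast
  moreover have "family (ext terminal_psh (Ob C)) (reindex (\<lambda>J. fst) (Ob C))"
    using families(1) by (auto simp: family_def ext_def reindex_def)
  ultimately show ?thesis unfolding ob2_ctx_def by (rule presheaf_ext)
qed

lemma presheaf_par: "presheaf (par_ctx terminal_psh C)"
proof -
  have "presheaf (hom_ctx terminal_psh C)"
    unfolding hom_ctx_def using presheaf_ext presheaf_ob2 families(2) by blast
  moreover have "family (hom_ctx terminal_psh C) (reindex (\<lambda>J. fst) (Hom C))"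
    using families(2) by (auto simp: family_def hom_ctx_def ext_def reindex_def)
  ultimately show ?thesis unfolding par_ctx_def by (rule presheaf_ext)
qed

text \<open>
  Fibrancy of \<open>EqHom\<close>: an equality of morphisms at one end of a line holds on the whole line.
\<close>

lemma hom_eq_from_end:
  assumes J: "finite J" and j: "j \<in> J" and x: "x \<in> ob C J ()" and y: "y \<in> ob C J ()"
    and m: "m \<in> hom C J () x y" and n: "n \<in> hom C J () x y"
    and eq: "rh (freeze J j (end_pt e)) x y m = rh (freeze J j (end_pt e)) x y n"
  shows "m = n"
proof -
  let ?f = "freeze J j (end_pt e)"
  have z: "(((((), x), y), m), n) \<in> El (par_ctx terminal_psh C) J" using x y m n by (simp add: ctx_simps)
  have f: "is_arr ?f" using J j by simp
  have "EqHom C J () (rs ?f x) (rs ?f y) (rh ?f x y m) (rh ?f x y n)"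
    using EqHom_iff[OF J] rs_in[OF f] rh_in[OF f] x y m n eq by simp
  then have b: "() \<in> Fib (eq_fam C) J (act (par_ctx terminal_psh C) ?f (((((), x), y), m), n))"
    by (simp add: ctx_simps eq_fam_def)
  obtain w where "w \<in> Fib (eq_fam C) J (((((), x), y), m), n)"
    using fibrant_transport[OF presheaf_par eq_fibrant J j z b] by (auto simp: eq_fam_def)
  then show ?thesis using EqHom_iff[OF J x y m n] by (simp add: eq_fam_def split: if_splits)
qed

text \<open>
  Fibrancy of \<open>Hom\<close>: a morphism at one end of a line extends to the whole line. The path from the weak
  composite to the given morphism is constant, since equality propagates along it.
\<close>

lemma hom_from_end:
  fixes e :: bool
  assumes J: "finite J" and j: "j \<in> J" and x: "x \<in> ob C J ()" and y: "y \<in> ob C J ()"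
  defines "x' \<equiv> rs (freeze J j (end_pt e)) x" and "y' \<equiv> rs (freeze J j (end_pt e)) y"
  assumes m: "m \<in> hom C J () x' y'" and inv: "\<And>c. rh (freeze J j (end_pt c)) x' y' m = m"
  obtains w where "w \<in> hom C J () x y" and "rh (freeze J j (end_pt e)) x y w = m"
proof -
  let ?f = "\<lambda>c. freeze J j (end_pt c)"
  have f: "is_arr (?f c)" for c using J j by simp
  have z: "(((), x), y) \<in> El (ob2_ctx terminal_psh C) J" using x y by (simp add: ctx_simps)
  have z': "act (ob2_ctx terminal_psh C) (?f e) (((), x), y) = (((), x'), y')"
    by (simp add: ctx_simps x'_def y'_def)
  obtain w p where w: "w \<in> hom C J () x y" and p: "p \<in> hom C J () x' y'"
    and wp: "rh (?f e) x y w = rh (?f False) x' y' p" and p1: "rh (?f True) x' y' p = m"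
    using fibrant_transport[OF presheaf_ob2 hom_fibrant J j z, of m e] m inv unfolding z' by auto
  have xy': "x' \<in> ob C J ()" "y' \<in> ob C J ()"
    using rs_in[OF f] x y by (simp_all add: x'_def y'_def)
  \<comment> \<open>\<open>p\<close> is a line of morphisms between objects that do not depend on \<open>j\<close>, and it agrees with \<open>m\<close> at one end.\<close>
  have "p = m" using hom_eq_from_end[OF J j xy' p m, of True] p1 inv by simp
  then show ?thesis using that w wp inv by simp
qed

text \<open>
  By induction on the dimension: \<open>m\<close> and \<open>n\<close> agree on a face through the vertex, hence they agree once the
  coordinate orthogonal to the face is frozen, and equality propagates along this coordinate.
\<close>

lemma hom_eq_from_vertex:
  assumes "finite J" and "x \<in> ob C J ()" and "y \<in> ob C J ()"
    and "m \<in> hom C J () x y" and "n \<in> hom C J () x y"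
    and "rh (vert J V) x y m = rh (vert J V) x y n"
  shows "m = n"
  using assms
proof (induction J arbitrary: x y m n rule: finite_induct)
  case empty
  then show ?case by (simp add: vert_empty)
next
  case (insert j J)
  let ?F = "face J j (j \<in> V)" and ?P = "proj J j"
  note eqs = face_equations[OF insert.hyps]
  note xy = insert.prems(1-4)
  have F: "is_arr ?F" and P: "is_arr ?P" using insert.hyps by simp_all
  have Fx: "rs ?F x \<in> ob C J ()" "rs ?F y \<in> ob C J ()" "rh ?F x y m \<in> hom C J () (rs ?F x) (rs ?F y)"
    "rh ?F x y n \<in> hom C J () (rs ?F x) (rs ?F y)"
    using rs_in[OF F] rh_in[OF F] xy by simp_all
  have "rh (vert J V) (rs ?F x) (rs ?F y) (rh ?F x y k) = rh (vert (insert j J) V) x y k"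
    if "k \<in> hom C (insert j J) () x y" for k
    using rh_comp[OF F, of "vert J V" x y k] insert.hyps xy that eqs(4) by simp
  then have "rh ?F x y m = rh ?F x y n" using insert.IH[OF Fx] insert.prems by simp
  moreover have "rh (freeze (insert j J) j (end_pt (j \<in> V))) x y k = rh ?P (rs ?F x) (rs ?F y) (rh ?F x y k)"
    if "k \<in> hom C (insert j J) () x y" for k
    using rh_comp[OF F P, of x y k] xy that unfolding eqs(1) by simp
  ultimately have "rh (freeze (insert j J) j (end_pt (j \<in> V))) x y m = rh (freeze (insert j J) j (end_pt (j \<in> V))) x y n"
    using xy by simp
  then show ?case using hom_eq_from_end[of "insert j J" j x y m n] insert.hyps xy by simp
qed

text \<open>
  By induction on the dimension: first extend to a face through the vertex, then extend degenerately in the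
  direction \<open>j\<close> orthogonal to the face, and transport along this direction.
\<close>

lemma hom_from_vertex:
  assumes "finite J" and "x \<in> ob C J ()" and "y \<in> ob C J ()"
    and "m \<in> hom C {} () (rs (vert J V) x) (rs (vert J V) y)"
  shows "\<exists>w\<in>hom C J () x y. rh (vert J V) x y w = m"
  using assms
proof (induction J arbitrary: x y rule: finite_induct)
  case empty
  then show ?case by (auto simp: vert_empty)
next
  case (insert j J)
  let ?F = "face J j (j \<in> V)" and ?P = "proj J j" and ?f = "\<lambda>c. freeze (insert j J) j (end_pt c)"
  note eqs = face_equations[OF insert.hyps]
  note xy = insert.prems(1,2)
  have F: "is_arr ?F" and P: "is_arr ?P" and f: "is_arr (?f c)" for c using insert.hyps by simp_all
  have Fx: "rs ?F x \<in> ob C J ()" "rs ?F y \<in> ob C J ()"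
    using rs_in[OF F] xy by simp_all
  have "rs (vert J V) (rs ?F x) = rs (vert (insert j J) V) x" "rs (vert J V) (rs ?F y) = rs (vert (insert j J) V) y"
    using rs_comp[OF F, of "vert J V"] insert.hyps xy eqs(4) by simp_all
  then obtain n where n: "n \<in> hom C J () (rs ?F x) (rs ?F y)" and nm: "rh (vert J V) (rs ?F x) (rs ?F y) n = m"
    using insert.IH[OF Fx] insert.prems(3) by auto
  \<comment> \<open>Being pulled back along the projection, \<open>?b\<close> does not depend on \<open>j\<close>, as transport requires.\<close>
  let ?b = "rh ?P (rs ?F x) (rs ?F y) n"
  have PF: "rs ?P (rs ?F x) = rs (?f (j \<in> V)) x" "rs ?P (rs ?F y) = rs (?f (j \<in> V)) y"
    using rs_comp[OF F P] xy eqs(1) by simp_all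
  have b: "?b \<in> hom C (insert j J) () (rs (?f (j \<in> V)) x) (rs (?f (j \<in> V)) y)"
    using rh_in[OF P, of "rs ?F x" "rs ?F y" n] Fx n unfolding PF by simp
  have "rh (?f c) (rs (?f (j \<in> V)) x) (rs (?f (j \<in> V)) y) ?b = ?b" for c
    using rh_comp[OF P f[of c], of "rs ?F x" "rs ?F y" n] Fx n eqs(3) unfolding PF by simp
  then obtain w where w: "w \<in> hom C (insert j J) () x y" and wb: "rh (?f (j \<in> V)) x y w = ?b"
    using hom_from_end[of "insert j J" j x y ?b "j \<in> V"] insert.hyps xy b by auto
  have "rh ?F x y w = rh ?F (rs (?f (j \<in> V)) x) (rs (?f (j \<in> V)) y) (rh (?f (j \<in> V)) x y w)"
    using rh_comp[OF f[of "j \<in> V"] F, of x y w] xy w eqs(5) by simp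
  also have "\<dots> = rh (cube_comp ?P ?F) (rs ?F x) (rs ?F y) n"
    unfolding wb using rh_comp[OF P F, of "rs ?F x" "rs ?F y" n] Fx n PF by simp
  also have "\<dots> = n" unfolding eqs(2) using insert.hyps Fx n by simp
  finally have "rh ?F x y w = n" .
  then have "rh (vert (insert j J) V) x y w = m"
    using rh_comp[OF F, of "vert J V" x y w] insert.hyps xy w eqs(4) nm by simp
  with w show ?case by blast
qed

end

section \<open>The functor to the nerve\<close>

definition bang :: "cube \<Rightarrow> arr" where
  "bang J = Arr J {} (\<lambda>_. undefined)"

lemma bang_simps [simp]: "src (bang J) = J" "tgt (bang J) = {}" "finite J \<Longrightarrow> is_arr (bang J)"
  by (auto simp: bang_def is_arr_def)

lemma bang_comp:
  assumes "is_arr f"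
  shows "cube_comp (bang (tgt f)) f = bang (src f)"
  using assms finite_tgt[OF assms] finite_src[OF assms] by (intro arr_eqI) auto

lemma bang_vert: "finite J \<Longrightarrow> cube_comp (bang J) (vert J V) = cube_id {}"
  by (intro arr_eqI) auto

context hom_fibrant_category
begin

lemma eval_cat_simps [simp]: "oobj (eval_cat C) = ob C {} ()" "ohom (eval_cat C) = hom C {} ()"
  "oid (eval_cat C) = Idn C {} ()" "ocmp (eval_cat C) = Cmp C {} ()"
  by (auto simp: eval_cat_def)

sublocale N: iso_nerve "eval_cat C"
  by unfold_locales (simp_all add: comp_assoc infinite_type)

lemma rs_vert_in [simp]: "finite J \<Longrightarrow> x \<in> ob C J () \<Longrightarrow> rs (vert J V) x \<in> ob C {} ()"
  using rs_in[of "vert J V" x] by simp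

lemma rh_vert_in [simp]: "finite J \<Longrightarrow> x \<in> ob C J () \<Longrightarrow> y \<in> ob C J () \<Longrightarrow> m \<in> hom C J () x y \<Longrightarrow>
  rh (vert J V) x y m \<in> hom C {} () (rs (vert J V) x) (rs (vert J V) y)"
  using rh_in[of "vert J V" x y m] by simp

lemma rh_vert_cmp: "finite J \<Longrightarrow> x \<in> ob C J () \<Longrightarrow> y \<in> ob C J () \<Longrightarrow> z \<in> ob C J () \<Longrightarrow>
  m \<in> hom C J () x y \<Longrightarrow> n \<in> hom C J () y z \<Longrightarrow>
  rh (vert J V) x z (Cmp C J () x y z n m) =
  Cmp C {} () (rs (vert J V) x) (rs (vert J V) y) (rs (vert J V) z) (rh (vert J V) y z n) (rh (vert J V) x y m)"
  using rh_cmp[of "vert J V" x y z m n] by simp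

lemma rs_bang_in [simp]: "finite J \<Longrightarrow> a \<in> ob C {} () \<Longrightarrow> rs (bang J) a \<in> ob C J ()"
  using rs_in[of "bang J" a] by simp

lemma rh_bang_in [simp]: "finite J \<Longrightarrow> a \<in> ob C {} () \<Longrightarrow> b \<in> ob C {} () \<Longrightarrow> m \<in> hom C {} () a b \<Longrightarrow>
  rh (bang J) a b m \<in> hom C J () (rs (bang J) a) (rs (bang J) b)"
  using rh_in[of "bang J" a b m] by simp

lemma vert_bang [simp]:
  "finite J \<Longrightarrow> a \<in> ob C {} () \<Longrightarrow> rs (vert J V) (rs (bang J) a) = a"
  "finite J \<Longrightarrow> a \<in> ob C {} () \<Longrightarrow> b \<in> ob C {} () \<Longrightarrow> m \<in> hom C {} () a b \<Longrightarrow>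
    rh (vert J V) (rs (bang J) a) (rs (bang J) b) (rh (bang J) a b m) = m"
  using rs_comp[of "bang J" "vert J V" a] rh_comp[of "bang J" "vert J V" a b m] by (simp_all add: bang_vert)

text \<open>
  The constant cube at the value of \<open>x\<close> at a vertex \<open>V\<close> has a unique morphism to \<open>x\<close> that is the
  identity at \<open>V\<close>. Its value at another vertex is the comparison of the values of \<open>x\<close>.
\<close>

definition base :: "cube \<Rightarrow> 'u \<Rightarrow> nat set \<Rightarrow> 'u" where
  "base J x V = rs (bang J) (rs (vert J V) x)"

definition spread :: "cube \<Rightarrow> 'u \<Rightarrow> nat set \<Rightarrow> 'u" where
  "spread J x V = (SOME m. m \<in> hom C J () (base J x V) x \<and>
     rh (vert J V) (base J x V) x m = Idn C {} () (rs (vert J V) x))"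

definition compare :: "cube \<Rightarrow> 'u \<Rightarrow> nat set \<Rightarrow> nat set \<Rightarrow> 'u" where
  "compare J x V W = rh (vert J W) (base J x V) x (spread J x V)"

lemma base_simps [simp]:
  assumes "finite J" and "x \<in> ob C J ()"
  shows "base J x V \<in> ob C J ()" and "rs (vert J W) (base J x V) = rs (vert J V) x"
  using assms by (simp_all add: base_def)

lemma spread:
  assumes "finite J" and "x \<in> ob C J ()"
  shows "spread J x V \<in> hom C J () (base J x V) x"
    and "rh (vert J V) (base J x V) x (spread J x V) = Idn C {} () (rs (vert J V) x)"
proof -
  have "Idn C {} () (rs (vert J V) x) \<in> hom C {} () (rs (vert J V) (base J x V)) (rs (vert J V) x)"
    using assms by simp
  then have "\<exists>m. m \<in> hom C J () (base J x V) x \<and>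
     rh (vert J V) (base J x V) x m = Idn C {} () (rs (vert J V) x)"
    using hom_from_vertex[OF assms(1) base_simps(1)[OF assms] assms(2)] by blast
  from someI_ex[OF this] show "spread J x V \<in> hom C J () (base J x V) x"
    and "rh (vert J V) (base J x V) x (spread J x V) = Idn C {} () (rs (vert J V) x)"
    unfolding spread_def by blast+
qed

lemma compare_in [simp]:
  assumes "finite J" and "x \<in> ob C J ()"
  shows "compare J x V W \<in> hom C {} () (rs (vert J V) x) (rs (vert J W) x)"
  using rh_vert_in[OF assms(1) base_simps(1)[OF assms] assms(2) spread(1)[OF assms]] assms
  by (simp add: compare_def)

lemma compare_same [simp]:
  assumes "finite J" and "x \<in> ob C J ()"
  shows "compare J x V V = Idn C {} () (rs (vert J V) x)"
  using spread(2)[OF assms] by (simp add: compare_def)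

text \<open>
  A morphism out of a constant cube is determined at one vertex \<open>V\<close>, hence it is the composite of its
  constant value at \<open>V\<close> with \<open>spread\<close>. The functor laws of \<open>compare\<close> and the naturality of the
  components of a morphism are both instances.
\<close>

lemma compare_from_constant:
  assumes J: "finite J" and a: "a \<in> ob C {} ()" and y: "y \<in> ob C J ()"
    and m: "m \<in> hom C J () (rs (bang J) a) y"
  shows "rh (vert J W) (rs (bang J) a) y m =
    Cmp C {} () a (rs (vert J V) y) (rs (vert J W) y) (compare J y V W) (rh (vert J V) (rs (bang J) a) y m)"
proof -
  let ?mV = "rh (vert J V) (rs (bang J) a) y m"
  have mV: "?mV \<in> hom C {} () a (rs (vert J V) y)"
    using rh_vert_in[OF J rs_bang_in[OF J a] y m] J a by simp
  have yV: "rs (vert J V) y \<in> ob C {} ()" using J y by simp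
  let ?b = "rh (bang J) a (rs (vert J V) y) ?mV"
  let ?n = "Cmp C J () (rs (bang J) a) (base J y V) y (spread J y V) ?b"
  have b: "?b \<in> hom C J () (rs (bang J) a) (base J y V)" using rh_bang_in[OF J a yV mV] by (simp add: base_def)
  have bW: "rh (vert J W) (rs (bang J) a) (base J y V) ?b = ?mV" for W
    unfolding base_def using vert_bang(2)[OF J a yV mV] .
  have n: "?n \<in> hom C J () (rs (bang J) a) y"
    using comp_in[OF J rs_bang_in[OF J a] base_simps(1)[OF J y] y b spread(1)[OF J y]] .
  have nW: "rh (vert J W) (rs (bang J) a) y ?n =
      Cmp C {} () a (rs (vert J V) y) (rs (vert J W) y) (compare J y V W) ?mV" for W
    using rh_vert_cmp[OF J rs_bang_in[OF J a] base_simps(1)[OF J y] y b spread(1)[OF J y], of W] J a y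
    by (simp add: bW compare_def)
  have "rh (vert J V) (rs (bang J) a) y m = rh (vert J V) (rs (bang J) a) y ?n"
    unfolding nW using comp_id(2)[OF _ a yV mV] J y by simp
  then have "m = ?n" by (rule hom_eq_from_vertex[OF J rs_bang_in[OF J a] y m n])
  then show ?thesis using nW[of W] by simp
qed

lemma compare_compose:
  assumes J: "finite J" and x: "x \<in> ob C J ()"
  shows "Cmp C {} () (rs (vert J V) x) (rs (vert J W) x) (rs (vert J Z) x) (compare J x W Z) (compare J x V W) =
    compare J x V Z"
  using compare_from_constant[OF J rs_vert_in[OF J x] x spread(1)[OF J x, unfolded base_def], of Z V W]
  by (simp add: compare_def base_def)

lemma compare_natural:
  assumes J: "finite J" and x: "x \<in> ob C J ()" and y: "y \<in> ob C J ()" and f: "f \<in> hom C J () x y"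
  shows "Cmp C {} () (rs (vert J V) x) (rs (vert J V) y) (rs (vert J W) y) (compare J y V W) (rh (vert J V) x y f) =
    Cmp C {} () (rs (vert J V) x) (rs (vert J W) x) (rs (vert J W) y) (rh (vert J W) x y f) (compare J x V W)"
proof -
  note b = base_simps(1)[OF J x] and s = spread(1)[OF J x]
  let ?m = "Cmp C J () (base J x V) x y f (spread J x V)"
  have m: "?m \<in> hom C J () (base J x V) y" using comp_in[OF J b x y s f] .
  have mW: "rh (vert J W) (base J x V) y ?m =
      Cmp C {} () (rs (vert J V) x) (rs (vert J W) x) (rs (vert J W) y) (rh (vert J W) x y f) (compare J x V W)" for W
    using rh_vert_cmp[OF J b x y s f, of W] J x by (simp add: compare_def)
  have "rh (vert J V) (base J x V) y ?m = rh (vert J V) x y f"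
    unfolding mW using J x y f by simp
  then show ?thesis
    using compare_from_constant[OF J rs_vert_in[OF J x] y m[unfolded base_def], of W V] mW[of W]
    by (simp add: base_def)
qed

lemma vert_res:
  assumes "is_arr u" and "x \<in> ob C (tgt u) ()"
  shows "rs (vert (src u) V) (rs u x) = rs (vert (tgt u) (push u V)) x"
    and "y \<in> ob C (tgt u) () \<Longrightarrow> m \<in> hom C (tgt u) () x y \<Longrightarrow>
      rh (vert (src u) V) (rs u x) (rs u y) (rh u x y m) = rh (vert (tgt u) (push u V)) x y m"
  using rs_comp[of u "vert (src u) V" x] rh_comp[of u "vert (src u) V" x y m] assms
  by (simp_all add: comp_vert)

text \<open>
  The restriction of \<open>spread\<close> has the property that characterises \<open>spread\<close>.
\<close>

lemma compare_res:
  assumes u: "is_arr u" and x: "x \<in> ob C (tgt u) ()"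
  shows "compare (src u) (rs u x) V W = compare (tgt u) x (push u V) (push u W)"
proof -
  let ?K = "src u" and ?J = "tgt u"
  have K: "finite ?K" and J: "finite ?J" using u by simp_all
  have ux: "rs u x \<in> ob C ?K ()" using u x by simp
  let ?s = "spread ?J x (push u V)" and ?b = "base ?J x (push u V)"
  note b = base_simps(1)[OF J x, of "push u V"] and s = spread(1)[OF J x, of "push u V"]
  have bu: "rs u ?b = base ?K (rs u x) V"
    using rs_comp[of "bang ?J" u "rs (vert ?J (push u V)) x"] u x J K
    by (simp add: base_def bang_comp vert_res(1)[OF u x])
  have su: "rh u ?b x ?s \<in> hom C ?K () (base ?K (rs u x) V) (rs u x)"
    using rh_in[OF u b x s] by (simp add: bu)
  have sW: "rh (vert ?K W) (base ?K (rs u x) V) (rs u x) (rh u ?b x ?s) = rh (vert ?J (push u W)) ?b x ?s" for W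
    using vert_res(2)[OF u b x s, of W] by (simp add: bu)
  have "rh u ?b x ?s = spread ?K (rs u x) V"
  proof (rule hom_eq_from_vertex[OF K base_simps(1)[OF K ux] ux su spread(1)[OF K ux], where V = V])
    show "rh (vert ?K V) (base ?K (rs u x) V) (rs u x) (rh u ?b x ?s) =
      rh (vert ?K V) (base ?K (rs u x) V) (rs u x) (spread ?K (rs u x) V)"
      unfolding sW spread(2)[OF K ux] spread(2)[OF J x] vert_res(1)[OF u x] ..
  qed
  then show ?thesis using sW[of W] by (simp add: compare_def)
qed

definition to_nerve :: "(unit, 'u) ifun" where
  "to_nerve = \<lparr>FOb = \<lambda>J _ x. mk_ob J (\<lambda>V. rs (vert J V) x) (compare J x),
               FHom = \<lambda>J _ x y f. mk_hom J (\<lambda>V. rh (vert J V) x y f)\<rparr>"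

lemma to_nerve_simps [simp]:
  "FOb to_nerve J \<gamma> x = mk_ob J (\<lambda>V. rs (vert J V) x) (compare J x)"
  "FHom to_nerve J \<gamma> x y f = mk_hom J (\<lambda>V. rh (vert J V) x y f)"
  by (simp_all add: to_nerve_def)

lemma to_nerve_ob:
  assumes "finite J" and "x \<in> ob C J ()"
  shows "mk_ob J (\<lambda>V. rs (vert J V) x) (compare J x) \<in> nerve_ob (eval_cat C) J"
  using assms by (intro N.mk_ob_in) (auto simp: chaotic_functor_def compare_compose)

lemma to_nerve_hom:
  assumes "finite J" and "x \<in> ob C J ()" and "y \<in> ob C J ()" and "f \<in> hom C J () x y"
  shows "mk_hom J (\<lambda>V. rh (vert J V) x y f) \<in> nerve_hom (eval_cat C) J
    (mk_ob J (\<lambda>V. rs (vert J V) x) (compare J x)) (mk_ob J (\<lambda>V. rs (vert J V) y) (compare J y))"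
  using assms by (intro N.mk_hom_in) (auto simp: natural_cpts_def compare_natural)

theorem to_nerve_is_ifun: "is_ifun terminal_psh C (nerve (eval_cat C)) to_nerve"
proof -
  have id: "FHom to_nerve J () x x (Idn C J () x) = Idn (nerve (eval_cat C)) J () (FOb to_nerve J () x)"
    if "finite J" "x \<in> ob C J ()" for J x
    using that rh_idn[of "vert J _" x] by (auto intro!: N.mk_hom_cong)
  have cmp: "FHom to_nerve J () x z (Cmp C J () x y z g f) =
      Cmp (nerve (eval_cat C)) J () (FOb to_nerve J () x) (FOb to_nerve J () y) (FOb to_nerve J () z)
        (FHom to_nerve J () y z g) (FHom to_nerve J () x y f)"
    if "finite J" "x \<in> ob C J ()" "y \<in> ob C J ()" "z \<in> ob C J ()" "f \<in> hom C J () x y" "g \<in> hom C J () y z"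
    for J x y z f g
    using that by (auto simp: rh_vert_cmp intro!: N.mk_hom_cong)
  have ob: "ob_tr (nerve (eval_cat C)) u () (FOb to_nerve (tgt u) () x) = FOb to_nerve (src u) () (rs u x)"
    if "is_arr u" "x \<in> ob C (tgt u) ()" for u x
    using that unfolding nerve_simps res_ob_def
    by (auto simp: vert_res compare_res intro!: N.mk_ob_cong)
  have hom: "hom_tr (nerve (eval_cat C)) u () (FOb to_nerve (tgt u) () x) (FOb to_nerve (tgt u) () y)
      (FHom to_nerve (tgt u) () x y f) = FHom to_nerve (src u) () (rs u x) (rs u y) (rh u x y f)"
    if "is_arr u" "x \<in> ob C (tgt u) ()" "y \<in> ob C (tgt u) ()" "f \<in> hom C (tgt u) () x y" for u x y f
    using that unfolding nerve_simps res_hom_def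
    by (auto simp: vert_res intro!: N.mk_hom_cong)
  show ?thesis
    unfolding is_ifun_def
    using id cmp ob hom by (simp add: to_nerve_ob to_nerve_hom EqHom_iff del: nerve_simps(6,7))
qed

text \<open>
  A cube of dimension zero has a single vertex, so over it the nerve is the original category.
\<close>

theorem to_nerve_weak_equivalence:
  "weak_equivalence (eval_cat C) (eval_cat (nerve (eval_cat C))) (eval_fun to_nerve)"
  unfolding weak_equivalence_def
proof
  have e: "finite ({} :: cube)" by simp
  let ?E = "eval_cat C"
  have v: "rs (vert {} V) x = x" if "x \<in> ob C {} ()" for V x
    using that by (simp add: vert_empty)
  have vh: "rh (vert {} V) x y f = f" if "x \<in> ob C {} ()" "y \<in> ob C {} ()" "f \<in> hom C {} () x y" for V x y f
    using that by (simp add: vert_empty)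
  show "essentially_surjective ?E (eval_cat (nerve ?E)) (eval_fun to_nerve)"
    unfolding essentially_surjective_def
  proof
    fix d assume "d \<in> oobj (eval_cat (nerve ?E))"
    then have d: "d \<in> nerve_ob ?E {}" by (simp add: eval_cat_def)
    let ?c = "vtx {} d {}"
    have c: "?c \<in> ob C {} ()" using N.nerve_obD(1)[OF d] by simp
    have "FOb to_nerve {} () ?c = d"
      using to_nerve_ob[OF e c] N.nerve_obD(2)[OF d] c
      by (intro N.nerve_ob_eqI[OF e _ d]) (auto simp: v)
    moreover have "isomorphic_in (eval_cat (nerve ?E)) d d"
      using N.nerve_id_in[OF e d] N.nerve_id_laws(1)[OF e d d N.nerve_id_in[OF e d], of "()"]
      by (auto simp: isomorphic_in_def eval_cat_def simp del: nerve_simps(7))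
    ultimately show "\<exists>c\<in>oobj ?E. isomorphic_in (eval_cat (nerve ?E)) (oFob (eval_fun to_nerve) c) d"
      using c by (auto simp: eval_fun_def intro!: bexI[of _ ?c])
  qed
  show "fully_faithful ?E (eval_cat (nerve ?E)) (eval_fun to_nerve)"
    unfolding fully_faithful_def
  proof (intro ballI)
    fix x y assume "x \<in> oobj ?E" "y \<in> oobj ?E"
    then have xy: "x \<in> ob C {} ()" "y \<in> ob C {} ()" by simp_all
    let ?X = "mk_ob {} (\<lambda>V. rs (vert {} V) x) (compare {} x)" and ?Y = "mk_ob {} (\<lambda>V. rs (vert {} V) y) (compare {} y)"
    let ?F = "\<lambda>f. mk_hom {} (\<lambda>V. rh (vert {} V) x y f)"
    have "bij_betw ?F (hom C {} () x y) (nerve_hom ?E {} ?X ?Y)"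
    proof (rule bij_betwI[where g = "\<lambda>m. cpt {} m {}"])
      show "?F \<in> hom C {} () x y \<rightarrow> nerve_hom ?E {} ?X ?Y" using to_nerve_hom[OF e xy] by blast
      show "(\<lambda>m. cpt {} m {}) \<in> nerve_hom ?E {} ?X ?Y \<rightarrow> hom C {} () x y"
        using N.nerve_homD(1)[of _ "{}" ?X ?Y "{}"] xy by (auto simp: v)
      show "cpt {} (?F f) {} = f" if "f \<in> hom C {} () x y" for f using that xy by (simp add: vh)
      show "?F (cpt {} m {}) = m" if m: "m \<in> nerve_hom ?E {} ?X ?Y" for m
      proof (rule N.nerve_hom_eqI[OF e _ m])
        have c: "cpt {} m {} \<in> hom C {} () x y" using N.nerve_homD(1)[OF m, of "{}"] xy by (simp add: v)
        show "?F (cpt {} m {}) \<in> nerve_hom ?E {} ?X ?Y" using to_nerve_hom[OF e xy c] .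
        show "cpt {} (?F (cpt {} m {})) V = cpt {} m V" if "V \<subseteq> {}" for V
          using that c xy by (simp add: vh)
      qed
    qed
    then show "bij_betw (oFhom (eval_fun to_nerve) x y) (ohom ?E x y)
        (ohom (eval_cat (nerve ?E)) (oFob (eval_fun to_nerve) x) (oFob (eval_fun to_nerve) y))"
      by (simp add: eval_fun_def eval_cat_def[of "nerve _"] to_nerve_def)
  qed
qed

theorem nerve_strict_rezk_completion: "strict_rezk_completion C (nerve (eval_cat C)) to_nerve"
  unfolding strict_rezk_completion_def fibrant_components_def
  using N.nerve_is_icat N.nerve_ob_fibrant N.nerve_hom_fibrant N.nerve_eq_fibrant N.nerve_complete
    to_nerve_is_ifun to_nerve_weak_equivalence by blast

end

theorem theorem3p37:
  fixes C :: "(unit, 'u) icat"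
  assumes "infinite (UNIV :: 'u set)"
    and "is_icat terminal_psh C"
    and "algebraically_cofibrant C"
    and "fibrant_components C"
  shows "\<exists>(D :: (unit, 'u) icat) (i :: (unit, 'u) ifun). strict_rezk_completion C D i"
proof -
  interpret hom_fibrant_category C
    using assms by unfold_locales (auto simp: fibrant_components_def)
  show ?thesis using nerve_strict_rezk_completion by blast
qed

end
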